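(* Consider the stochastic Schrödinger equation $$\mathrm{i}\,\mathrm{d}u(t)=\Delta u(t)\,\mathrm{d}t+F(u(t))\,\mathrm{d}t+\alpha\,\mathrm{d}W^Q(t),\qquad u(0)=u_0,$$ on the torus $\mathbb{T}^d$, with trace class covariance operator $Q$ and deterministic initial value $u_0\in L^2$, and apply to it the splitting scheme $$u_{n+1}=S(\tau)\bigl(\Phi_\tau(u_n)-\mathrm{i}\alpha\,\delta W_n^Q\bigr),\qquad \Phi_t(u)=\mathrm{e}^{-\mathrm{i}tV[u]}u .$$ Assume that $F(u)=V[u]u$, where $V[u]=V[\bar u]$ is real-valued, and that Assumption 1 (stated in the context) holds. Then there exists $\kappa>0$ such that for all $\mu,T\in(0,\infty)$ with $\mu\alpha^2T<\frac{\kappa}{\mathrm{Tr}(Q)}$ one has, for the exact solution, $$\sup_{0\le t\le T}\mathbb{E}\left[\exp\left(\mu\|u(t)\|_{L^2}^2\right)\right]\le C(\mu,T,\alpha,Q,u_0)<\infty,$$ and there exists $\tau^\star>0$ such that, for the numerical solution, $$\sup_{\tau\in(0,\tau^\star)}\ \sup_{0\le n\tau\le T}\mathbb{E}\left[\exp\left(\mu\|u_n\|_{L^2}^2\right)\right]\le C(\mu,T,\alpha,Q,u_0)<\infty .$$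
   Context: $\mathbb{T}^d$ is the $d$-dimensional torus; $L^2=L^2(\mathbb{T}^d;\mathbb{C})$ with $\langle u,v\rangle=\int_{\mathbb{T}^d}\bar u(x)v(x)\,\mathrm{d}x$, $\|u\|_{L^2}^2=\langle u,u\rangle$; $H^1=H^1(\mathbb{T}^d)$ is the Sobolev space; $\alpha>0$ is a real parameter; $S(t)=\mathrm{e}^{-\mathrm{i}t\Delta}$. Noise: $W^Q(t)=\sum_{k\in\mathbb{N}}\gamma_k\beta_k(t)e_k$, where $(e_k)$ is a complete orthonormal system of $L^2$, $(\beta_k)$ are independent real-valued standard Wiener processes on a stochastic basis $(\Omega,\mathcal{F},\mathbb{P},(\mathcal{F}(t))_{t\ge0})$, and $(\gamma_k)$ are complex numbers with $\sum_k|\gamma_k|^2<\infty$. $Q^{1/2}e_k=\gamma_ke_k$ and $\mathrm{Tr}(Q):=\sum_k|\gamma_k|^2$. Exact solution: $u$ is the unique mild solution, i.e. the adapted continuous $L^2$-valued process with $$u(t)=S(t)u_0-\mathrm{i}\int_0^tS(t-s)F(u(s))\,\mathrm{d}s-\mathrm{i}\alpha\int_0^tS(t-s)\,\mathrm{d}W^Q(s),\quad t\ge0.$$ Scheme: $\tau\in(0,1)$ is the time-step size, the recursion starts from $u_0$, and $\delta W_n^Q=W^Q((n+1)\tau)-W^Q(n\tau)$. Assumption 1: $\sum_k|\gamma_k|^2\|e_k\|_{H^1}^2<\infty$. $F(u)=V[u]u$ for all $u\in L^2$, where $V$ maps each $u\in L^2$ to a real-valued function $V[u]$ on $\mathbb{T}^d$,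 and $V[u_1]=V[u_2]$ if $|u_1|=|u_2|$. There exist $C_F,K_F\in(0,\infty)$ such that for all $u_1,u_2\in L^2$, $$\|F(u_2)-F(u_1)\|_{L^2}\le\left(C_F+K_F(\|u_1\|_{L^2}^2+\|u_2\|_{L^2}^2)\right)\|u_2-u_1\|_{L^2}.$$ There exist $C_1\in(0,\infty)$ and a polynomial $P_1$ such that for all $u\in H^1$, $$\|F(u)\|_{H^1}\le C_1\|u\|_{H^1}(1+\|u\|_{L^2}^2),\qquad |\mathrm{Im}\langle\nabla u,\nabla F(u)\rangle|\le C_1\|\nabla u\|_{L^2}^2+P_1(\|u\|_{L^2}^2).$$ *)

theory Defs
  imports "HOL-Probability.Probability" "HOL-Computational_Algebra.Polynomial"
begin

section \<open>The complex Hilbert space of square integrable functions on the torus\<close>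

text \<open>
  The torus is \<open>(\<real> / 2\<pi>\<int>)\<^sup>d\<close>. Up to a null set, its functions are functions on
  the cube \<open>[0, 2\<pi>]\<^sup>d\<close>, with (completed, unnormalised) Lebesgue measure.
  The dimension \<open>d \<ge> 1\<close> is the cardinality of the index type.
\<close>

abbreviation torus :: "(real ^ 'd::finite) measure" where
  "torus \<equiv> lebesgue_on (cbox 0 (\<chi> j. 2 * pi))"

definition square_integrable :: "(real ^ 'd::finite \<Rightarrow> complex) \<Rightarrow> bool" where
  "square_integrable f \<longleftrightarrow>
     f \<in> borel_measurable torus \<and> integrable torus (\<lambda>x. (cmod (f x))\<^sup>2)"

lemma square_integrable_mult:
  assumes "square_integrable f" "square_integrable g"
  shows "integrable torus (\<lambda>x. cnj (f x) * g x)"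
proof (rule Bochner_Integration.integrable_bound)
  show "integrable torus (\<lambda>x. (cmod (f x))\<^sup>2 + (cmod (g x))\<^sup>2)"
    using assms by (auto simp: square_integrable_def)
  have [measurable]: "f \<in> borel_measurable torus" "g \<in> borel_measurable torus"
    using assms by (auto simp: square_integrable_def)
  have "cnj \<in> borel_measurable borel"
    by (intro borel_measurable_continuous_onI continuous_intros)
  then have [measurable]: "(\<lambda>x. cnj (f x)) \<in> borel_measurable torus"
    by (rule measurable_compose[rotated]) simp
  show "(\<lambda>x. cnj (f x) * g x) \<in> borel_measurable torus" by measurable
  have "cmod (f x) * cmod (g x) \<le> (cmod (f x))\<^sup>2 + (cmod (g x))\<^sup>2" for x
    using sum_squares_bound[of "cmod (f x)" "cmod (g x)"]
      mult_nonneg_nonneg[OF norm_ge_zero[of "f x"] norm_ge_zero[of "g x"]] by linarith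
  then show "AE x in torus. norm (cnj (f x) * g x) \<le> norm ((cmod (f x))\<^sup>2 + (cmod (g x))\<^sup>2)"
    by (simp add: norm_mult)
qed

lemma square_integrable_add:
  assumes "square_integrable f" "square_integrable g"
  shows "square_integrable (\<lambda>x. f x + g x)"
  unfolding square_integrable_def
proof
  have [measurable]: "f \<in> borel_measurable torus" "g \<in> borel_measurable torus"
    using assms by (auto simp: square_integrable_def)
  show "(\<lambda>x. f x + g x) \<in> borel_measurable torus" by measurable
  show "integrable torus (\<lambda>x. (cmod (f x + g x))\<^sup>2)"
  proof (rule Bochner_Integration.integrable_bound)
    show "integrable torus (\<lambda>x. 2 * (cmod (f x))\<^sup>2 + 2 * (cmod (g x))\<^sup>2)"
      using assms by (auto simp: square_integrable_def)
    show "(\<lambda>x. (cmod (f x + g x))\<^sup>2) \<in> borel_measurable torus" by measurable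
    have "(cmod (f x + g x))\<^sup>2 \<le> 2 * (cmod (f x))\<^sup>2 + 2 * (cmod (g x))\<^sup>2" for x
    proof -
      have "(cmod (f x + g x))\<^sup>2 \<le> (cmod (f x) + cmod (g x))\<^sup>2"
        by (intro power_mono norm_triangle_ineq) auto
      also have "\<dots> \<le> 2 * (cmod (f x))\<^sup>2 + 2 * (cmod (g x))\<^sup>2"
        using sum_squares_bound[of "cmod (f x)" "cmod (g x)"] by (simp add: power2_sum)
      finally show ?thesis .
    qed
    then show "AE x in torus. norm ((cmod (f x + g x))\<^sup>2) \<le>
        norm (2 * (cmod (f x))\<^sup>2 + 2 * (cmod (g x))\<^sup>2)"
      by simp
  qed
qed

lemma square_integrable_scale:
  assumes "square_integrable f"
  shows "square_integrable (\<lambda>x. c * f x)"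
  using assms by (auto simp: square_integrable_def norm_mult power_mult_distrib)

lemma square_integrable_zero: "square_integrable (\<lambda>x. 0)"
  by (simp add: square_integrable_def)

lemma square_integrable_diff:
  assumes "square_integrable f" "square_integrable g"
  shows "square_integrable (\<lambda>x. f x - g x)"
  using square_integrable_add[OF assms(1) square_integrable_scale[OF assms(2), of "-1"]] by simp

quotient_type (overloaded) 'd L2 = "real ^ 'd::finite \<Rightarrow> complex" /
  partial: "\<lambda>f g. square_integrable f \<and> square_integrable g \<and> (AE x in torus. f x = g x)"
proof (rule part_equivpI)
  show "\<exists>f::real ^ 'd \<Rightarrow> complex.
      square_integrable f \<and> square_integrable f \<and> (AE x in torus. f x = f x)"
    using square_integrable_zero by blast
  show "symp (\<lambda>f g::real ^ 'd \<Rightarrow> complex.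
      square_integrable f \<and> square_integrable g \<and> (AE x in torus. f x = g x))"
    by (auto simp: symp_def)
  show "transp (\<lambda>f g::real ^ 'd \<Rightarrow> complex.
      square_integrable f \<and> square_integrable g \<and> (AE x in torus. f x = g x))"
    by (auto simp: transp_def)
qed

lift_definition cinner :: "'d::finite L2 \<Rightarrow> 'd L2 \<Rightarrow> complex"
  is "\<lambda>f g. LINT x|torus. cnj (f x) * g x"
proof -
  fix f f' g g' :: "real ^ 'd \<Rightarrow> complex"
  assume *: "square_integrable f \<and> square_integrable f' \<and> (AE x in torus. f x = f' x)"
    "square_integrable g \<and> square_integrable g' \<and> (AE x in torus. g x = g' x)"
  have "AE x in torus. cnj (f x) * g x = cnj (f' x) * g' x"
    using conjunct2[OF conjunct2[OF *(1)]] conjunct2[OF conjunct2[OF *(2)]] by eventually_elim simp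
  then show "(LINT x|torus. cnj (f x) * g x) = (LINT x|torus. cnj (f' x) * g' x)"
    using * by (intro integral_cong_AE borel_measurable_integrable square_integrable_mult) auto
qed

lift_definition scaleC :: "complex \<Rightarrow> 'd::finite L2 \<Rightarrow> 'd L2" (infixr \<open>*\<^sub>C\<close> 75)
  is "\<lambda>c f x. c * f x"
  by (auto intro: square_integrable_scale)

instantiation L2 :: (finite) real_inner
begin

lift_definition zero_L2 :: "'a L2" is "\<lambda>x. 0"
  by (auto simp: square_integrable_zero)

lift_definition plus_L2 :: "'a L2 \<Rightarrow> 'a L2 \<Rightarrow> 'a L2" is "\<lambda>f g x. f x + g x"
  by (auto intro: square_integrable_add)

lift_definition minus_L2 :: "'a L2 \<Rightarrow> 'a L2 \<Rightarrow> 'a L2" is "\<lambda>f g x. f x - g x"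
  by (auto intro: square_integrable_diff)

definition uminus_L2 :: "'a L2 \<Rightarrow> 'a L2" where "uminus_L2 u = scaleC (-1) u"
definition scaleR_L2 :: "real \<Rightarrow> 'a L2 \<Rightarrow> 'a L2" where "scaleR_L2 r u = scaleC (of_real r) u"
definition inner_L2 :: "'a L2 \<Rightarrow> 'a L2 \<Rightarrow> real" where "inner_L2 u v = Re (cinner u v)"
definition norm_L2 :: "'a L2 \<Rightarrow> real" where "norm_L2 u = sqrt (Re (cinner u u))"
definition dist_L2 :: "'a L2 \<Rightarrow> 'a L2 \<Rightarrow> real" where "dist_L2 u v = norm (u - v)"
definition sgn_L2 :: "'a L2 \<Rightarrow> 'a L2" where "sgn_L2 u = inverse (norm u) *\<^sub>R u"
definition uniformity_L2 :: "('a L2 \<times> 'a L2) filter"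
  where "uniformity_L2 = (INF e\<in>{0<..}. principal {(x, y). dist x y < e})"
definition open_L2 :: "'a L2 set \<Rightarrow> bool"
  where "open_L2 U \<longleftrightarrow> (\<forall>x\<in>U. eventually (\<lambda>(x', y). x' = x \<longrightarrow> y \<in> U) uniformity)"

instance
proof
  fix u v w :: "'a L2" and r s :: real
  show "u + v + w = u + (v + w)"
    by transfer (auto intro!: square_integrable_add simp: add.assoc)
  show "u + v = v + u"
    by transfer (auto intro!: square_integrable_add simp: add.commute)
  show "0 + u = u" by transfer simp
  show "- u + u = 0"
    unfolding uminus_L2_def
    by transfer (auto intro!: square_integrable_zero)
  show "u - v = u + - v"
    unfolding uminus_L2_def
    by transfer (auto intro!: square_integrable_diff)
  show "r *\<^sub>R (u + v) = r *\<^sub>R u + r *\<^sub>R v"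
    unfolding scaleR_L2_def
    by transfer (auto intro!: square_integrable_add square_integrable_scale simp: distrib_left)
  show "(r + s) *\<^sub>R u = r *\<^sub>R u + s *\<^sub>R u"
    unfolding scaleR_L2_def
    by transfer (auto intro!: square_integrable_add square_integrable_scale simp: distrib_right)
  show "r *\<^sub>R s *\<^sub>R u = (r * s) *\<^sub>R u"
    unfolding scaleR_L2_def
    by transfer (auto intro!: square_integrable_scale simp: mult.assoc)
  show "1 *\<^sub>R u = u"
    unfolding scaleR_L2_def by transfer simp
  show "dist u v = norm (u - v)" by (rule dist_L2_def)
  show "sgn u = inverse (norm u) *\<^sub>R u" by (rule sgn_L2_def)
  show "norm u = sqrt (inner u u)" by (simp add: norm_L2_def inner_L2_def)
  show "inner u v = inner v u"
  proof -
    have "(LINT x|torus. cnj (f x) * g x) = cnj (LINT x|torus. cnj (g x) * f x)"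
      for f g :: "real ^ 'a \<Rightarrow> complex"
    proof -
      have "cnj (LINT x|torus. cnj (g x) * f x) = (LINT x|torus. cnj (cnj (g x) * f x))"
        by (rule Bochner_Integration.integral_cnj[symmetric])
      then show ?thesis by (simp add: mult.commute)
    qed
    then have "cinner u v = cnj (cinner v u)" by transfer blast
    then show ?thesis by (simp add: inner_L2_def)
  qed
  show "inner (u + v) w = inner u w + inner v w"
    unfolding inner_L2_def
    by transfer (simp add: distrib_right square_integrable_mult)
  show "inner (r *\<^sub>R u) v = r * inner u v"
    unfolding inner_L2_def scaleR_L2_def
    by transfer (simp add: mult.assoc)
  have sq: "Re (LINT x|torus. cnj (f x) * f x) = (LINT x|torus. (cmod (f x))\<^sup>2)"
    for f :: "real ^ 'a \<Rightarrow> complex"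
  proof -
    have "(\<lambda>x. cnj (f x) * f x) = (\<lambda>x. complex_of_real ((cmod (f x))\<^sup>2))"
      by (rule ext) (simp only: complex_norm_square mult.commute)
    then show ?thesis by (simp only: integral_complex_of_real Re_complex_of_real)
  qed
  show "0 \<le> inner u u"
    unfolding inner_L2_def by transfer (simp add: sq)
  show "inner u u = 0 \<longleftrightarrow> u = 0"
    unfolding inner_L2_def
  proof transfer
    fix f :: "real ^ 'a \<Rightarrow> complex"
    assume f: "square_integrable f \<and> square_integrable f \<and> (AE x in torus. f x = f x)"
    have "(LINT x|torus. (cmod (f x))\<^sup>2) = 0 \<longleftrightarrow> (AE x in torus. (cmod (f x))\<^sup>2 = 0)"
      using f by (intro integral_nonneg_eq_0_iff_AE) (auto simp: square_integrable_def)
    then show "(Re (LINT x|torus. cnj (f x) * f x) = 0) =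
        (square_integrable f \<and> square_integrable (\<lambda>x. 0) \<and> (AE x in torus. f x = 0))"
      using f by (simp add: sq square_integrable_zero)
  qed
qed (simp_all add: uniformity_L2_def open_L2_def)

end

definition complete_orthonormal :: "(nat \<Rightarrow> 'd::finite L2) \<Rightarrow> bool" where
  "complete_orthonormal e \<longleftrightarrow>
     (\<forall>j k. cinner (e j) (e k) = (if j = k then 1 else 0)) \<and>
     (\<forall>u. (\<forall>k. cinner (e k) u = 0) \<longrightarrow> u = 0)"


section \<open>Free Schroedinger group and first order Sobolev space\<close>

lift_definition fourier_mode :: "int ^ 'd \<Rightarrow> 'd::finite L2" is
  "\<lambda>k x. complex_of_real (1 / sqrt ((2 * pi) ^ CARD('d))) * cis (\<Sum>j\<in>UNIV. of_int (k $ j) * x $ j)"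
proof -
  fix k :: "int ^ 'd"
  let ?f = "\<lambda>x :: real ^ 'd. complex_of_real (1 / sqrt ((2 * pi) ^ CARD('d))) *
    cis (\<Sum>j\<in>UNIV. of_int (k $ j) * x $ j)"
  have "continuous_on UNIV ?f"
    by (intro continuous_intros)
  then have "?f \<in> borel_measurable borel"
    by (rule borel_measurable_continuous_onI)
  then have "?f \<in> borel_measurable torus"
    by (intro measurable_restrict_space1 measurable_completion) simp
  moreover have "integrable torus (\<lambda>x. (cmod (?f x))\<^sup>2)"
    using finite_measure.integrable_const[OF finite_measure_lebesgue_on[OF lmeasurable_cbox]]
    by (simp only: norm_mult norm_cis norm_of_real mult_1_right)
  ultimately show "square_integrable ?f \<and> square_integrable ?f \<and> (AE x in torus. ?f x = ?f x)"
    by (simp add: square_integrable_def)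
qed

text \<open>
  \<open>S(t) = exp (- i t \<Delta>)\<close>, by functional calculus: the Fourier mode with index \<open>k\<close>
  is an eigenfunction of \<open>\<Delta>\<close> with eigenvalue \<open>- \<bar>k\<bar>\<^sup>2\<close>.
\<close>

definition free_group :: "real \<Rightarrow> 'd::finite L2 \<Rightarrow> 'd L2" where
  "free_group t u = (\<Sum>\<^sub>\<infinity>k. (cis (t * (\<Sum>j\<in>UNIV. (of_int (k $ j))\<^sup>2)) *
     cinner (fourier_mode k) u) *\<^sub>C fourier_mode k)"

text \<open>Continuously differentiable functions on the torus, together with their gradient.\<close>

definition torus_test :: "(real ^ 'd::finite \<Rightarrow> complex) \<Rightarrow> ('d \<Rightarrow> real ^ 'd \<Rightarrow> complex) \<Rightarrow> bool" where
  "torus_test \<phi> D\<phi> \<longleftrightarrow>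
     (\<forall>x j. \<phi> (x + axis j (2 * pi)) = \<phi> x) \<and>
     (\<forall>x. (\<phi> has_derivative (\<lambda>h. \<Sum>j\<in>UNIV. h $ j *\<^sub>R D\<phi> j x)) (at x)) \<and>
     (\<forall>j. continuous_on UNIV (D\<phi> j))"

definition weak_pderiv :: "'d::finite \<Rightarrow> 'd L2 \<Rightarrow> 'd L2 \<Rightarrow> bool" where
  "weak_pderiv j u v \<longleftrightarrow>
     (\<forall>\<phi> D\<phi>. torus_test \<phi> D\<phi> \<longrightarrow>
        (LINT x|torus. rep_L2 u x * D\<phi> j x) = - (LINT x|torus. rep_L2 v x * \<phi> x))"

definition H1 :: "'d::finite L2 set" where
  "H1 = {u. \<forall>j. \<exists>v. weak_pderiv j u v}"

text \<open>For elements of \<open>H1\<close>; weak derivatives are unique in \<open>L2\<close>.\<close>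

definition wpd :: "'d::finite \<Rightarrow> 'd L2 \<Rightarrow> 'd L2" where
  "wpd j u = (THE v. weak_pderiv j u v)"

definition grad_inner :: "'d::finite L2 \<Rightarrow> 'd L2 \<Rightarrow> complex" where
  "grad_inner u v = (\<Sum>j\<in>UNIV. cinner (wpd j u) (wpd j v))"

definition grad_norm :: "'d::finite L2 \<Rightarrow> real" where
  "grad_norm u = sqrt (\<Sum>j\<in>UNIV. (norm (wpd j u))\<^sup>2)"

definition H1_norm :: "'d::finite L2 \<Rightarrow> real" where
  "H1_norm u = sqrt ((norm u)\<^sup>2 + (grad_norm u)\<^sup>2)"


section \<open>Noise\<close>

definition stochastic_basis :: "'w measure \<Rightarrow> (real \<Rightarrow> 'w measure) \<Rightarrow> bool" where
  "stochastic_basis M \<F> \<longleftrightarrow> prob_space M \<and> (\<forall>t\<ge>0. subalgebra M (\<F> t)) \<and>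
     (\<forall>s t. 0 \<le> s \<and> s \<le> t \<longrightarrow> subalgebra (\<F> t) (\<F> s))"

definition wiener_process ::
  "'w measure \<Rightarrow> (real \<Rightarrow> 'w measure) \<Rightarrow> (real \<Rightarrow> 'w \<Rightarrow> real) \<Rightarrow> bool" where
  "wiener_process M \<F> b \<longleftrightarrow>
     (\<forall>t\<ge>0. b t \<in> borel_measurable (\<F> t)) \<and>
     (AE \<omega> in M. b 0 \<omega> = 0) \<and>
     (AE \<omega> in M. continuous_on {0..} (\<lambda>t. b t \<omega>)) \<and>
     (\<forall>s t. 0 \<le> s \<and> s < t \<longrightarrow>
        distributed M lborel (\<lambda>\<omega>. b t \<omega> - b s \<omega>) (normal_density 0 (sqrt (t - s))) \<and>
        prob_space.indep_set M (sets (\<F> s))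
          {(\<lambda>\<omega>. b t \<omega> - b s \<omega>) -` B \<inter> space M | B. B \<in> sets borel})"

definition indep_wiener_processes ::
  "'w measure \<Rightarrow> (real \<Rightarrow> 'w measure) \<Rightarrow> (nat \<Rightarrow> real \<Rightarrow> 'w \<Rightarrow> real) \<Rightarrow> bool" where
  "indep_wiener_processes M \<F> \<beta> \<longleftrightarrow>
     (\<forall>k. wiener_process M \<F> (\<beta> k)) \<and>
     prob_space.indep_vars M (\<lambda>_. \<Pi>\<^sub>M t\<in>{0..}. borel) (\<lambda>k \<omega>. \<lambda>t\<in>{0..}. \<beta> k t \<omega>) UNIV"

definition trace_Q :: "(nat \<Rightarrow> complex) \<Rightarrow> real" where
  "trace_Q \<gamma> = (\<Sum>k. (cmod (\<gamma> k))\<^sup>2)"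

text \<open>The series converges almost surely, for each time.\<close>

definition Q_wiener ::
  "(nat \<Rightarrow> complex) \<Rightarrow> (nat \<Rightarrow> 'd::finite L2) \<Rightarrow> (nat \<Rightarrow> real \<Rightarrow> 'w \<Rightarrow> real) \<Rightarrow> real \<Rightarrow> 'w \<Rightarrow> 'd L2"
  where "Q_wiener \<gamma> e \<beta> t \<omega> = (\<Sum>k. (\<gamma> k * of_real (\<beta> k t \<omega>)) *\<^sub>C e k)"

text \<open>
  The stochastic integral \<open>Z = \<integral>\<^sub>0\<^sup>t \<Psi>(s) dW(s)\<close> of a deterministic operator-valued
  integrand, for \<open>W = Q_wiener \<gamma> e \<beta>\<close>: step functions \<open>\<Psi>\<^sub>n\<close> with values in the bounded
  operators approximate \<open>\<Psi>\<close> in the norm of the Ito isometry,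
  \<open>\<integral>\<^sub>0\<^sup>t \<parallel>(\<Psi>(s) - \<Psi>\<^sub>n(s)) Q\<^sup>1\<^sup>/\<^sup>2\<parallel>\<^sup>2 ds\<close> (Hilbert-Schmidt norm, evaluated on the basis \<open>e\<close>,
  where \<open>Q\<^sup>1\<^sup>/\<^sup>2 e\<^sub>k = \<gamma>\<^sub>k e\<^sub>k\<close>), and their elementary integrals converge to \<open>Z\<close> in mean square.
  The operators \<open>\<Psi>\<^sub>n\<close> need only be real linear, because the processes \<open>\<beta>\<^sub>k\<close> are real.
\<close>

definition step_operator ::
  "nat \<Rightarrow> (nat \<Rightarrow> real) \<Rightarrow> (nat \<Rightarrow> 'd::finite L2 \<Rightarrow> 'd L2) \<Rightarrow> real \<Rightarrow> 'd L2 \<Rightarrow> 'd L2" where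
  "step_operator m p A s v = (\<Sum>i<m. indicator {p i<..p (Suc i)} s *\<^sub>R A i v)"

definition step_integral ::
  "nat \<Rightarrow> (nat \<Rightarrow> real) \<Rightarrow> (nat \<Rightarrow> 'd::finite L2 \<Rightarrow> 'd L2) \<Rightarrow> (real \<Rightarrow> 'w \<Rightarrow> 'd L2) \<Rightarrow> 'w \<Rightarrow> 'd L2" where
  "step_integral m p A W \<omega> = (\<Sum>i<m. A i (W (p (Suc i)) \<omega> - W (p i) \<omega>))"

definition has_wiener_integral ::
  "'w measure \<Rightarrow> (nat \<Rightarrow> complex) \<Rightarrow> (nat \<Rightarrow> 'd::finite L2) \<Rightarrow> (nat \<Rightarrow> real \<Rightarrow> 'w \<Rightarrow> real) \<Rightarrow>
   (real \<Rightarrow> 'd L2 \<Rightarrow> 'd L2) \<Rightarrow> real \<Rightarrow> ('w \<Rightarrow> 'd L2) \<Rightarrow> bool" where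
  "has_wiener_integral M \<gamma> e \<beta> \<Psi> t Z \<longleftrightarrow>
     Z \<in> borel_measurable M \<and>
     (\<exists>m p A.
        (\<forall>n. p n 0 = 0 \<and> p n (m n) = t \<and> (\<forall>i<m n. p n i \<le> p n (Suc i)) \<and>
             (\<forall>i. bounded_linear (A n i))) \<and>
        ((\<lambda>n. \<integral>\<^sup>+s\<in>{0..t}.
            (\<Sum>k. ennreal ((norm (\<Psi> s (\<gamma> k *\<^sub>C e k) -
                                     step_operator (m n) (p n) (A n) s (\<gamma> k *\<^sub>C e k)))\<^sup>2)) \<partial>lborel)
          \<longlonglongrightarrow> 0) \<and>
        ((\<lambda>n. \<integral>\<^sup>+\<omega>. ennreal ((norm (Z \<omega> -
            step_integral (m n) (p n) (A n) (Q_wiener \<gamma> e \<beta>) \<omega>))\<^sup>2) \<partial>M) \<longlonglongrightarrow> 0))"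


section \<open>Assumptions, exact solution and splitting scheme\<close>

text \<open>
  A term with \<open>\<gamma>\<^sub>k = 0\<close> contributes nothing, whether or not \<open>e\<^sub>k\<close> belongs to \<open>H1\<close>.
\<close>

definition H1_noise :: "(nat \<Rightarrow> complex) \<Rightarrow> (nat \<Rightarrow> 'd::finite L2) \<Rightarrow> bool" where
  "H1_noise \<gamma> e \<longleftrightarrow> (\<forall>k. \<gamma> k \<noteq> 0 \<longrightarrow> e k \<in> H1) \<and>
     summable (\<lambda>k. (cmod (\<gamma> k))\<^sup>2 * (H1_norm (e k))\<^sup>2)"

text \<open>
  Measurability of \<open>V u\<close> is not demanded: off the zero set of \<open>u\<close>, which is all that matters,
  it follows from \<open>F u = V u \<cdot> u\<close> almost everywhere. The condition \<open>V[u] = V[cnj u]\<close> is the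
  special case \<open>u\<^sub>2 = cnj u\<^sub>1\<close> of the condition on moduli.
\<close>

definition nonlinearity ::
  "('d::finite L2 \<Rightarrow> real ^ 'd \<Rightarrow> real) \<Rightarrow> ('d L2 \<Rightarrow> 'd L2) \<Rightarrow> bool" where
  "nonlinearity V F \<longleftrightarrow>
     (\<forall>u. AE x in torus. rep_L2 (F u) x = of_real (V u x) * rep_L2 u x) \<and>
     (\<forall>u\<^sub>1 u\<^sub>2. (AE x in torus. cmod (rep_L2 u\<^sub>1 x) = cmod (rep_L2 u\<^sub>2 x)) \<longrightarrow>
        (AE x in torus. V u\<^sub>1 x = V u\<^sub>2 x)) \<and>
     (\<exists>C\<^sub>F K\<^sub>F. 0 < C\<^sub>F \<and> 0 < K\<^sub>F \<and>
        (\<forall>u\<^sub>1 u\<^sub>2. norm (F u\<^sub>2 - F u\<^sub>1) \<le>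
           (C\<^sub>F + K\<^sub>F * ((norm u\<^sub>1)\<^sup>2 + (norm u\<^sub>2)\<^sup>2)) * norm (u\<^sub>2 - u\<^sub>1))) \<and>
     (\<exists>C\<^sub>1 (P\<^sub>1 :: real poly). 0 < C\<^sub>1 \<and>
        (\<forall>u\<in>H1. F u \<in> H1 \<and> H1_norm (F u) \<le> C\<^sub>1 * H1_norm u * (1 + (norm u)\<^sup>2) \<and>
           \<bar>Im (grad_inner u (F u))\<bar> \<le> C\<^sub>1 * (grad_norm u)\<^sup>2 + poly P\<^sub>1 ((norm u)\<^sup>2)))"

text \<open>
  For almost every path, the drift integrand is continuous, so its Henstock-Kurzweil integral
  agrees with the Bochner integral.
\<close>

definition mild_solution ::
  "'w measure \<Rightarrow> (real \<Rightarrow> 'w measure) \<Rightarrow> (nat \<Rightarrow> complex) \<Rightarrow> (nat \<Rightarrow> 'd::finite L2) \<Rightarrow>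
   (nat \<Rightarrow> real \<Rightarrow> 'w \<Rightarrow> real) \<Rightarrow> real \<Rightarrow> ('d L2 \<Rightarrow> 'd L2) \<Rightarrow> 'd L2 \<Rightarrow>
   (real \<Rightarrow> 'w \<Rightarrow> 'd L2) \<Rightarrow> bool" where
  "mild_solution M \<F> \<gamma> e \<beta> \<alpha> F u0 u \<longleftrightarrow>
     (\<forall>t\<ge>0. u t \<in> borel_measurable (\<F> t)) \<and>
     (AE \<omega> in M. continuous_on {0..} (\<lambda>t. u t \<omega>)) \<and>
     (\<forall>t\<ge>0. \<exists>Z. has_wiener_integral M \<gamma> e \<beta> (\<lambda>s. free_group (t - s)) t Z \<and>
        (AE \<omega> in M. u t \<omega> = free_group t u0
           - \<i> *\<^sub>C integral {0..t} (\<lambda>s. free_group (t - s) (F (u s \<omega>)))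
           - (\<i> * of_real \<alpha>) *\<^sub>C Z \<omega>))"

text \<open>The exponential has modulus one, so the argument of \<open>abs_L2\<close> is square integrable.\<close>

definition phase_flow ::
  "('d::finite L2 \<Rightarrow> real ^ 'd \<Rightarrow> real) \<Rightarrow> real \<Rightarrow> 'd L2 \<Rightarrow> 'd L2" where
  "phase_flow V t u = abs_L2 (\<lambda>x. exp (- \<i> * of_real t * of_real (V u x)) * rep_L2 u x)"

primrec splitting ::
  "(real \<Rightarrow> 'w \<Rightarrow> 'd::finite L2) \<Rightarrow> real \<Rightarrow> ('d L2 \<Rightarrow> real ^ 'd \<Rightarrow> real) \<Rightarrow> 'd L2 \<Rightarrow>
   real \<Rightarrow> nat \<Rightarrow> 'w \<Rightarrow> 'd L2" where
  "splitting W \<alpha> V u0 \<tau> 0 \<omega> = u0"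
| "splitting W \<alpha> V u0 \<tau> (Suc n) \<omega> =
     free_group \<tau> (phase_flow V \<tau> (splitting W \<alpha> V u0 \<tau> n \<omega>)
       - (\<i> * of_real \<alpha>) *\<^sub>C (W (real (Suc n) * \<tau>) \<omega> - W (real n * \<tau>) \<omega>))"

end

theory Submission
  imports Defs
begin

text \<open>
  For a scheme \<open>w\<^sub>n\<^sub>+\<^sub>1 = S(h) (B w\<^sub>n - \<i> \<alpha> \<delta>W\<^sub>n)\<close> with \<open>\<parallel>B w\<parallel>\<^sup>2 \<le> \<parallel>w\<parallel>\<^sup>2 + c\<close>, integrating out the Gaussian
  coordinates of \<open>\<delta>W\<^sub>n\<close> one at a time gives
  \<open>E exp (l \<parallel>w\<^sub>n\<^sub>+\<^sub>1\<parallel>\<^sup>2) \<le> exp (2 l \<alpha>\<^sup>2 Tr(Q) h) E exp (l (1 + 4 l \<alpha>\<^sup>2 Tr(Q) h) (\<parallel>w\<^sub>n\<parallel>\<^sup>2 + c))\<close>.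
  Iterating this, the exponent stays bounded as long as \<open>\<mu> \<alpha>\<^sup>2 T Tr(Q)\<close> is small. The phase flow preserves the
  norm, so the splitting scheme is of this form with \<open>c = 0\<close>. A truncated Euler step preserves the norm up to
  \<open>O(h\<^sup>2)\<close>, because \<open>\<langle>u, F u\<rangle>\<close> is real, and the resulting scheme converges almost surely along a
  subsequence to the exact solution, which therefore inherits the bound by Fatou's lemma.
\<close>

section \<open>The Hilbert space of square integrable functions\<close>

text \<open>Integrating out one Gaussian coordinate costs a summand proportional to
  \<open>(cmod (g k))^2\<close> in the exponent. These costs add up to the trace, so infinitely many
  coordinates and arbitrarily many steps can be treated alike. The price is an exponent that grows
  from step to step; that it at most doubles up to time \<open>T\<close> is where the smallness of
  \<open>\<mu> \<alpha>^2 T Tr(Q)\<close> comes from. Three obstacles shape the passage to the exact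
  solution. \<open>F\<close> is only locally Lipschitz with cubic growth, so no constant
  \<open>c\<close> bounds the defect of an untruncated Euler step; the truncation radius is sent to
  infinity last, after the step size has gone to zero, and a bound independent of the radius
  survives. The mild solution is known only through a stochastic integral given by unspecified step
  functions; an Ito inequality for differences of step integrals exchanges them for left-endpoint
  sums on a uniform grid. Finally, \<open>S(0)\<close> is treated as a projection onto the closed
  span of the Fourier modes, so the approximating schemes start from \<open>S(0) u0\<close>.\<close>

lemma rep_abs_L2: "square_integrable f \<Longrightarrow> AE x in torus. rep_L2 (abs_L2 f) x = f x"
  using Quotient_rep_abs[OF Quotient_L2, of f] by auto

lemma abs_rep_L2: "abs_L2 (rep_L2 u) = u"
  by (rule Quotient_abs_rep[OF Quotient_L2])

lemma square_integrable_rep [simp]: "square_integrable (rep_L2 u)"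
  using Quotient_rep_reflp[OF Quotient_L2, of u] by auto

lemma abs_L2_cong: "\<lbrakk>square_integrable f; square_integrable g; AE x in torus. f x = g x\<rbrakk> \<Longrightarrow> abs_L2 f = abs_L2 g"
  using Quotient_rel_abs[OF Quotient_L2, of f g] by auto

lemma L2_eqI: "AE x in torus. rep_L2 u x = rep_L2 v x \<Longrightarrow> u = v"
  using abs_L2_cong[of "rep_L2 u" "rep_L2 v"] by (simp add: abs_rep_L2)

lemma rep_add_L2: "AE x in torus. rep_L2 (u + v) x = rep_L2 u x + rep_L2 v x"
proof -
  have "u + v = abs_L2 (\<lambda>x. rep_L2 u x + rep_L2 v x)"
    using plus_L2.abs_eq[of "rep_L2 u" "rep_L2 v"] by (simp add: abs_rep_L2)
  then show ?thesis using rep_abs_L2[OF square_integrable_add[of "rep_L2 u" "rep_L2 v"]] by simp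
qed

lemma rep_diff_L2: "AE x in torus. rep_L2 (u - v) x = rep_L2 u x - rep_L2 v x"
proof -
  have "u - v = abs_L2 (\<lambda>x. rep_L2 u x - rep_L2 v x)"
    using minus_L2.abs_eq[of "rep_L2 u" "rep_L2 v"] by (simp add: abs_rep_L2)
  then show ?thesis using rep_abs_L2[OF square_integrable_diff[of "rep_L2 u" "rep_L2 v"]] by simp
qed

lemma rep_scaleC: "AE x in torus. rep_L2 (c *\<^sub>C u) x = c * rep_L2 u x"
proof -
  have "c *\<^sub>C u = abs_L2 (\<lambda>x. c * rep_L2 u x)"
    using scaleC.abs_eq[of "rep_L2 u" c] by (simp add: abs_rep_L2)
  then show ?thesis using rep_abs_L2[OF square_integrable_scale[of "rep_L2 u"]] by simp
qed

lemma cinner_rep: "cinner u v = (LINT x|torus. cnj (rep_L2 u x) * rep_L2 v x)"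
  using cinner.abs_eq[of "rep_L2 u" "rep_L2 v"] by (simp add: abs_rep_L2)

lemma cinner_add_right: "cinner u (v + w) = cinner u v + cinner u w"
  by transfer (simp add: distrib_left square_integrable_mult)

lemma cinner_scaleC_right: "cinner u (c *\<^sub>C v) = c * cinner u v"
proof transfer
  fix f g :: "real^'a \<Rightarrow> complex" and c
  have "(\<lambda>x. cnj (f x) * (c * g x)) = (\<lambda>x. c * (cnj (f x) * g x))" by (auto simp: fun_eq_iff)
  then show "(LINT x|torus. cnj (f x) * (c * g x)) = c * (LINT x|torus. cnj (f x) * g x)" by simp
qed

lemma cinner_commute: "cinner u v = cnj (cinner v u)"
proof transfer
  fix f g :: "real^'a \<Rightarrow> complex"
  have "cnj (LINT x|torus. cnj (g x) * f x) = (LINT x|torus. cnj (cnj (g x) * f x))"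
    by (rule Bochner_Integration.integral_cnj[symmetric])
  then show "(LINT x|torus. cnj (f x) * g x) = cnj (LINT x|torus. cnj (g x) * f x)"
    by (simp add: mult.commute)
qed

lemma cinner_scaleC_left: "cinner (c *\<^sub>C u) v = cnj c * cinner u v"
  by (metis cinner_commute cinner_scaleC_right complex_cnj_mult)

lemma scaleC_scaleC: "a *\<^sub>C b *\<^sub>C u = (a * b) *\<^sub>C u"
  by transfer (auto intro: square_integrable_scale simp: mult.assoc)

lemma scaleC_add_right: "a *\<^sub>C (u + v) = a *\<^sub>C u + a *\<^sub>C v"
  by transfer (auto intro!: square_integrable_add square_integrable_scale simp: distrib_left)

lemma scaleC_add_left: "(a + b) *\<^sub>C u = a *\<^sub>C u + b *\<^sub>C u"
  by transfer (auto intro!: square_integrable_add square_integrable_scale simp: distrib_right)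

lemma cinner_self: "cinner u u = of_real ((norm u)\<^sup>2)"
proof -
  have "cnj (cinner u u) = cinner u u" using cinner_commute[of u u] by simp
  then have "Im (cinner u u) = 0" by (simp add: complex_eq_iff)
  moreover have "Re (cinner u u) = (norm u)\<^sup>2"
    by (metis inner_L2_def power2_norm_eq_inner)
  ultimately show ?thesis by (simp add: complex_eq_iff)
qed

lemma norm_scaleC: "norm (c *\<^sub>C u) = cmod c * norm u"
proof -
  have "of_real ((norm (c *\<^sub>C u))\<^sup>2) = (of_real ((cmod c * norm u)\<^sup>2) :: complex)"
    unfolding cinner_self[symmetric] cinner_scaleC_left cinner_scaleC_right
    by (simp add: cinner_self power_mult_distrib complex_norm_square[of c, simplified] mult.assoc)
  then have "(norm (c *\<^sub>C u))\<^sup>2 = (cmod c * norm u)\<^sup>2" unfolding of_real_eq_iff .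
  then show ?thesis by (simp add: power2_eq_iff_nonneg)
qed

lemma cmod_cinner_le: "cmod (cinner u v) \<le> norm u * norm v"
proof -
  \<comment> \<open>The phase \<open>c\<close> rotates the complex inner product onto the
    nonnegative real axis, where the real Cauchy-Schwarz inequality applies.\<close>
  define c where "c = (if cinner u v = 0 then 1 else cnj (cinner u v) / cmod (cinner u v))"
  have c: "cmod c = 1" by (auto simp: c_def norm_divide)
  have "cinner u (c *\<^sub>C v) = of_real (cmod (cinner u v))"
    using complex_norm_square[of "cinner u v"]
    by (auto simp: c_def cinner_scaleC_right divide_simps power2_eq_square mult.commute)
  then have "cmod (cinner u v) = inner u (c *\<^sub>C v)" by (simp add: inner_L2_def)
  also have "\<dots> \<le> norm u * norm (c *\<^sub>C v)" by (rule norm_cauchy_schwarz)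
  finally show ?thesis by (simp add: norm_scaleC c)
qed

lemma bounded_linear_cinner: "bounded_linear (cinner u)"
  by (rule bounded_linear_intro[where K = "norm u"])
     (auto simp: cinner_add_right cinner_scaleC_right scaleR_L2_def scaleR_conv_of_real
       mult.commute[of "norm _" "norm u"] cmod_cinner_le)

lemma bounded_linear_scaleC: "bounded_linear (scaleC c)"
  by (rule bounded_linear_intro[where K = "cmod c"])
     (auto simp: scaleC_add_right scaleR_L2_def scaleC_scaleC norm_scaleC mult.commute)

lemma bounded_linear_scaleC_left: "bounded_linear (\<lambda>c. c *\<^sub>C u)"
  by (rule bounded_linear_intro[where K = "norm u"])
     (auto simp: scaleC_add_left scaleR_L2_def scaleC_scaleC norm_scaleC scaleR_conv_of_real)

lemmas cinner_diff_right = linear_diff[OF bounded_linear.linear[OF bounded_linear_cinner]]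
lemmas cinner_zero_right [simp] = linear_0[OF bounded_linear.linear[OF bounded_linear_cinner]]
lemmas cinner_sum_right = linear_sum[OF bounded_linear.linear[OF bounded_linear_cinner]]
lemmas scaleC_diff_right = linear_diff[OF bounded_linear.linear[OF bounded_linear_scaleC]]
lemmas scaleC_zero_left [simp] = linear_0[OF bounded_linear.linear[OF bounded_linear_scaleC_left]]
lemmas scaleC_zero_right [simp] = linear_0[OF bounded_linear.linear[OF bounded_linear_scaleC]]
lemmas tendsto_cinner [tendsto_intros] = bounded_linear.tendsto[OF bounded_linear_cinner]
lemmas continuous_on_scaleC [continuous_intros] = bounded_linear.continuous_on[OF bounded_linear_scaleC]

lemma cinner_sum_left: "cinner (\<Sum>i\<in>I. f i) u = (\<Sum>i\<in>I. cinner (f i) u)"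
  by (subst cinner_commute) (simp add: cinner_sum_right cinner_commute[of u])

lemma norm_L2_sq: "(norm u)\<^sup>2 = (LINT x|torus. (cmod (rep_L2 u x))\<^sup>2)"
proof -
  have "(norm u)\<^sup>2 = Re (cinner u u)" by (simp add: cinner_self)
  also have "cinner u u = (LINT x|torus. complex_of_real ((cmod (rep_L2 u x))\<^sup>2))"
    unfolding cinner_rep by (simp only: complex_norm_square mult.commute)
  finally show ?thesis by (simp only: integral_complex_of_real Re_complex_of_real)
qed

lemma norm_L2_sq_nn: "ennreal ((norm u)\<^sup>2) = (\<integral>\<^sup>+x. ennreal ((cmod (rep_L2 u x))\<^sup>2) \<partial>torus)"
proof -
  have "integrable torus (\<lambda>x. (cmod (rep_L2 u x))\<^sup>2)"
    using square_integrable_rep[of u] by (simp add: square_integrable_def)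
  then show ?thesis unfolding norm_L2_sq by (subst nn_integral_eq_integral) auto
qed

lemma norm_diff_L2_nn:
  "ennreal ((norm (u - v))\<^sup>2) = (\<integral>\<^sup>+x. ennreal ((cmod (rep_L2 u x - rep_L2 v x))\<^sup>2) \<partial>torus)"
  unfolding norm_L2_sq_nn using rep_diff_L2[of u v]
  by (intro nn_integral_cong_AE) (auto elim: eventually_mono)

lemma measurable_rep_L2 [measurable]: "rep_L2 u \<in> borel_measurable torus"
  using square_integrable_rep[of u] by (simp add: square_integrable_def)

lemma finite_measure_torus: "finite_measure (torus :: (real ^ 'd::finite) measure)"
  by (rule finite_measure_lebesgue_on[OF lmeasurable_cbox])

section \<open>Completeness of \<open>L2\<close> (Riesz-Fischer)\<close>

text \<open>The torus has finite measure, so the increments also have summable \<open>L1\<close>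
  norms; hence they are absolutely summable almost everywhere and the sequence telescopes.\<close>

lemma L2_Cauchy_subseq_AE_convergent:
  fixes X :: "nat \<Rightarrow> 'd::finite L2"
  assumes X: "\<And>k. norm (X (Suc k) - X k) \<le> (1/2) ^ k"
  shows "AE x in torus. convergent (\<lambda>k. rep_L2 (X k) x)"
proof -
  interpret finite_measure "torus :: (real ^ 'd) measure" by (rule finite_measure_torus)
  define g where "g k x = cmod (rep_L2 (X (Suc k)) x - rep_L2 (X k) x)" for k x
  have gm [measurable]: "g k \<in> borel_measurable torus" for k unfolding g_def by measurable
  have g0: "0 \<le> g k x" for k x by (simp add: g_def)
  define V where "V = measure torus (space (torus :: (real ^ 'd) measure))"
  have int: "(\<integral>\<^sup>+x. ennreal (g k x) \<partial>torus) \<le> ennreal ((1/2)^k * (V + 1))" for k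
  proof -
    \<comment> \<open>Trades the \<open>L1\<close> norm for the \<open>L2\<close> norm:
      \<open>g \<le> a + g^2 / a\<close> with \<open>a = (1/2)^k\<close>, whose two terms both
      integrate to \<open>O((1/2)^k)\<close>.\<close>
    have le: "g k x \<le> (1/2)^k + 2^k * (g k x)\<^sup>2" for x
    proof (cases "g k x \<le> (1/2)^k")
      case False
      then have "1 \<le> 2^k * g k x" by (simp add: field_simps power_divide)
      then have "g k x * 1 \<le> g k x * (2^k * g k x)" using g0 by (intro mult_left_mono) auto
      then show ?thesis by (simp add: power2_eq_square mult_ac add_increasing)
    next
      case True
      moreover have "0 \<le> 2^k * (g k x)\<^sup>2" by simp
      ultimately show ?thesis by linarith
    qed
    have "(\<integral>\<^sup>+x. ennreal (g k x) \<partial>torus) \<le> (\<integral>\<^sup>+x. ennreal ((1/2)^k) + ennreal (2^k) * ennreal ((g k x)\<^sup>2) \<partial>torus)"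
      using le by (intro nn_integral_mono) (simp add: ennreal_mult[symmetric] ennreal_plus[symmetric] del: ennreal_plus)
    also have "\<dots> = ennreal ((1/2)^k) * emeasure torus (space (torus::(real ^ 'd) measure)) + ennreal (2^k) * (\<integral>\<^sup>+x. ennreal ((g k x)\<^sup>2) \<partial>torus)"
      by (subst nn_integral_add) (auto simp: nn_integral_cmult)
    also have "(\<integral>\<^sup>+x. ennreal ((g k x)\<^sup>2) \<partial>torus) = ennreal ((norm (X (Suc k) - X k))\<^sup>2)"
      unfolding norm_diff_L2_nn g_def ..
    also have "\<dots> \<le> ennreal (((1/2)^k)\<^sup>2)"
      using X by (intro ennreal_leI power_mono) auto
    also have "ennreal ((1/2)^k) * emeasure torus (space (torus::(real ^ 'd) measure)) + ennreal (2^k) * ennreal (((1/2)^k)\<^sup>2)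
       = ennreal ((1/2)^k * V + 2^k * ((1/2)^k)\<^sup>2)"
      unfolding emeasure_eq_measure V_def[symmetric]
      by (simp add: ennreal_mult[symmetric] V_def)
    also have "(1/2)^k * V + 2^k * ((1/2)^k)\<^sup>2 = (1/2)^k * (V + 1)"
      by (simp add: power2_eq_square power_divide field_simps)
    finally show ?thesis by (auto simp: add_left_mono mult_left_mono)
  qed
  have "(\<integral>\<^sup>+x. (\<Sum>k. ennreal (g k x)) \<partial>torus) = (\<Sum>k. \<integral>\<^sup>+x. ennreal (g k x) \<partial>torus)"
    by (rule nn_integral_suminf) measurable
  also have "\<dots> \<le> (\<Sum>k. ennreal ((1/2)^k * (V + 1)))" by (intro suminf_le int) auto
  also have "\<dots> = ennreal (\<Sum>k. (1/2)^k * (V + 1))"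
    by (intro suminf_ennreal2 summable_mult2 summable_geometric) (auto simp: V_def)
  also have "\<dots> < \<infinity>" by simp
  finally have "(\<integral>\<^sup>+x. (\<Sum>k. ennreal (g k x)) \<partial>torus) \<noteq> \<infinity>" by simp
  then have "AE x in torus. (\<Sum>k. ennreal (g k x)) \<noteq> \<infinity>"
    by (intro nn_integral_PInf_AE) measurable
  then show ?thesis
  proof eventually_elim
    case (elim x)
    have "summable (\<lambda>k. g k x)" using elim g0 by (intro summable_suminf_not_top) auto
    then have "summable (\<lambda>k. rep_L2 (X (Suc k)) x - rep_L2 (X k) x)"
      unfolding g_def by (rule summable_norm_cancel)
    then have "convergent (\<lambda>n. \<Sum>k<n. rep_L2 (X (Suc k)) x - rep_L2 (X k) x)"
      by (simp add: summable_iff_convergent)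
    then have "convergent (\<lambda>n. rep_L2 (X n) x - rep_L2 (X 0) x)"
      using sum_lessThan_telescope[of "\<lambda>k. rep_L2 (X k) x"] by simp
    then show ?case using convergent_add[OF _ convergent_const[of "rep_L2 (X 0) x"]] by fastforce
  qed
qed

text \<open>A rapidly convergent subsequence has a pointwise limit \<open>f\<close>, and Fatou's
  lemma along it controls the distance from \<open>f\<close> to every late term of the full
  sequence.\<close>

lemma L2_Cauchy_convergent:
  fixes X :: "nat \<Rightarrow> 'd::finite L2"
  assumes "Cauchy X"
  shows "convergent X"
proof -
  have "\<exists>N. \<forall>m\<ge>N. \<forall>n\<ge>N. norm (X m - X n) < (1/2)^k" for k :: nat
    using CauchyD[OF assms, of "(1/2)^k"] by auto
  then obtain N where N: "\<And>k m n. N k \<le> m \<Longrightarrow> N k \<le> n \<Longrightarrow> norm (X m - X n) < (1/2)^k" by metis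
  \<comment> \<open>Partial sums make \<open>r\<close> strictly increasing while it still dominates
    \<open>N\<close>.\<close>
  define r where "r k = (\<Sum>j\<le>k. N j + 1)" for k
  have rN: "N k \<le> r k" for k
    unfolding r_def using member_le_sum[of k "{..k}" "\<lambda>j. N j + 1"] by auto
  have rS: "r k < r (Suc k)" for k unfolding r_def by simp
  have rk: "k \<le> r k" for k by (induct k) (use rS in \<open>auto simp: Suc_le_eq intro: le_less_trans\<close>)
  define Y where "Y k = X (r k)" for k
  have "norm (Y (Suc k) - Y k) \<le> (1/2)^k" for k
    unfolding Y_def using N[of k "r (Suc k)" "r k"] rN[of k] rS[of k] by simp
  then have conv: "AE x in torus. convergent (\<lambda>k. rep_L2 (Y k) x)"
    by (rule L2_Cauchy_subseq_AE_convergent)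
  define f where "f x = lim (\<lambda>k. rep_L2 (Y k) x)" for x
  have [measurable]: "f \<in> borel_measurable torus"
    unfolding f_def by (rule borel_measurable_lim_metric) measurable
  \<comment> \<open>With \<open>n\<close> fixed and only \<open>j\<close> sent to infinity, the
    bound concerns \<open>X n\<close> itself; it yields both \<open>f\<close> in \<open>L2\<close>
    and convergence of the whole sequence.\<close>
  have fatou: "(\<integral>\<^sup>+x. ennreal ((cmod (f x - rep_L2 (X n) x))\<^sup>2) \<partial>torus) \<le> ennreal (((1/2)^k)\<^sup>2)"
    if "N k \<le> n" for k n
  proof -
    have "(\<integral>\<^sup>+x. ennreal ((cmod (f x - rep_L2 (X n) x))\<^sup>2) \<partial>torus)
      = (\<integral>\<^sup>+x. liminf (\<lambda>j. ennreal ((cmod (rep_L2 (Y j) x - rep_L2 (X n) x))\<^sup>2)) \<partial>torus)"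
    proof (rule nn_integral_cong_AE)
      show "AE x in torus. ennreal ((cmod (f x - rep_L2 (X n) x))\<^sup>2) = liminf (\<lambda>j. ennreal ((cmod (rep_L2 (Y j) x - rep_L2 (X n) x))\<^sup>2))"
        using conv
      proof eventually_elim
        case (elim x)
        then have "(\<lambda>k. rep_L2 (Y k) x) \<longlonglongrightarrow> f x" unfolding f_def by (simp add: convergent_LIMSEQ_iff)
        then have "(\<lambda>j. ennreal ((cmod (rep_L2 (Y j) x - rep_L2 (X n) x))\<^sup>2)) \<longlonglongrightarrow> ennreal ((cmod (f x - rep_L2 (X n) x))\<^sup>2)"
          by (intro tendsto_intros tendsto_ennrealI)
        then show ?case using lim_imp_Liminf[OF sequentially_bot] by metis
      qed
    qed
    also have "\<dots> \<le> liminf (\<lambda>j. \<integral>\<^sup>+x. ennreal ((cmod (rep_L2 (Y j) x - rep_L2 (X n) x))\<^sup>2) \<partial>torus)"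
      by (rule nn_integral_liminf) measurable
    also have "\<dots> = liminf (\<lambda>j. ennreal ((norm (Y j - X n))\<^sup>2))" unfolding norm_diff_L2_nn ..
    also have "\<dots> \<le> limsup (\<lambda>j. ennreal ((norm (Y j - X n))\<^sup>2))" by (rule Liminf_le_Limsup) simp
    also have "\<dots> \<le> ennreal (((1/2)^k)\<^sup>2)"
    proof (rule Limsup_bounded, rule eventually_sequentiallyI[of "N k"])
      fix j assume "N k \<le> j"
      then have "N k \<le> r j" using rk[of j] by linarith
      then show "ennreal ((norm (Y j - X n))\<^sup>2) \<le> ennreal (((1/2)^k)\<^sup>2)"
        using N[of k "r j" n] that by (intro ennreal_leI power_mono) (auto simp: Y_def less_imp_le)
    qed
    finally show ?thesis .
  qed
  have sqd: "square_integrable (\<lambda>x. f x - rep_L2 (X n) x)" if "N 0 \<le> n" for n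
  proof -
    have "(\<integral>\<^sup>+x. ennreal ((cmod (f x - rep_L2 (X n) x))\<^sup>2) \<partial>torus) < \<infinity>"
      using fatou[OF that] by (simp add: le_less_trans)
    then show ?thesis unfolding square_integrable_def
      by (auto intro!: integrableI_bounded)
  qed
  have sqf: "square_integrable f"
    using square_integrable_add[OF sqd[of "N 0"] square_integrable_rep[of "X (N 0)"]] by simp
  have bd: "norm (abs_L2 f - X n) \<le> (1/2)^k" if "N k \<le> n" for k n
  proof -
    have "ennreal ((norm (abs_L2 f - X n))\<^sup>2) = (\<integral>\<^sup>+x. ennreal ((cmod (f x - rep_L2 (X n) x))\<^sup>2) \<partial>torus)"
      unfolding norm_diff_L2_nn using rep_abs_L2[OF sqf]
      by (intro nn_integral_cong_AE) (auto elim: eventually_mono)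
    also have "\<dots> \<le> ennreal (((1/2)^k)\<^sup>2)" by (rule fatou[OF that])
    finally have "(norm (abs_L2 f - X n))\<^sup>2 \<le> ((1/2)^k)\<^sup>2" by (simp add: ennreal_le_iff)
    then show ?thesis by (rule power2_le_imp_le) simp
  qed
  have "X \<longlonglongrightarrow> abs_L2 f"
  proof (rule LIMSEQ_I)
    fix e :: real assume "0 < e"
    then obtain k where "(1/2)^k < e" using real_arch_pow_inv[of e "1/2"] by auto
    then show "\<exists>no. \<forall>n\<ge>no. norm (X n - abs_L2 f) < e"
      using bd[of k] by (intro exI[of _ "N k"]) (auto simp: norm_minus_commute intro: le_less_trans)
  qed
  then show ?thesis by (rule convergentI)
qed

text \<open>Completeness is what lets unordered orthonormal series converge and continuous paths be
  integrated.\<close>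

instance L2 :: (finite) banach
  by standard (rule L2_Cauchy_convergent)

section \<open>Orthonormal families and measurability\<close>

text \<open>The index type is free because the notion serves both the noise basis, indexed by
  \<open>nat\<close>, and the Fourier modes, indexed by \<open>int ^ 'd\<close>.\<close>

definition orthonormal_family :: "('i \<Rightarrow> 'd::finite L2) \<Rightarrow> bool" where
  "orthonormal_family f \<longleftrightarrow> (\<forall>j k. cinner (f j) (f k) = (if j = k then 1 else 0))"

lemma complete_orthonormal_imp_orthonormal:
  "complete_orthonormal e \<Longrightarrow> orthonormal_family e"
  by (simp add: complete_orthonormal_def orthonormal_family_def)

lemma cinner_orthonormal_sum:
  assumes "orthonormal_family f" "finite I"
  shows "cinner (f j) (\<Sum>k\<in>I. c k *\<^sub>C f k) = (if j \<in> I then c j else 0)"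
proof -
  have "cinner (f j) (\<Sum>k\<in>I. c k *\<^sub>C f k) = (\<Sum>k\<in>I. if j = k then c k else 0)"
    unfolding cinner_sum_right cinner_scaleC_right
    using assms by (intro sum.cong) (auto simp: orthonormal_family_def)
  then show ?thesis using assms by (simp add: sum.delta)
qed

lemma norm_orthonormal:
  assumes "orthonormal_family f"
  shows "norm (f k) = 1"
proof -
  have "complex_of_real ((norm (f k))\<^sup>2) = of_real 1"
    using assms unfolding cinner_self[symmetric] by (simp add: orthonormal_family_def)
  then have "(norm (f k))\<^sup>2 = 1\<^sup>2" unfolding of_real_eq_iff by simp
  then show ?thesis by (rule power2_eq_imp_eq) auto
qed

lemma norm_orthonormal_sum:
  assumes "orthonormal_family f" "finite I"
  shows "(norm (\<Sum>k\<in>I. c k *\<^sub>C f k))\<^sup>2 = (\<Sum>k\<in>I. (cmod (c k))\<^sup>2)"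
proof -
  have "of_real ((norm (\<Sum>k\<in>I. c k *\<^sub>C f k))\<^sup>2) = (\<Sum>k\<in>I. cnj (c k) * c k)"
    unfolding cinner_self[symmetric] using assms
    by (subst cinner_sum_left) (auto simp: cinner_scaleC_left cinner_orthonormal_sum intro!: sum.cong)
  also have "\<dots> = of_real (\<Sum>k\<in>I. (cmod (c k))\<^sup>2)"
    by (simp only: of_real_sum complex_norm_square mult.commute)
  finally show ?thesis unfolding of_real_eq_iff .
qed

lemma Bessel:
  assumes "orthonormal_family f" "finite I"
  shows "(\<Sum>k\<in>I. (cmod (cinner (f k) u))\<^sup>2) \<le> (norm u)\<^sup>2"
proof -
  define p where "p = (\<Sum>k\<in>I. cinner (f k) u *\<^sub>C f k)"
  have np: "(norm p)\<^sup>2 = (\<Sum>k\<in>I. (cmod (cinner (f k) u))\<^sup>2)"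
    unfolding p_def by (rule norm_orthonormal_sum[OF assms])
  have "cinner p u = (\<Sum>k\<in>I. cnj (cinner (f k) u) * cinner (f k) u)"
    unfolding p_def cinner_sum_left cinner_scaleC_left ..
  also have "\<dots> = of_real ((norm p)\<^sup>2)"
    unfolding np by (simp only: of_real_sum complex_norm_square mult.commute)
  finally have "inner p u = (norm p)\<^sup>2" by (simp add: inner_L2_def)
  moreover have "0 \<le> inner (u - p) (u - p)" by simp
  ultimately have "(norm p)\<^sup>2 \<le> (norm u)\<^sup>2"
    by (simp add: inner_diff power2_norm_eq_inner inner_commute)
  then show ?thesis unfolding np .
qed

lemma Bessel_summable:
  assumes "orthonormal_family f"
  shows "(\<lambda>k. (cmod (cinner (f k) u))\<^sup>2) summable_on UNIV"
  by (rule nonneg_bdd_above_summable_on)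
     (auto intro!: bdd_aboveI2[where M = "(norm u)\<^sup>2"] Bessel[OF assms])

text \<open>By Pythagoras the squared distance of nested finite partial sums is a difference of
  partial sums of the \<open>(cmod (c k))^2\<close>, so the net of partial sums is Cauchy.\<close>

lemma orthonormal_summable:
  fixes f :: "'i \<Rightarrow> 'd::finite L2"
  assumes f: "orthonormal_family f" and c: "(\<lambda>k. (cmod (c k))\<^sup>2) summable_on UNIV"
  shows "(\<lambda>k. c k *\<^sub>C f k) summable_on UNIV"
proof -
  obtain L where L: "((\<lambda>k. (cmod (c k))\<^sup>2) has_sum L) UNIV" using c by (auto simp: summable_on_def)
  let ?g = "\<lambda>F. \<Sum>k\<in>F. c k *\<^sub>C f k"
  have "cauchy_filter (filtermap ?g (finite_subsets_at_top UNIV))"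
    unfolding cauchy_filter_metric_filtermap
  proof (intro allI impI)
    fix e :: real assume e: "0 < e"
    \<comment> \<open>Two partial sums of squares within \<open>d\<close> of \<open>L\<close> differ
      by less than \<open>2 d = (e/2)^2\<close>, so each larger vector sum is within
      \<open>e/2\<close> of the reference sum over \<open>F0\<close>.\<close>
    define d where "d = (e/2)\<^sup>2 / 2"
    have "0 < d" using e by (simp add: d_def)
    then have "eventually (\<lambda>F. dist (\<Sum>k\<in>F. (cmod (c k))\<^sup>2) L < d) (finite_subsets_at_top UNIV)"
      using L unfolding has_sum_def by (rule tendstoD[rotated])
    then obtain F0 where F0: "finite F0"
      "\<And>F. finite F \<Longrightarrow> F0 \<subseteq> F \<Longrightarrow> dist (\<Sum>k\<in>F. (cmod (c k))\<^sup>2) L < d"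
      by (auto simp: eventually_finite_subsets_at_top)
    have *: "norm (?g F - ?g F0) < e/2" if "finite F" "F0 \<subseteq> F" for F
    proof -
      have "?g F - ?g F0 = ?g (F - F0)" using that by (simp add: sum_diff)
      then have "(norm (?g F - ?g F0))\<^sup>2 = (\<Sum>k\<in>F-F0. (cmod (c k))\<^sup>2)"
        using norm_orthonormal_sum[OF f, of "F - F0" c] that by simp
      also have "\<dots> = (\<Sum>k\<in>F. (cmod (c k))\<^sup>2) - (\<Sum>k\<in>F0. (cmod (c k))\<^sup>2)"
        using that by (simp add: sum_diff)
      also have "\<dots> < 2 * d"
        using F0(2)[OF that] F0(2)[OF F0(1) order_refl] unfolding dist_real_def by linarith
      finally show ?thesis using e by (subst (asm) d_def, intro power2_less_imp_less[of "norm (?g F - ?g F0)" "e/2"]) auto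
    qed
    show "\<exists>P. eventually P (finite_subsets_at_top UNIV) \<and>
        (\<forall>x y. P x \<and> P y \<longrightarrow> dist (?g x) (?g y) < e)"
    proof (intro exI[of _ "\<lambda>F. finite F \<and> F0 \<subseteq> F"] conjI allI impI)
      show "eventually (\<lambda>F. finite F \<and> F0 \<subseteq> F) (finite_subsets_at_top UNIV)"
        unfolding eventually_finite_subsets_at_top using F0(1) by auto
      fix x y assume "(finite x \<and> F0 \<subseteq> x) \<and> finite y \<and> F0 \<subseteq> y"
      then show "dist (?g x) (?g y) < e"
        using *[of x] *[of y] dist_triangle2[of "?g x" "?g y" "?g F0"] by (simp add: dist_norm)
    qed
  qed
  moreover have "Topological_Spaces.complete (UNIV::'d L2 set)"
    by (meson Cauchy_convergent UNIV_I complete_def convergent_def)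
  ultimately obtain l where "(?g \<longlongrightarrow> l) (finite_subsets_at_top UNIV)"
    using complete_uniform[where S=UNIV] by (force simp add: filterlim_def)
  then show ?thesis by (auto simp: summable_on_def has_sum_def)
qed

lemma orthonormal_has_sum_norm:
  assumes "orthonormal_family f" "((\<lambda>k. c k *\<^sub>C f k) has_sum v) UNIV"
  shows "((\<lambda>k. (cmod (c k))\<^sup>2) has_sum (norm v)\<^sup>2) UNIV"
proof -
  have "((\<lambda>F. (norm (\<Sum>k\<in>F. c k *\<^sub>C f k))\<^sup>2) \<longlongrightarrow> (norm v)\<^sup>2) (finite_subsets_at_top UNIV)"
    using assms(2) unfolding has_sum_def by (intro tendsto_intros)
  moreover have "eventually (\<lambda>F. (norm (\<Sum>k\<in>F. c k *\<^sub>C f k))\<^sup>2 = (\<Sum>k\<in>F. (cmod (c k))\<^sup>2)) (finite_subsets_at_top UNIV)"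
    by (rule eventually_finite_subsets_at_top_weakI) (rule norm_orthonormal_sum[OF assms(1)])
  ultimately show ?thesis unfolding has_sum_def by (rule Lim_transform_eventually)
qed

lemma orthonormal_has_sum_cinner:
  assumes "orthonormal_family f" "((\<lambda>k. c k *\<^sub>C f k) has_sum v) UNIV"
  shows "cinner (f j) v = c j"
proof -
  have "((\<lambda>F. cinner (f j) (\<Sum>k\<in>F. c k *\<^sub>C f k)) \<longlongrightarrow> cinner (f j) v) (finite_subsets_at_top UNIV)"
    using assms(2) unfolding has_sum_def by (intro tendsto_intros)
  moreover have "((\<lambda>F. cinner (f j) (\<Sum>k\<in>F. c k *\<^sub>C f k)) \<longlongrightarrow> c j) (finite_subsets_at_top UNIV)"
    by (intro tendsto_eventually, unfold eventually_finite_subsets_at_top)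
       (rule exI[of _ "{j}"], auto simp: cinner_orthonormal_sum[OF assms(1)])
  ultimately show ?thesis by (rule tendsto_unique[OF finite_subsets_at_top_neq_bot])
qed

text \<open>The series converges by Bessel's inequality, and the difference of \<open>u\<close> and
  its sum has all coefficients zero, so completeness kills it.\<close>

lemma complete_orthonormal_expansion:
  assumes "complete_orthonormal e"
  shows "((\<lambda>k. cinner (e k) u *\<^sub>C e k) has_sum u) UNIV"
proof -
  note e = complete_orthonormal_imp_orthonormal[OF assms]
  obtain v where v: "((\<lambda>k. cinner (e k) u *\<^sub>C e k) has_sum v) UNIV"
    using orthonormal_summable[OF e Bessel_summable[OF e, of u]] by (auto simp: summable_on_def)
  have "cinner (e k) (u - v) = 0" for k
    using orthonormal_has_sum_cinner[OF e v, of k] by (simp add: cinner_diff_right)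
  then have "u - v = 0" using assms unfolding complete_orthonormal_def by blast
  then show ?thesis using v by simp
qed

lemma Parseval:
  assumes "complete_orthonormal e"
  shows "(\<lambda>k. (cmod (cinner (e k) u))\<^sup>2) sums (norm u)\<^sup>2"
  by (rule has_sum_imp_sums orthonormal_has_sum_norm complete_orthonormal_imp_orthonormal
      complete_orthonormal_expansion assms)+

lemma complete_orthonormal_eqI:
  assumes "complete_orthonormal e" "\<And>k. cinner (e k) u = cinner (e k) v"
  shows "u = v"
proof -
  have "cinner (e k) (u - v) = 0" for k using assms(2) by (simp add: cinner_diff_right)
  then show ?thesis using assms(1) unfolding complete_orthonormal_def by (metis eq_iff_diff_eq_0)
qed

lemma orthonormal_sums:
  fixes f :: "nat \<Rightarrow> 'd::finite L2"
  assumes "orthonormal_family f" "summable (\<lambda>k. (cmod (c k))\<^sup>2)"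
  shows "summable (\<lambda>k. c k *\<^sub>C f k)"
    and "cinner (f j) (\<Sum>k. c k *\<^sub>C f k) = c j"
    and "(norm (\<Sum>k. c k *\<^sub>C f k))\<^sup>2 = (\<Sum>k. (cmod (c k))\<^sup>2)"
proof -
  obtain v where v: "((\<lambda>k. c k *\<^sub>C f k) has_sum v) UNIV"
    using orthonormal_summable[OF assms(1) summable_nonneg_imp_summable_on[OF assms(2)]]
    by (auto simp: summable_on_def)
  note s = has_sum_imp_sums[OF v]
  show "summable (\<lambda>k. c k *\<^sub>C f k)" using s by (rule sums_summable)
  show "cinner (f j) (\<Sum>k. c k *\<^sub>C f k) = c j"
    using orthonormal_has_sum_cinner[OF assms(1) v] s by (simp add: sums_iff)
  show "(norm (\<Sum>k. c k *\<^sub>C f k))\<^sup>2 = (\<Sum>k. (cmod (c k))\<^sup>2)"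
    using has_sum_imp_sums[OF orthonormal_has_sum_norm[OF assms(1) v]] s by (simp add: sums_iff)
qed

section \<open>Borel measurability in \<open>L2\<close> through scalar coordinates\<close>

text \<open>Simple functions are closed under addition whatever the topology of the target, so
  approximating the scalar coefficients by simple functions avoids the question whether addition on
  \<open>L2\<close> is jointly Borel measurable.\<close>

lemma measurable_scaleC_sum:
  fixes c :: "nat \<Rightarrow> 'a \<Rightarrow> complex"
  assumes "\<And>k. k < K \<Longrightarrow> c k \<in> borel_measurable M"
  shows "(\<lambda>\<omega>. \<Sum>k<K. c k \<omega> *\<^sub>C v k) \<in> borel_measurable M"
proof -
  have "\<forall>k<K. \<exists>F. (\<forall>i. simple_function M (F i)) \<and> (\<forall>x\<in>space M. (\<lambda>i. F i x) \<longlonglongrightarrow> c k x)"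
    using borel_measurable_implies_sequence_metric assms by metis
  then obtain F where F: "\<And>k i. k < K \<Longrightarrow> simple_function M (F k i)"
    "\<And>k x. k < K \<Longrightarrow> x \<in> space M \<Longrightarrow> (\<lambda>i. F k i x) \<longlonglongrightarrow> c k x" by metis
  show ?thesis
  proof (rule borel_measurable_LIMSEQ_metric)
    fix i
    have "n \<le> K \<Longrightarrow> simple_function M (\<lambda>\<omega>. \<Sum>k<n. F k i \<omega> *\<^sub>C v k)" for n
    proof (induct n)
      case (Suc n)
      then show ?case
        using simple_function_compose2[of M "\<lambda>\<omega>. \<Sum>k<n. F k i \<omega> *\<^sub>C v k" "F n i" "\<lambda>s z. s + z *\<^sub>C v n"] F(1)[of n i]
        by simp
    qed simp
    then show "(\<lambda>\<omega>. \<Sum>k<K. F k i \<omega> *\<^sub>C v k) \<in> borel_measurable M"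
      by (intro borel_measurable_simple_function) auto
  next
    fix x assume "x \<in> space M"
    then show "(\<lambda>i. \<Sum>k<K. F k i x *\<^sub>C v k) \<longlonglongrightarrow> (\<Sum>k<K. c k x *\<^sub>C v k)"
      using F(2) by (intro tendsto_sum bounded_linear.tendsto[OF bounded_linear_scaleC_left]) auto
  qed
qed

lemma measurable_cinner:
  assumes "X \<in> borel_measurable M"
  shows "(\<lambda>\<omega>. cinner u (X \<omega>)) \<in> borel_measurable M"
  by (rule measurable_compose[OF assms borel_measurable_continuous_onI])
     (rule bounded_linear.continuous_on[OF bounded_linear_cinner continuous_on_id])

text \<open>A random vector is the pointwise limit of its partial expansions along \<open>e\<close>.
  The countable basis thus supplies separability, and sums and differences become measurable
  coordinate by coordinate.\<close>

lemma borel_measurable_L2_iff: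
  fixes e :: "nat \<Rightarrow> 'd::finite L2"
  assumes "complete_orthonormal e"
  shows "X \<in> borel_measurable M \<longleftrightarrow> (\<forall>k. (\<lambda>\<omega>. cinner (e k) (X \<omega>)) \<in> borel_measurable M)"
proof
  assume *: "\<forall>k. (\<lambda>\<omega>. cinner (e k) (X \<omega>)) \<in> borel_measurable M"
  show "X \<in> borel_measurable M"
  proof (rule borel_measurable_LIMSEQ_metric)
    show "(\<lambda>\<omega>. \<Sum>k<n. cinner (e k) (X \<omega>) *\<^sub>C e k) \<in> borel_measurable M" for n
      using * by (intro measurable_scaleC_sum) auto
    show "(\<lambda>n. \<Sum>k<n. cinner (e k) (X \<omega>) *\<^sub>C e k) \<longlonglongrightarrow> X \<omega>" for \<omega>
      using has_sum_imp_sums[OF complete_orthonormal_expansion[OF assms, of "X \<omega>"]]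
      by (simp add: sums_def)
  qed
qed (auto intro: measurable_cinner)

lemma borel_measurable_L2_add:
  fixes e :: "nat \<Rightarrow> 'd::finite L2" and X Y :: "'a \<Rightarrow> 'd L2"
  assumes "complete_orthonormal e" "X \<in> borel_measurable M" "Y \<in> borel_measurable M"
  shows "(\<lambda>\<omega>. X \<omega> + Y \<omega>) \<in> borel_measurable M"
  by (rule iffD2[OF borel_measurable_L2_iff[OF assms(1)]])
     (use assms(2,3)[THEN measurable_cinner] in \<open>simp add: cinner_add_right\<close>)

lemma borel_measurable_L2_diff:
  fixes e :: "nat \<Rightarrow> 'd::finite L2" and X Y :: "'a \<Rightarrow> 'd L2"
  assumes "complete_orthonormal e" "X \<in> borel_measurable M" "Y \<in> borel_measurable M"
  shows "(\<lambda>\<omega>. X \<omega> - Y \<omega>) \<in> borel_measurable M"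
  by (rule iffD2[OF borel_measurable_L2_iff[OF assms(1)]])
     (use assms(2,3)[THEN measurable_cinner] in \<open>simp add: cinner_diff_right\<close>)

lemma borel_measurable_L2_sum:
  fixes e :: "nat \<Rightarrow> 'd::finite L2" and X :: "'i \<Rightarrow> 'a \<Rightarrow> 'd L2"
  assumes "complete_orthonormal e" "\<And>i. i \<in> I \<Longrightarrow> X i \<in> borel_measurable M"
  shows "(\<lambda>\<omega>. \<Sum>i\<in>I. X i \<omega>) \<in> borel_measurable M"
  by (rule iffD2[OF borel_measurable_L2_iff[OF assms(1)]])
     (use assms(2)[THEN measurable_cinner] in \<open>simp add: cinner_sum_right\<close>)

lemma borel_measurable_bounded_linear:
  assumes "bounded_linear A" "X \<in> borel_measurable M"
  shows "(\<lambda>\<omega>. A (X \<omega>)) \<in> borel_measurable M"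
  by (rule measurable_compose[OF assms(2) borel_measurable_continuous_onI])
     (rule bounded_linear.continuous_on[OF assms(1) continuous_on_id])

section \<open>The free Schroedinger group\<close>

lemma integral_cis_period:
  "integral\<^sup>L lborel (\<lambda>t. indicator {0..2*pi} t *\<^sub>R cis (of_int n * t)) = (if n = 0 then 2 * pi else 0)"
proof (cases "n = 0")
  case False
  have "has_bochner_integral lborel (\<lambda>t. indicator {0..2*pi} t *\<^sub>R cis (of_int n * t))
    ((1 / (\<i> * of_int n)) * cis (of_int n * (2*pi)) - (1 / (\<i> * of_int n)) * cis (of_int n * 0))"
  proof (rule has_bochner_integral_FTC_Icc)
    fix x :: real
    have "((\<lambda>t. (1 / (\<i> * of_int n)) * exp (\<i> * of_int n * complex_of_real t)) has_vector_derivative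
        exp (\<i> * of_int n * x)) (at x within {0..2*pi})"
      using False by (auto intro!: derivative_eq_intros has_vector_derivative_real_field simp: field_simps)
    then show "((\<lambda>t. (1 / (\<i> * of_int n)) * cis (of_int n * t)) has_vector_derivative cis (of_int n * x)) (at x within {0..2*pi})"
      by (simp add: cis_conv_exp mult.assoc)
  qed (auto intro!: continuous_intros)
  moreover have "cis (of_int n * (2*pi)) = 1"
    using cis_multiple_2pi[of "of_int n"] by (simp add: mult_ac)
  ultimately show ?thesis using False by (simp add: has_bochner_integral_iff)
qed (simp add: scaleR_conv_of_real)

text \<open>The exponential is a product of functions of one coordinate each and Lebesgue measure is
  a product measure, so the integral factors into one-dimensional ones over a full period.\<close>

lemma integral_torus_cis:
  fixes m :: "int ^ 'd::finite"
  shows "(LINT x|torus. cis (\<Sum>j\<in>UNIV. of_int (m $ j) * x $ j)) =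
    (if m = 0 then (2 * pi) ^ CARD('d) else 0)"
proof -
  define Q :: "(real^'d) set" where "Q = cbox 0 (\<chi> j. 2 * pi)"
  \<comment> \<open>The product representation of Lebesgue measure is indexed by
    \<open>Basis\<close>; \<open>n\<close> carries the frequencies over from coordinate indices to
    basis vectors.\<close>
  define n where "n b = m $ (SOME j. b = axis j (1::real))" for b :: "real^'d"
  have n: "n (axis j 1) = m $ j" for j
    unfolding n_def by (rule arg_cong[where f = "\<lambda>j. m $ j"]) (auto simp: axis_eq_axis)
  have B: "(Basis :: (real^'d) set) = (\<lambda>j. axis j 1) ` UNIV" by (auto simp: Basis_vec_def)
  have injB: "inj (\<lambda>j::'d. axis j (1::real))" by (auto simp: inj_def axis_eq_axis)
  define F :: "real^'d \<Rightarrow> real \<Rightarrow> complex" where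
    "F b t = indicator {0..2*pi} t *\<^sub>R cis (of_int (n b) * t)" for b t
  interpret product_sigma_finite "\<lambda>_::real^'d. lborel :: real measure" ..
  have intF: "integrable lborel (F b)" for b
    unfolding F_def by (intro borel_integrable_compact continuous_intros) auto
  have meas: "(\<lambda>x. indicator Q x *\<^sub>R cis (\<Sum>j\<in>UNIV. of_int (m $ j) * x $ j)) \<in> borel_measurable borel"
  proof -
    have "(\<lambda>x::real^'d. cis (\<Sum>j\<in>UNIV. of_int (m $ j) * x $ j)) \<in> borel_measurable borel"
      by (intro borel_measurable_continuous_onI continuous_intros)
    then show ?thesis unfolding Q_def by (intro borel_measurable_scaleR borel_measurable_indicator) auto
  qed
  have eq: "indicator Q x *\<^sub>R cis (\<Sum>j\<in>UNIV. of_int (m $ j) * x $ j) = (\<Prod>b\<in>Basis. F b (x \<bullet> b))" for x :: "real^'d"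
  proof -
    have "(\<Prod>b\<in>Basis. F b (x \<bullet> b)) = (\<Prod>j\<in>UNIV. F (axis j 1) (x $ j))"
      unfolding B by (subst prod.reindex[OF injB]) (simp add: inner_axis)
    also have "\<dots> = (\<Prod>j\<in>UNIV. of_real (indicator {0..2*pi} (x $ j)) * cis (of_int (m $ j) * x $ j))"
      unfolding F_def n by (simp add: scaleR_conv_of_real)
    also have "\<dots> = of_real (\<Prod>j\<in>UNIV. indicator {0..2*pi} (x $ j)) * cis (\<Sum>j\<in>UNIV. of_int (m $ j) * x $ j)"
      by (simp add: prod.distrib cis_conv_exp exp_sum sum_distrib_left)
    also have "(\<Prod>j\<in>UNIV. indicator {0..2*pi} (x $ j)) = (indicator Q x :: real)"
    proof (cases "x \<in> Q")
      case True
      then show ?thesis by (auto simp: Q_def mem_box_cart)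
    next
      case False
      then obtain j where "x $ j \<notin> {0..2*pi}" by (auto simp: Q_def mem_box_cart)
      then have "indicator {0..2*pi} (x $ j) = (0::real)" by (rule indicator_simps)
      then have "\<exists>j\<in>UNIV. indicator {0..2*pi} (x $ j) = (0::real)" by blast
      then show ?thesis using False by (simp add: prod_zero_iff)
    qed
    finally show ?thesis by (simp add: scaleR_conv_of_real)
  qed
  have "(LINT x|torus. cis (\<Sum>j\<in>UNIV. of_int (m $ j) * x $ j)) =
      (LINT x|lebesgue. indicator Q x *\<^sub>R cis (\<Sum>j\<in>UNIV. of_int (m $ j) * x $ j))"
    unfolding Q_def by (rule integral_restrict_space) simp
  also have "\<dots> = (LINT x|lborel. indicator Q x *\<^sub>R cis (\<Sum>j\<in>UNIV. of_int (m $ j) * x $ j))"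
    using meas by (intro integral_completion) simp
  also have "\<dots> = (LINT f|(\<Pi>\<^sub>M b\<in>Basis. lborel). (\<Prod>b\<in>Basis. F b ((\<Sum>b\<in>Basis. f b *\<^sub>R b) \<bullet> b)))"
    using meas unfolding eq by (subst lborel_eq) (subst integral_distr, auto)
  also have "\<dots> = (LINT f|(\<Pi>\<^sub>M b\<in>Basis. lborel). (\<Prod>b\<in>Basis. F b (f b)))"
    by (simp cong: prod.cong)
  also have "\<dots> = (\<Prod>b\<in>Basis. integral\<^sup>L lborel (F b))"
    by (rule product_integral_prod) (auto intro: intF)
  also have "\<dots> = (\<Prod>j\<in>UNIV. integral\<^sup>L lborel (F (axis j 1)))"
    unfolding B by (subst prod.reindex[OF injB]) simp
  also have "\<dots> = (\<Prod>j\<in>UNIV. if m $ j = 0 then 2 * complex_of_real pi else 0)"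
    unfolding F_def n integral_cis_period by (intro prod.cong) auto
  also have "\<dots> = (if m = 0 then (2 * pi) ^ CARD('d) else 0)"
    by (auto simp: vec_eq_iff prod_zero_iff)
  finally show ?thesis .
qed

lemma orthonormal_fourier_mode: "orthonormal_family (fourier_mode :: int ^ 'd \<Rightarrow> 'd::finite L2)"
  unfolding orthonormal_family_def
proof (intro allI)
  fix k l :: "int ^ 'd"
  define c where "c = 1 / sqrt ((2 * pi) ^ CARD('d))"
  have c: "c * c * (2 * pi) ^ CARD('d) = 1" unfolding c_def by simp
  have "cinner (fourier_mode k) (fourier_mode l) =
     (LINT x|torus. cnj (complex_of_real c * cis (\<Sum>j\<in>UNIV. of_int (k $ j) * x $ j)) *
        (complex_of_real c * cis (\<Sum>j\<in>UNIV. of_int (l $ j) * x $ j)))"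
    unfolding c_def by transfer simp
  also have "\<dots> = (LINT x|torus. complex_of_real (c * c) * cis (\<Sum>j\<in>UNIV. of_int ((l - k) $ j) * x $ j))"
    by (intro Bochner_Integration.integral_cong)
       (auto simp: cis_cnj cis_mult sum_negf[symmetric] sum.distrib[symmetric] algebra_simps)
  also have "\<dots> = complex_of_real (c * c) * (if l - k = 0 then (2 * pi) ^ CARD('d) else 0)"
    using integral_torus_cis[of "l - k"] by simp
  also have "\<dots> = (if k = l then 1 else 0)" 
    using c by (auto simp del: of_real_mult of_real_power simp: of_real_mult[symmetric] of_real_power[symmetric])
  finally show "cinner (fourier_mode k) (fourier_mode l) = (if k = l then 1 else 0)" .
qed

text \<open>The multipliers have modulus one, so Bessel's inequality makes the coefficients square
  summable; the \<open>infsum\<close> in \<open>free_group\<close> is therefore a genuine sum and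
  not a default value.\<close>

lemma free_group_has_sum:
  "((\<lambda>k. (cis (t * (\<Sum>j\<in>UNIV. (of_int (k $ j))\<^sup>2)) * cinner (fourier_mode k) u) *\<^sub>C fourier_mode k)
     has_sum free_group t u) UNIV"
  unfolding free_group_def
proof (rule has_sum_infsum, rule orthonormal_summable[OF orthonormal_fourier_mode])
  show "(\<lambda>k. (cmod (cis (t * (\<Sum>j\<in>UNIV. (of_int (k $ j))\<^sup>2)) * cinner (fourier_mode k) u))\<^sup>2) summable_on UNIV"
    using Bessel_summable[OF orthonormal_fourier_mode, of u] by (simp add: norm_mult)
qed

lemma cinner_fourier_free_group:
  "cinner (fourier_mode k) (free_group t u) =
     cis (t * (\<Sum>j\<in>UNIV. (of_int (k $ j))\<^sup>2)) * cinner (fourier_mode k) u"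
  by (rule orthonormal_has_sum_cinner[OF orthonormal_fourier_mode free_group_has_sum])

text \<open>The left-hand side is the norm of the component of \<open>u\<close> in the closed span
  of the Fourier modes, which Bessel's inequality bounds.\<close>

lemma norm_free_group_le: "norm (free_group t u) \<le> norm u"
proof -
  have "((\<lambda>k. (cmod (cinner (fourier_mode k) u))\<^sup>2) has_sum (norm (free_group t u))\<^sup>2) UNIV"
    using orthonormal_has_sum_norm[OF orthonormal_fourier_mode free_group_has_sum[of t u]]
    by (simp add: norm_mult)
  then have "(norm (free_group t u))\<^sup>2 \<le> (norm u)\<^sup>2"
    by (rule has_sum_le_finite_sums) (rule Bessel[OF orthonormal_fourier_mode])
  then show ?thesis by (rule power2_le_imp_le) simp
qed

lemma free_group_add: "free_group t (u + v) = free_group t u + free_group t v"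
proof (rule has_sum_unique[OF free_group_has_sum])
  show "((\<lambda>k. (cis (t * (\<Sum>j\<in>UNIV. (of_int (k $ j))\<^sup>2)) * cinner (fourier_mode k) (u + v)) *\<^sub>C fourier_mode k)
     has_sum free_group t u + free_group t v) UNIV"
    using has_sum_add[OF free_group_has_sum[of t u] free_group_has_sum[of t v]]
    by (simp add: cinner_add_right scaleC_add_left distrib_left)
qed

lemma free_group_scaleC: "free_group t (c *\<^sub>C u) = c *\<^sub>C free_group t u"
proof (rule has_sum_unique[OF free_group_has_sum])
  show "((\<lambda>k. (cis (t * (\<Sum>j\<in>UNIV. (of_int (k $ j))\<^sup>2)) * cinner (fourier_mode k) (c *\<^sub>C u)) *\<^sub>C fourier_mode k)
     has_sum c *\<^sub>C free_group t u) UNIV"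
    using has_sum_bounded_linear[OF bounded_linear_scaleC[of c] free_group_has_sum[of t u]]
    by (simp add: cinner_scaleC_right scaleC_scaleC mult_ac o_def)
qed

lemma free_group_free_group: "free_group t (free_group s u) = free_group (t + s) u"
  unfolding free_group_def[of t] free_group_def[of "t + s"] cinner_fourier_free_group
  by (simp add: mult.assoc[symmetric] cis_mult distrib_right)

lemma bounded_linear_free_group: "bounded_linear (free_group t)"
  by (rule bounded_linear_intro[where K = 1])
     (auto simp: free_group_add scaleR_L2_def free_group_scaleC norm_free_group_le)

lemmas free_group_diff = linear_diff[OF bounded_linear.linear[OF bounded_linear_free_group]]
lemmas free_group_sum = linear_sum[OF bounded_linear.linear[OF bounded_linear_free_group]]

lemma free_group_fourier_mode:
  fixes k :: "int ^ 'd::finite"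
  shows "free_group t (fourier_mode k) = cis (t * (\<Sum>j\<in>UNIV. (of_int (k $ j))\<^sup>2)) *\<^sub>C fourier_mode k"
proof -
  have o: "cinner (fourier_mode l) (fourier_mode k) = (if l = k then 1 else 0)" for l
    using orthonormal_fourier_mode[where 'd = 'd] by (simp add: orthonormal_family_def)
  have "free_group t (fourier_mode k) = (\<Sum>\<^sub>\<infinity>l\<in>{k}. (cis (t * (\<Sum>j\<in>UNIV. (of_int (l $ j))\<^sup>2)) *
     cinner (fourier_mode l) (fourier_mode k)) *\<^sub>C fourier_mode l)"
    unfolding free_group_def by (intro infsum_cong_neutral) (auto simp: o)
  then show ?thesis by (simp add: o)
qed

text \<open>On finitely many modes the orbit is a trigonometric polynomial in \<open>t\<close>, and
  contractivity makes the approximation by such orbits uniform in \<open>t\<close>.\<close>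

lemma continuous_on_free_group_time: "continuous_on UNIV (\<lambda>t. free_group t u)"
proof (rule uniform_limit_theorem[where F = "finite_subsets_at_top UNIV"])
  define uF where "uF F = (\<Sum>k\<in>F. cinner (fourier_mode k) u *\<^sub>C fourier_mode k)" for F
  show "\<forall>\<^sub>F F in finite_subsets_at_top UNIV. continuous_on UNIV (\<lambda>t. free_group t (uF F))"
    unfolding uF_def free_group_sum free_group_scaleC free_group_fourier_mode scaleC_scaleC
    by (intro always_eventually allI continuous_intros
      bounded_linear.continuous_on[OF bounded_linear_scaleC_left])
  \<comment> \<open>The truncations converge to \<open>free_group 0 u\<close>; the group law then
    absorbs the extra \<open>free_group 0\<close> into \<open>free_group t\<close>.\<close>
  have lim: "(uF \<longlongrightarrow> free_group 0 u) (finite_subsets_at_top UNIV)"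
    using free_group_has_sum[of 0 u] unfolding has_sum_def uF_def by simp
  show "uniform_limit UNIV (\<lambda>F t. free_group t (uF F)) (\<lambda>t. free_group t u) (finite_subsets_at_top UNIV)"
  proof (rule uniform_limitI)
    fix e :: real assume "0 < e"
    from tendstoD[OF lim this] 
    show "\<forall>\<^sub>F F in finite_subsets_at_top UNIV. \<forall>t\<in>UNIV. dist (free_group t (uF F)) (free_group t u) < e"
    proof eventually_elim
      case (elim F)
      have "free_group t (uF F - free_group 0 u) = free_group t (uF F) - free_group t u" for t
        by (simp add: free_group_diff free_group_free_group)
      then have "norm (free_group t (uF F) - free_group t u) \<le> norm (uF F - free_group 0 u)" for t
        using norm_free_group_le[of t "uF F - free_group 0 u"] by simp
      then show ?case using elim unfolding dist_norm by (blast intro: le_less_trans)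
    qed
  qed
qed simp

text \<open>Joint continuity: strong continuity in time treats the fixed limit vector, contractivity
  the moving remainder \<open>g x - b\<close>.\<close>

lemma tendsto_free_group:
  assumes "(f \<longlongrightarrow> a) F" "(g \<longlongrightarrow> b) F"
  shows "((\<lambda>x. free_group (f x) (g x)) \<longlongrightarrow> free_group a b) F"
proof -
  have 1: "((\<lambda>x. free_group (f x) b) \<longlongrightarrow> free_group a b) F"
    by (rule continuous_on_tendsto_compose[OF continuous_on_free_group_time assms(1)]) auto
  have "((\<lambda>x. free_group (f x) (g x - b)) \<longlongrightarrow> 0) F"
  proof (rule Lim_null_comparison)
    show "\<forall>\<^sub>F x in F. norm (free_group (f x) (g x - b)) \<le> norm (g x - b)"
      by (simp add: norm_free_group_le)
    show "((\<lambda>x. norm (g x - b)) \<longlongrightarrow> 0) F"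
      using assms(2) by (simp add: LIM_zero tendsto_norm_zero)
  qed
  from tendsto_add[OF this 1] show ?thesis by (simp add: free_group_diff)
qed

lemma continuous_on_free_group:
  assumes "continuous_on A f" "continuous_on A g"
  shows "continuous_on A (\<lambda>x. free_group (f x) (g x))"
  using assms unfolding continuous_on_def by (auto intro: tendsto_free_group)

lemma norm_free_group_time_diff_le:
  "norm (free_group a u - free_group b u) \<le> norm (free_group (a - b) u - free_group 0 u)"
proof -
  have "free_group a u - free_group b u = free_group b (free_group (a - b) u - free_group 0 u)"
    by (simp add: free_group_diff free_group_free_group)
  then show ?thesis by (simp add: norm_free_group_le)
qed

section \<open>The phase flow\<close>

lemma rep_zero_L2: "AE x in torus. rep_L2 (0 :: 'd::finite L2) x = 0"
  using rep_scaleC[of 0 "0 :: 'd L2"] by simp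

lemma borel_measurable_Re_borel: "Re \<in> borel_measurable borel"
  by (intro borel_measurable_continuous_onI continuous_intros)

text \<open>Completeness of Lebesgue measure. It is used for the phase factor, since
  \<open>V u\<close> comes with no measurability of its own.\<close>

lemma borel_measurable_torus_AE:
  fixes f g :: "real ^ 'd::finite \<Rightarrow> complex"
  assumes "f \<in> borel_measurable torus" "AE x in torus. f x = g x"
  shows "g \<in> borel_measurable torus"
proof -
  let ?S = "cbox 0 (\<chi> j. 2 * pi) :: (real ^ 'd) set"
  have S: "?S \<in> sets lebesgue" by simp
  have "(\<lambda>x. if x \<in> ?S then f x else 0) \<in> borel_measurable lebesgue"
    using assms(1) borel_measurable_if[OF S] by blast
  moreover have "AE x in lebesgue. (if x \<in> ?S then f x else 0) = (if x \<in> ?S then g x else 0)"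
    using assms(2) S by (subst (asm) AE_restrict_space_iff) auto
  ultimately have "(\<lambda>x. if x \<in> ?S then g x else 0) \<in> borel_measurable lebesgue"
    by (rule borel_measurable_AE)
  then show ?thesis using borel_measurable_if[OF S] by blast
qed

lemma norm_L2_eqI:
  assumes "AE x in torus. cmod (rep_L2 u x) = cmod (rep_L2 v x)"
  shows "norm u = norm v"
proof -
  have "ennreal ((norm u)\<^sup>2) = ennreal ((norm v)\<^sup>2)"
    unfolding norm_L2_sq_nn using assms by (intro nn_integral_cong_AE) (auto elim: eventually_mono)
  then have "(norm u)\<^sup>2 = (norm v)\<^sup>2" by (simp add: ennreal_inj)
  then show ?thesis by (simp add: power2_eq_iff_nonneg)
qed

lemma rep_nonlinearity:
  assumes "nonlinearity V F"
  shows "AE x in torus. rep_L2 (F u) x = of_real (V u x) * rep_L2 u x"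
  using assms unfolding nonlinearity_def by (elim conjE) (erule spec)

lemma nonlinearity_cmod_cong:
  assumes "nonlinearity V F" "AE x in torus. cmod (rep_L2 u x) = cmod (rep_L2 v x)"
  shows "AE x in torus. V u x = V v x"
  using assms unfolding nonlinearity_def by blast

lemma square_integrable_phase_flow:
  fixes u :: "'d::finite L2"
  assumes "nonlinearity V F"
  shows "square_integrable (\<lambda>x. exp (- \<i> * of_real t * of_real (V u x)) * rep_L2 u x)"
proof -
  \<comment> \<open>A measurable stand-in: the quotient \<open>F u / u\<close> recovers
    \<open>V u\<close> where \<open>u\<close> is nonzero, and elsewhere the final factor
    \<open>u\<close> makes the phase irrelevant.\<close>
  define g where "g x = exp (- \<i> * of_real t * of_real (Re (rep_L2 (F u) x / rep_L2 u x))) * rep_L2 u x" for x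
  let ?f = "\<lambda>x. exp (- \<i> * of_real t * of_real (V u x)) * rep_L2 u x"
  have "g \<in> borel_measurable torus"
    unfolding g_def by (auto intro!: borel_measurable_times measurable_compose[OF _ borel_measurable_exp]
      measurable_compose[OF _ borel_measurable_Re_borel] borel_measurable_divide borel_measurable_of_real)
  moreover have "AE x in torus. g x = ?f x"
    using rep_nonlinearity[OF assms, of u] by eventually_elim (auto simp: g_def)
  ultimately have m: "?f \<in> borel_measurable torus" by (rule borel_measurable_torus_AE)
  have "cmod (?f x) = cmod (rep_L2 u x)" for x
    using norm_exp_i_times[of "- t * V u x"] by (simp add: norm_mult)
  then show ?thesis
    using m square_integrable_rep[of u] by (simp only: square_integrable_def)
qed

lemma rep_phase_flow:
  assumes "nonlinearity V F"
  shows "AE x in torus. rep_L2 (phase_flow V t u) x = exp (- \<i> * of_real t * of_real (V u x)) * rep_L2 u x"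
  unfolding phase_flow_def by (rule rep_abs_L2[OF square_integrable_phase_flow[OF assms]])

lemma cmod_exp_i_real [simp]: "cmod (exp (- \<i> * of_real t * of_real v)) = 1"
  "cmod (exp (- (\<i> * of_real t * of_real v))) = 1"
  using norm_exp_i_times[of "- t * v"] by (simp_all add: mult.assoc)

lemma cmod_rep_phase_flow:
  assumes "nonlinearity V F"
  shows "AE x in torus. cmod (rep_L2 (phase_flow V t u) x) = cmod (rep_L2 u x)"
  using rep_phase_flow[OF assms, of t u] by eventually_elim (simp add: norm_mult)

lemma norm_phase_flow:
  assumes "nonlinearity V F"
  shows "norm (phase_flow V t u) = norm u"
  by (rule norm_L2_eqI[OF cmod_rep_phase_flow[OF assms]])

text \<open>\<open>V\<close> depends on the modulus only and the flow preserves the modulus, so the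
  potential stays frozen at \<open>V u\<close>. This is why \<open>phase_flow\<close> solves
  \<open>\<i> du/dt = F u\<close> exactly.\<close>

lemma rep_nonlinearity_phase_flow:
  assumes "nonlinearity V F"
  shows "AE x in torus. rep_L2 (F (phase_flow V t u)) x =
    of_real (V u x) * (exp (- \<i> * of_real t * of_real (V u x)) * rep_L2 u x)"
  using rep_phase_flow[OF assms, of t u] rep_nonlinearity[OF assms, of "phase_flow V t u"]
    nonlinearity_cmod_cong[OF assms cmod_rep_phase_flow[OF assms, of t u]]
  by eventually_elim simp

section \<open>Euler's method along the phase flow\<close>

text \<open>The local error of one explicit Euler step of size \<open>h\<close> for
  \<open>\<i> du/dt = F u\<close>, started at \<open>u\<close>.\<close>

definition euler_defect where
  "euler_defect V F h u = phase_flow V h u - u + (\<i> * of_real h) *\<^sub>C F u"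

lemma rep_euler_defect:
  assumes "nonlinearity V F"
  shows "AE x in torus. rep_L2 (euler_defect V F h u) x =
    (exp (- \<i> * of_real h * of_real (V u x)) - 1 + \<i> * of_real h * of_real (V u x)) * rep_L2 u x"
  using rep_phase_flow[OF assms, of h u] rep_nonlinearity[OF assms, of u]
    rep_add_L2[of "phase_flow V h u - u" "(\<i> * of_real h) *\<^sub>C F u"]
    rep_diff_L2[of "phase_flow V h u" u] rep_scaleC[of "\<i> * of_real h" "F u"]
  unfolding euler_defect_def by eventually_elim (simp add: algebra_simps)

text \<open>Because the potential is frozen, the local error at time \<open>s\<close> is the one at
  time 0 multiplied by the unimodular factor \<open>exp (- \<i> s V u)\<close>. All steps thus share
  one error bound.\<close>

lemma norm_euler_defect_phase_flow:
  assumes "nonlinearity V F"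
  shows "norm (phase_flow V (s + h) u - phase_flow V s u + (\<i> * of_real h) *\<^sub>C F (phase_flow V s u)) =
    norm (euler_defect V F h u)"
proof (rule norm_L2_eqI)
  let ?d = "phase_flow V (s + h) u - phase_flow V s u"
  let ?g = "(\<i> * of_real h) *\<^sub>C F (phase_flow V s u)"
  have "AE x in torus. rep_L2 (?d + ?g) x =
    exp (- \<i> * of_real s * of_real (V u x)) *
    ((exp (- \<i> * of_real h * of_real (V u x)) - 1 + \<i> * of_real h * of_real (V u x)) * rep_L2 u x)"
    using rep_phase_flow[OF assms, of "s + h" u] rep_phase_flow[OF assms, of s u]
      rep_nonlinearity_phase_flow[OF assms, of s u] rep_add_L2[of ?d ?g]
      rep_diff_L2[of "phase_flow V (s + h) u" "phase_flow V s u"]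
      rep_scaleC[of "\<i> * of_real h" "F (phase_flow V s u)"]
  proof eventually_elim
    case (elim x)
    have "exp (- \<i> * of_real (s + h) * of_real (V u x)) =
      exp (- \<i> * of_real s * of_real (V u x)) * exp (- \<i> * of_real h * of_real (V u x))"
      by (simp add: exp_add[symmetric] algebra_simps)
    then show ?case using elim by (simp add: algebra_simps)
  qed
  then show "AE x in torus. cmod (rep_L2 (?d + ?g) x) = cmod (rep_L2 (euler_defect V F h u) x)"
    using rep_euler_defect[OF assms, of h u] by eventually_elim (simp add: norm_mult)
qed

lemma cmod_exp_i_minus_one_le:
  "cmod (exp (- \<i> * of_real h * of_real v) - 1) \<le> \<bar>h * v\<bar>"
  using iexp_approx1[of "- (h * v)" 0] by (simp add: mult.assoc abs_mult)

lemma cmod_exp_i_taylor_le: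
  "cmod (exp (- \<i> * of_real h * of_real v) - 1 + \<i> * of_real h * of_real v) \<le> (h * v)\<^sup>2 / 2"
proof -
  have "iexp (- (h * v)) - (\<Sum>k\<le>1. (\<i> * complex_of_real (- (h * v)))^k / fact k) =
      exp (- \<i> * of_real h * of_real v) - 1 + \<i> * of_real h * of_real v"
    by (simp add: mult.assoc)
  then show ?thesis
    using iexp_approx1[of "- (h * v)" 1] by (simp only:) (simp add: power2_eq_square)
qed

text \<open>\<open>V u\<close> may be unbounded, so a rate in norm cannot be expected. The
  second-order Taylor bound gives convergence pointwise, while the first-order bound gives the
  square integrable majorant \<open>2 |t| |V u| |u| = 2 |t| |F u|\<close> for dominated
  convergence.\<close>

lemma euler_defect_tendsto:
  fixes u :: "'d::finite L2"
  assumes N: "nonlinearity V F"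
  shows "(\<lambda>n. real n * norm (euler_defect V F (t / real n) u)) \<longlonglongrightarrow> 0"
proof -
  let ?r = "\<lambda>n x. rep_L2 (euler_defect V F (t / real n) u) x"
  have rep: "AE x in torus. \<forall>n. ?r n x =
    (exp (- \<i> * of_real (t / real n) * of_real (V u x)) - 1 + \<i> * of_real (t / real n) * of_real (V u x)) * rep_L2 u x"
    unfolding AE_all_countable using rep_euler_defect[OF N] by blast
  have "(\<lambda>n. LINT x|torus. (real n * cmod (?r n x))\<^sup>2) \<longlonglongrightarrow> (LINT x|(torus :: (real ^ 'd) measure). 0)"
  proof (rule integral_dominated_convergence[where w = "\<lambda>x. (2 * \<bar>t\<bar> * cmod (rep_L2 (F u) x))\<^sup>2"])
    show "integrable torus (\<lambda>x. (2 * \<bar>t\<bar> * cmod (rep_L2 (F u) x))\<^sup>2)"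
      using square_integrable_rep[of "F u"] unfolding square_integrable_def power_mult_distrib
      by (intro integrable_mult_right) auto
    show "AE x in torus. (\<lambda>n. (real n * cmod (?r n x))\<^sup>2) \<longlonglongrightarrow> 0"
      using rep
    proof eventually_elim
      case (elim x)
      define y where "y = t * V u x"
      have "norm (real n * cmod (?r n x)) \<le> (y\<^sup>2 / 2 * cmod (rep_L2 u x)) * (1 / real n)" for n
      proof (cases "n = 0")
        case False
        have "cmod (exp (- \<i> * of_real (t / real n) * of_real (V u x)) - 1 + \<i> * of_real (t / real n) * of_real (V u x)) \<le> (y / n)\<^sup>2 / 2"
          using cmod_exp_i_taylor_le[of "t / n" "V u x"] by (simp add: y_def)
        then have "cmod (?r n x) \<le> (y / n)\<^sup>2 / 2 * cmod (rep_L2 u x)"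
          unfolding elim[rule_format] norm_mult by (intro mult_right_mono) auto
        then have "real n * cmod (?r n x) \<le> real n * ((y / n)\<^sup>2 / 2 * cmod (rep_L2 u x))"
          by (intro mult_left_mono) auto
        also have "\<dots> = (y\<^sup>2 / 2 * cmod (rep_L2 u x)) * (1 / real n)"
          using False by (simp add: power2_eq_square field_simps)
        finally show ?thesis by simp
      qed simp
      then have "(\<lambda>n. real n * cmod (?r n x)) \<longlonglongrightarrow> 0"
        by (rule Lim_null_comparison[OF always_eventually[OF allI] tendsto_mult_right_zero[OF lim_1_over_n]])
      from tendsto_power[OF this, of 2] show ?case by simp
    qed
    show "AE x in torus. norm ((real n * cmod (?r n x))\<^sup>2) \<le> (2 * \<bar>t\<bar> * cmod (rep_L2 (F u) x))\<^sup>2" for n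
      using rep rep_nonlinearity[OF N, of u]
    proof eventually_elim
      case (elim x)
      define y where "y = t * V u x"
      have "real n * cmod (?r n x) \<le> 2 * \<bar>t\<bar> * cmod (rep_L2 (F u) x)"
      proof (cases "n = 0")
        case False
        have "cmod (exp (- \<i> * of_real (t / real n) * of_real (V u x)) - 1) \<le> \<bar>y\<bar> / n"
          using cmod_exp_i_minus_one_le[of "t / n" "V u x"] by (simp add: y_def abs_mult)
        moreover have "cmod (\<i> * of_real (t / real n) * of_real (V u x)) = \<bar>y\<bar> / n"
          by (simp add: norm_mult norm_divide y_def abs_mult)
        ultimately have "cmod (exp (- \<i> * of_real (t / real n) * of_real (V u x)) - 1 + \<i> * of_real (t / real n) * of_real (V u x)) \<le> 2 * (\<bar>y\<bar> / n)"
          using norm_triangle_ineq[of "exp (- \<i> * of_real (t / real n) * of_real (V u x)) - 1" "\<i> * of_real (t / real n) * of_real (V u x)"]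
          by linarith
        then have "cmod (?r n x) \<le> 2 * (\<bar>y\<bar> / n) * cmod (rep_L2 u x)"
          unfolding elim(1)[rule_format] norm_mult by (intro mult_right_mono) auto
        then have "real n * cmod (?r n x) \<le> real n * (2 * (\<bar>y\<bar> / n) * cmod (rep_L2 u x))"
          by (intro mult_left_mono) auto
        also have "\<dots> = 2 * \<bar>t\<bar> * cmod (rep_L2 (F u) x)"
          using False elim(2) by (simp add: norm_mult y_def abs_mult)
        finally show ?thesis .
      qed simp
      then show ?case by (simp add: power_mono)
    qed
  qed auto
  moreover have "(LINT x|torus. (real n * cmod (?r n x))\<^sup>2) = (real n * norm (euler_defect V F (t / real n) u))\<^sup>2" for n
    unfolding power_mult_distrib norm_L2_sq by simp
  ultimately have "(\<lambda>n. (real n * norm (euler_defect V F (t / real n) u))\<^sup>2) \<longlonglongrightarrow> 0" by simp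
  from tendsto_real_sqrt[OF this] show ?thesis by simp
qed

lemma phase_flow_zero:
  assumes "nonlinearity V F"
  shows "phase_flow V 0 u = u"
  using rep_phase_flow[OF assms, of 0 u] by (intro L2_eqI) simp

text \<open>The phase flow is the flow of \<open>\<i> du/dt = F u\<close>, so it inherits the local Lipschitz bound of \<open>F\<close>
  through Euler's method and a discrete Gronwall argument.\<close>

lemma phase_flow_Lipschitz:
  assumes N: "nonlinearity V F" and "0 \<le> t"
    and L: "\<And>u w. norm (F u - F w) \<le> (C + K * ((norm u)\<^sup>2 + (norm w)\<^sup>2)) * norm (u - w)"
    and C: "0 \<le> C" "0 \<le> K"
  shows "norm (phase_flow V t u - phase_flow V t w) \<le>
    exp (t * (C + K * ((norm u)\<^sup>2 + (norm w)\<^sup>2))) * norm (u - w)"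
proof -
  define l where "l = C + K * ((norm u)\<^sup>2 + (norm w)\<^sup>2)"
  have l: "0 \<le> l" using C by (auto simp: l_def)
  define D where "D s = phase_flow V s u - phase_flow V s w" for s
  define \<epsilon> where "\<epsilon> h = norm (euler_defect V F h u) + norm (euler_defect V F h w)" for h
  have step: "norm (D (s + h)) \<le> (1 + h * l) * norm (D s) + \<epsilon> h" if "0 \<le> h" for s h
  proof -
    let ?r = "\<lambda>u. phase_flow V (s + h) u - phase_flow V s u + (\<i> * of_real h) *\<^sub>C F (phase_flow V s u)"
    let ?q = "(\<i> * of_real h) *\<^sub>C (F (phase_flow V s u) - F (phase_flow V s w))"
    have "D (s + h) = (D s + ?r u) - (?r w + ?q)"
      unfolding D_def scaleC_diff_right by simp
    then have "norm (D (s + h)) \<le> norm (D s + ?r u) + norm (?r w + ?q)"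
      by (simp only: norm_triangle_ineq4)
    moreover have "norm (D s + ?r u) \<le> norm (D s) + norm (?r u)" "norm (?r w + ?q) \<le> norm (?r w) + norm ?q"
      by (rule norm_triangle_ineq)+
    \<comment> \<open>The local Lipschitz constant \<open>l\<close>, fixed by the initial norms,
      stays valid at time \<open>s\<close> because the flow preserves norms.\<close>
    moreover have "norm ?q \<le> h * (l * norm (D s))"
      using L[of "phase_flow V s u" "phase_flow V s w"] that
      by (auto simp: norm_scaleC norm_mult norm_phase_flow[OF N] l_def D_def intro!: mult_left_mono)
    ultimately have "norm (D (s + h)) \<le> norm (D s) + norm (?r u) + norm (?r w) + h * (l * norm (D s))"
      by linarith
    then show ?thesis unfolding norm_euler_defect_phase_flow[OF N] \<epsilon>_def by (simp add: algebra_simps)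
  qed
  have iter: "norm (D (real k * h)) \<le> (1 + h * l)^k * (norm (u - w) + real k * \<epsilon> h)" if "0 \<le> h" for k h
  proof (induct k)
    case 0
    show ?case by (simp add: D_def phase_flow_zero[OF N])
  next
    case (Suc k)
    have e: "0 \<le> \<epsilon> h" by (simp add: \<epsilon>_def)
    have 1: "1 \<le> (1 + h * l)^Suc k" using that l by (intro one_le_power) auto
    have "norm (D (real (Suc k) * h)) \<le> (1 + h * l) * norm (D (real k * h)) + \<epsilon> h"
      using step[OF that, of "real k * h"] by (simp add: algebra_simps)
    also have "\<dots> \<le> (1 + h * l) * ((1 + h * l)^k * (norm (u - w) + real k * \<epsilon> h)) + \<epsilon> h"
      using Suc that l by (intro add_right_mono mult_left_mono) auto
    also have "\<dots> \<le> (1 + h * l)^Suc k * (norm (u - w) + real k * \<epsilon> h) + (1 + h * l)^Suc k * \<epsilon> h"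
      using mult_right_mono[OF 1 e] by (simp add: mult.assoc)
    finally show ?case by (simp add: algebra_simps)
  qed
  have "norm (D t) \<le> exp (t * l) * (norm (u - w) + real n * \<epsilon> (t / real n))" if n: "0 < n" for n
  proof -
    have "norm (D t) \<le> (1 + t / n * l)^n * (norm (u - w) + real n * \<epsilon> (t / real n))"
      using iter[of "t / n" n] n \<open>0 \<le> t\<close> by simp
    also have "\<dots> \<le> exp (t / n * l) ^ n * (norm (u - w) + real n * \<epsilon> (t / real n))"
      using \<open>0 \<le> t\<close> l by (intro mult_right_mono power_mono exp_ge_add_one_self) (auto simp: \<epsilon>_def)
    also have "exp (t / n * l) ^ n = exp (t * l)" using n by (simp add: exp_of_nat_mult[symmetric])
    finally show ?thesis .
  qed
  \<comment> \<open>After \<open>n\<close> steps of size \<open>t / n\<close>, \<open>n\<close>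
    local errors have accumulated; their sum vanishes in the limit by
    \<open>euler_defect_tendsto\<close>.\<close>
  moreover have "(\<lambda>n. exp (t * l) * (norm (u - w) + real n * \<epsilon> (t / real n))) \<longlonglongrightarrow> exp (t * l) * (norm (u - w) + (0 + 0))"
    unfolding \<epsilon>_def distrib_left[of "real _"]
    by (intro tendsto_intros euler_defect_tendsto[OF N])
  ultimately have "norm (D t) \<le> exp (t * l) * (norm (u - w) + (0 + 0))"
    by (rule_tac LIMSEQ_le_const) (assumption, rule exI[of _ 1], simp)
  then show ?thesis by (simp add: D_def l_def)
qed

lemma continuous_phase_flow:
  assumes N: "nonlinearity V F" and "0 \<le> t"
  shows "continuous_on UNIV (phase_flow V t)"
proof -
  obtain C K where CK: "0 < C" "0 < K"
    "\<And>u w. norm (F u - F w) \<le> (C + K * ((norm w)\<^sup>2 + (norm u)\<^sup>2)) * norm (u - w)"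
    using N unfolding nonlinearity_def by blast
  have "(phase_flow V t \<longlongrightarrow> phase_flow V t w) (at w)" for w
  proof (rule LIM_zero_cancel, rule Lim_null_comparison)
    show "\<forall>\<^sub>F u in at w. norm (phase_flow V t u - phase_flow V t w) \<le>
      exp (t * (C + K * ((norm u)\<^sup>2 + (norm w)\<^sup>2))) * norm (u - w)"
      using CK by (intro always_eventually allI phase_flow_Lipschitz[OF N \<open>0 \<le> t\<close>]) (auto simp: add.commute)
    have "((\<lambda>u. exp (t * (C + K * ((norm u)\<^sup>2 + (norm w)\<^sup>2))) * norm (u - w)) \<longlongrightarrow>
      exp (t * (C + K * ((norm w)\<^sup>2 + (norm w)\<^sup>2))) * norm (w - w)) (at w)"
      by (intro tendsto_intros)
    then show "((\<lambda>u. exp (t * (C + K * ((norm u)\<^sup>2 + (norm w)\<^sup>2))) * norm (u - w)) \<longlongrightarrow> 0) (at w)" by simp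
  qed
  then show ?thesis by (simp add: continuous_on_def)
qed

text \<open>Pointwise \<open>cnj u * F u = V u * (cmod u)^2\<close> is real; this is the
  infinitesimal form of norm conservation.\<close>

lemma Im_cinner_nonlinearity:
  assumes "nonlinearity V F"
  shows "Im (cinner u (F u)) = 0"
proof -
  have "cinner u (F u) = (LINT x|torus. complex_of_real (Re (cnj (rep_L2 u x) * rep_L2 (F u) x)))"
    unfolding cinner_rep
  proof (rule integral_cong_AE)
    show m: "(\<lambda>x. cnj (rep_L2 u x) * rep_L2 (F u) x) \<in> borel_measurable torus"
      by (intro borel_measurable_integrable square_integrable_mult) auto
    show "(\<lambda>x. complex_of_real (Re (cnj (rep_L2 u x) * rep_L2 (F u) x))) \<in> borel_measurable torus"
      by (rule measurable_compose[OF m, of "\<lambda>z. complex_of_real (Re z)"])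
         (intro borel_measurable_continuous_onI continuous_intros)
    show "AE x in torus. cnj (rep_L2 u x) * rep_L2 (F u) x = complex_of_real (Re (cnj (rep_L2 u x) * rep_L2 (F u) x))"
      using rep_nonlinearity[OF assms, of u]
      by eventually_elim (simp add: complex_eq_iff algebra_simps)
  qed
  then show ?thesis by (simp only: integral_complex_of_real Im_complex_of_real)
qed

lemma nonlinearity_zero:
  fixes F :: "'d::finite L2 \<Rightarrow> 'd L2"
  assumes "nonlinearity V F"
  shows "F 0 = 0"
  by (rule L2_eqI) (use rep_nonlinearity[OF assms, of 0] rep_zero_L2 in \<open>eventually_elim, simp\<close>)

section \<open>Exponential moments of Gaussian arrays\<close>

text \<open>Completing the square turns the integrand into a constant times another Gaussian
  density. Bounding the constant by a pure exponential is what lets the estimate be multiplied over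
  coordinates and iterated over steps.\<close>

lemma gaussian_exp_quadratic:
  assumes h: "0 < h" and b: "0 \<le> b" "2 * b * h \<le> 1/2"
  shows "(\<integral>\<^sup>+x. ennreal (exp (a * x + b * x\<^sup>2)) * ennreal (normal_density 0 (sqrt h) x) \<partial>lborel)
    \<le> ennreal (exp (2 * b * h + a\<^sup>2 * h))"
proof -
  define y where "y = 2 * b * h"
  have y: "0 \<le> y" "y \<le> 1/2" using assms by (auto simp: y_def)
  \<comment> \<open>Standard deviation of the tilted Gaussian, whose mean is \<open>a s^2\<close>;
    positivity of \<open>1 - y\<close> is the condition for the integral to be finite.\<close>
  define s where "s = sqrt (h / (1 - y))"
  have s: "0 < s" "s\<^sup>2 = h / (1 - y)" using h y by (auto simp: s_def)
  have sq: "s / sqrt h = 1 / sqrt (1 - y)" using h y by (simp add: s_def real_sqrt_divide)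
  have eq: "exp (a * x + b * x\<^sup>2) * normal_density 0 (sqrt h) x =
    (s / sqrt h) * exp (a\<^sup>2 * s\<^sup>2 / 2) * normal_density (a * s\<^sup>2) s x" for x
  proof -
    have 1: "a * x + b * x\<^sup>2 + - (x - 0)\<^sup>2 / (2 * (sqrt h)\<^sup>2) = a\<^sup>2 * s\<^sup>2 / 2 + - (x - a * s\<^sup>2)\<^sup>2 / (2 * s\<^sup>2)"
    proof -
      have b: "b = (1/h - 1/s\<^sup>2) / 2" using h y s by (simp add: y_def field_simps)
      show ?thesis using h s(1) unfolding b by (simp add: field_simps power2_eq_square)
    qed
    have 2: "sqrt (2 * pi * s\<^sup>2) = s * sqrt (2 * pi)" "sqrt (2 * pi * (sqrt h)\<^sup>2) = sqrt h * sqrt (2 * pi)"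
      using s(1) h by (simp_all only: real_sqrt_mult real_sqrt_abs abs_of_pos real_sqrt_gt_0_iff mult.commute)
    have "exp (a * x + b * x\<^sup>2) * normal_density 0 (sqrt h) x
      = 1 / (sqrt h * sqrt (2 * pi)) * exp (a * x + b * x\<^sup>2 + - (x - 0)\<^sup>2 / (2 * (sqrt h)\<^sup>2))"
      unfolding normal_density_def 2 exp_add by simp
    also have "\<dots> = (s / sqrt h) * exp (a\<^sup>2 * s\<^sup>2 / 2) * (1 / (s * sqrt (2 * pi)) * exp (- (x - a * s\<^sup>2)\<^sup>2 / (2 * s\<^sup>2)))"
      unfolding 1 exp_add using s h by simp
    finally show ?thesis unfolding normal_density_def 2 .
  qed
  have "(\<integral>\<^sup>+x. ennreal (exp (a * x + b * x\<^sup>2)) * ennreal (normal_density 0 (sqrt h) x) \<partial>lborel)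
     = (\<integral>\<^sup>+x. ennreal ((s / sqrt h) * exp (a\<^sup>2 * s\<^sup>2 / 2)) * ennreal (normal_density (a * s\<^sup>2) s x) \<partial>lborel)"
    using s h by (intro nn_integral_cong) (simp add: ennreal_mult[symmetric] eq)
  also have "\<dots> = ennreal ((s / sqrt h) * exp (a\<^sup>2 * s\<^sup>2 / 2)) * (\<integral>\<^sup>+x. ennreal (normal_density (a * s\<^sup>2) s x) \<partial>lborel)"
    by (rule nn_integral_cmult) simp
  also have "(\<integral>\<^sup>+x. ennreal (normal_density (a * s\<^sup>2) s x) \<partial>lborel) = 1"
    using s by (subst nn_integral_eq_integral) auto
  also have "ennreal ((s / sqrt h) * exp (a\<^sup>2 * s\<^sup>2 / 2)) * 1 \<le> ennreal (exp y * exp (a\<^sup>2 * h))"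
  proof -
    \<comment> \<open>For \<open>y\<close> between 0 and 1/2 this gives
      \<open>1 / (1 - y) \<le> exp (2 y)\<close>, so the normalising factor
      \<open>s / sqrt h\<close> is at most \<open>exp y\<close>; the same range gives
      \<open>s^2 / 2 \<le> h\<close>.\<close>
    have "(1 - y) * (1 + 2 * y) \<le> (1 - y) * exp (2 * y)"
      using y by (intro mult_left_mono exp_ge_add_one_self) auto
    moreover have "1 \<le> (1 - y) * (1 + 2 * y)"
    proof -
      have "y * (2 * y) \<le> y * 1" using y by (intro mult_left_mono) auto
      then show ?thesis by (simp add: algebra_simps)
    qed
    ultimately have "1 / (1 - y) \<le> exp (2 * y)" using y by (simp add: field_simps)
    also have "\<dots> = (exp y)\<^sup>2" by (simp add: exp_double)
    finally have "sqrt (1 / (1 - y)) \<le> exp y" by (intro real_le_lsqrt) auto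
    then have "s / sqrt h \<le> exp y" unfolding sq by (simp add: real_sqrt_divide)
    moreover have "s\<^sup>2 / 2 \<le> h" unfolding s(2) using h y by (simp add: field_simps)
    then have "a\<^sup>2 * s\<^sup>2 / 2 \<le> a\<^sup>2 * h" using mult_left_mono[of "s\<^sup>2 / 2" h "a\<^sup>2"] by simp
    ultimately have "(s / sqrt h) * exp (a\<^sup>2 * s\<^sup>2 / 2) \<le> exp y * exp (a\<^sup>2 * h)"
      using s h by (intro mult_mono) auto
    then show ?thesis by (simp add: ennreal_leI)
  qed
  also have "exp y * exp (a\<^sup>2 * h) = exp (2 * b * h + a\<^sup>2 * h)" by (simp add: y_def exp_add)
  finally show ?thesis by (simp add: mult_left_mono)
qed

section \<open>Independent Gaussian coordinates, integrated out one at a time\<close>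

text \<open>\<open>\<xi> (n, k)\<close> models the increment of the \<open>k\<close>-th Wiener
  process over the \<open>n\<close>-th time step; \<open>h\<close> is its variance and the step
  size.\<close>

locale gaussian_array = prob_space M for M :: "'w measure" +
  fixes \<xi> :: "nat \<times> nat \<Rightarrow> 'w \<Rightarrow> real" and h :: real
  assumes h_pos: "0 < h"
    and indep_\<xi>: "indep_vars (\<lambda>_. borel) \<xi> UNIV"
    and dist_\<xi>: "\<And>i. distributed M lborel (\<xi> i) (normal_density 0 (sqrt h))"
begin

lemma measurable_\<xi> [measurable]: "\<xi> i \<in> borel_measurable M"
  using indep_\<xi> unfolding indep_vars_def by blast

text \<open>The sigma-algebra generated by the variables with index in \<open>A\<close>. Pulling
  back the product sigma-algebra makes independence of disjoint blocks a statement about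
  restrictions of the family.\<close>

definition gen :: "(nat \<times> nat) set \<Rightarrow> 'w measure" where
  "gen A = vimage_algebra (space M) (\<lambda>\<omega>. restrict (\<lambda>i. \<xi> i \<omega>) A) (Pi\<^sub>M A (\<lambda>_. borel))"

lemma space_gen [simp]: "space (gen A) = space M"
  by (simp add: gen_def)

lemma restrict_\<xi>_space: "(\<lambda>\<omega>. restrict (\<lambda>i. \<xi> i \<omega>) A) \<in> space M \<rightarrow> space (Pi\<^sub>M A (\<lambda>_. borel))"
  by (auto simp: space_PiM)

lemma measurable_restrict_\<xi>:
  assumes "A \<subseteq> A'"
  shows "(\<lambda>\<omega>. restrict (\<lambda>i. \<xi> i \<omega>) A) \<in> measurable (gen A') (Pi\<^sub>M A (\<lambda>_. borel))"
proof -
  have "(\<lambda>\<omega>. restrict (restrict (\<lambda>i. \<xi> i \<omega>) A') A) \<in> measurable (gen A') (Pi\<^sub>M A (\<lambda>_. borel))"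
    using measurable_restrict_subset[OF assms, of "\<lambda>_. borel :: real measure"]
      measurable_vimage_algebra1[OF restrict_\<xi>_space[of A']] unfolding gen_def
    by (rule measurable_compose[rotated])
  then show ?thesis using assms by (simp add: Int_absorb1)
qed

lemma sets_gen_mono: "A \<subseteq> A' \<Longrightarrow> sets (gen A) \<subseteq> sets (gen A')"
  unfolding gen_def[of A] sets_vimage_algebra2[OF restrict_\<xi>_space]
  using measurable_sets[OF measurable_restrict_\<xi>[of A A']] by auto

lemma sets_gen_le: "sets (gen A) \<subseteq> sets M"
proof -
  have "(\<lambda>\<omega>. restrict (\<lambda>i. \<xi> i \<omega>) A) \<in> measurable M (Pi\<^sub>M A (\<lambda>_. borel))"
    by (rule measurable_restrict) simp
  then show ?thesis unfolding gen_def sets_vimage_algebra2[OF restrict_\<xi>_space]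
    by (auto dest: measurable_sets)
qed

lemma measurable_gen_mono: "f \<in> measurable (gen A) N \<Longrightarrow> A \<subseteq> A' \<Longrightarrow> f \<in> measurable (gen A') N"
  using sets_gen_mono[of A A'] by (auto simp: measurable_def)

lemma measurable_gen_imp: "f \<in> measurable (gen A) N \<Longrightarrow> f \<in> measurable M N"
  using sets_gen_le[of A] by (auto simp: measurable_def)

lemma measurable_gen_\<xi>: "i \<in> A \<Longrightarrow> \<xi> i \<in> borel_measurable (gen A)"
  using measurable_compose[OF measurable_restrict_\<xi>[OF order_refl, of A] measurable_component_singleton[of i A]]
  by simp

lemma indep_var_gen:
  assumes f: "f \<in> measurable (gen A) N" and g: "g \<in> measurable (gen A') N'" and "A \<inter> A' = {}"
  shows "indep_var N f N' g"
proof -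
  let ?R = "\<lambda>A \<omega>. restrict (\<lambda>i. \<xi> i \<omega>) A"
  have "indep_var (Pi\<^sub>M A (\<lambda>_. borel)) (?R A) (Pi\<^sub>M A' (\<lambda>_. borel)) (?R A')"
    using assms(3) by (intro indep_var_restrict[OF indep_\<xi>]) auto
  then have "indep_set (sets (gen A)) (sets (gen A'))"
    unfolding indep_var_eq gen_def sets_vimage_algebra by blast
  moreover have "sigma_sets (space M) {f -` B \<inter> space M | B. B \<in> sets N} \<subseteq> sets (gen A)"
    using measurable_sets[OF f] sets.sigma_sets_subset[of "{f -` B \<inter> space M | B. B \<in> sets N}" "gen A"]
    by auto
  moreover have "sigma_sets (space M) {g -` B \<inter> space M | B. B \<in> sets N'} \<subseteq> sets (gen A')"
    using measurable_sets[OF g] sets.sigma_sets_subset[of "{g -` B \<inter> space M | B. B \<in> sets N'}" "gen A'"]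
    by auto
  ultimately show ?thesis
    unfolding indep_var_eq indep_sets2_eq
    using measurable_gen_imp[OF f] measurable_gen_imp[OF g] by blast
qed

text \<open>By independence the joint law is a product, so \<open>f\<close> and \<open>c\<close> can
  be frozen while \<open>\<xi> i\<close> is integrated out with
  \<open>gaussian_exp_quadratic\<close>. The weight \<open>f\<close> carries the factors belonging
  to other coordinates.\<close>

lemma gaussian_exp_step:
  fixes f :: "'w \<Rightarrow> ennreal" and c :: "'w \<Rightarrow> complex"
  assumes f: "f \<in> borel_measurable (gen A)" and c: "c \<in> borel_measurable (gen A)" and i: "i \<notin> A"
    and l: "0 \<le> l" "2 * l * (cmod g)\<^sup>2 * h \<le> 1/2"
  shows "(\<integral>\<^sup>+\<omega>. f \<omega> * ennreal (exp (l * (cmod (c \<omega> + of_real (\<xi> i \<omega>) * g))\<^sup>2)) \<partial>M) \<le>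
    (\<integral>\<^sup>+\<omega>. f \<omega> * ennreal (exp (l * (cmod (c \<omega>))\<^sup>2 +
       (2 * l * (cmod g)\<^sup>2 * h + 4 * l\<^sup>2 * (cmod (c \<omega>))\<^sup>2 * (cmod g)\<^sup>2 * h))) \<partial>M)"
proof -
  let ?N = "borel \<Otimes>\<^sub>M borel :: (ennreal \<times> complex) measure"
  let ?P = "\<lambda>\<omega>. (f \<omega>, c \<omega>)"
  \<comment> \<open>The dummy first component gives both variables the same value type, as
    \<open>indep_var\<close> demands.\<close>
  let ?Y = "\<lambda>\<omega>. (0 :: ennreal, complex_of_real (\<xi> i \<omega>))"
  have P: "?P \<in> measurable (gen A) ?N" using f c by (rule measurable_Pair)
  have Y: "?Y \<in> measurable (gen {i}) ?N"
    using measurable_gen_\<xi>[of i "{i}"] by (intro measurable_Pair borel_measurable_of_real) auto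
  have ind: "indep_var ?N ?P ?N ?Y" by (rule indep_var_gen[OF P Y]) (use i in auto)
  have PM [measurable]: "?P \<in> measurable M ?N" using measurable_gen_imp[OF P] .
  have YM [measurable]: "?Y \<in> measurable M ?N" using measurable_gen_imp[OF Y] .
  define H where "H p q = fst p * ennreal (exp (l * (cmod (snd p + snd q * g))\<^sup>2))" for p q :: "ennreal \<times> complex"
  have H [measurable]: "(\<lambda>(p, q). H p q) \<in> borel_measurable (?N \<Otimes>\<^sub>M ?N)"
    unfolding H_def by measurable
  have Hp [measurable]: "H p \<in> borel_measurable ?N" for p
    unfolding H_def by measurable
  interpret X: prob_space "distr M ?N ?Y" by (rule prob_space_distr) simp
  have inner: "(\<integral>\<^sup>+q. H p q \<partial>distr M ?N ?Y) \<le> fst p * ennreal (exp (l * (cmod (snd p))\<^sup>2 +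
       (2 * l * (cmod g)\<^sup>2 * h + 4 * l\<^sup>2 * (cmod (snd p))\<^sup>2 * (cmod g)\<^sup>2 * h)))" for p
  proof -
    define z where "z = snd p"
    \<comment> \<open>Linear and quadratic coefficient in \<open>x\<close> of
      \<open>l * (cmod (z + x g))^2\<close>.\<close>
    define a where "a = 2 * l * Re (cnj z * g)"
    define b where "b = l * (cmod g)\<^sup>2"
    have e: "l * (cmod (z + of_real x * g))\<^sup>2 = l * (cmod z)\<^sup>2 + (a * x + b * x\<^sup>2)" for x
      unfolding cmod_power2 a_def b_def by (simp add: algebra_simps power2_eq_square)
    have "a\<^sup>2 \<le> 4 * l\<^sup>2 * (cmod z)\<^sup>2 * (cmod g)\<^sup>2"
    proof -
      have "\<bar>Re (cnj z * g)\<bar> \<le> cmod z * cmod g"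
        using abs_Re_le_cmod[of "cnj z * g"] by (simp add: norm_mult)
      then have "(Re (cnj z * g))\<^sup>2 \<le> (cmod z * cmod g)\<^sup>2"
        by (metis abs_le_square_iff abs_mult abs_norm_cancel)
      moreover have "a\<^sup>2 = 4 * l\<^sup>2 * r\<^sup>2" if "r = Re (cnj z * g)" for r
        unfolding a_def that[symmetric] by (simp add: power_mult_distrib)
      ultimately show ?thesis
        using mult_left_mono[of "(Re (cnj z * g))\<^sup>2" "(cmod z * cmod g)\<^sup>2" "4 * l\<^sup>2"]
        by (simp only: power_mult_distrib[of "cmod z"] mult.assoc) simp
    qed
    then have a: "a\<^sup>2 * h \<le> 4 * l\<^sup>2 * (cmod z)\<^sup>2 * (cmod g)\<^sup>2 * h" using h_pos by (intro mult_right_mono) auto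
    have "(\<integral>\<^sup>+q. H p q \<partial>distr M ?N ?Y) =
        fst p * (ennreal (exp (l * (cmod z)\<^sup>2)) * (\<integral>\<^sup>+\<omega>. ennreal (exp (a * \<xi> i \<omega> + b * (\<xi> i \<omega>)\<^sup>2)) \<partial>M))"
      by (subst nn_integral_distr) (auto simp: H_def z_def[symmetric] e exp_add ennreal_mult nn_integral_cmult)
    also have "(\<integral>\<^sup>+\<omega>. ennreal (exp (a * \<xi> i \<omega> + b * (\<xi> i \<omega>)\<^sup>2)) \<partial>M) =
        (\<integral>\<^sup>+x. ennreal (normal_density 0 (sqrt h) x) * ennreal (exp (a * x + b * x\<^sup>2)) \<partial>lborel)"
      by (rule distributed_nn_integral[OF dist_\<xi>, symmetric]) measurable
    also have "fst p * (ennreal (exp (l * (cmod z)\<^sup>2)) * \<dots>) \<le> fst p * (ennreal (exp (l * (cmod z)\<^sup>2)) * ennreal (exp (2 * b * h + a\<^sup>2 * h)))"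
      using gaussian_exp_quadratic[OF h_pos, of b a] l by (intro mult_left_mono) (auto simp: b_def mult_ac)
    also have "\<dots> = fst p * ennreal (exp (l * (cmod z)\<^sup>2 + (2 * b * h + a\<^sup>2 * h)))"
      by (simp add: exp_add ennreal_mult)
    also have "\<dots> \<le> fst p * ennreal (exp (l * (cmod z)\<^sup>2 + (2 * l * (cmod g)\<^sup>2 * h + 4 * l\<^sup>2 * (cmod z)\<^sup>2 * (cmod g)\<^sup>2 * h)))"
      using a by (intro mult_left_mono ennreal_leI) (auto simp: b_def)
    finally show ?thesis unfolding z_def .
  qed
  have "(\<integral>\<^sup>+\<omega>. f \<omega> * ennreal (exp (l * (cmod (c \<omega> + of_real (\<xi> i \<omega>) * g))\<^sup>2)) \<partial>M) =
      (\<integral>\<^sup>+r. (\<lambda>(p, q). H p q) r \<partial>distr M (?N \<Otimes>\<^sub>M ?N) (\<lambda>\<omega>. (?P \<omega>, ?Y \<omega>)))"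
    by (subst nn_integral_distr) (auto simp: H_def)
  also have "\<dots> = (\<integral>\<^sup>+r. (\<lambda>(p, q). H p q) r \<partial>(distr M ?N ?P \<Otimes>\<^sub>M distr M ?N ?Y))"
    using ind unfolding indep_var_distribution_eq by simp
  also have "\<dots> = (\<integral>\<^sup>+p. \<integral>\<^sup>+q. H p q \<partial>distr M ?N ?Y \<partial>distr M ?N ?P)"
    by (subst X.nn_integral_fst[symmetric]) auto
  also have "\<dots> \<le> (\<integral>\<^sup>+p. fst p * ennreal (exp (l * (cmod (snd p))\<^sup>2 +
       (2 * l * (cmod g)\<^sup>2 * h + 4 * l\<^sup>2 * (cmod (snd p))\<^sup>2 * (cmod g)\<^sup>2 * h))) \<partial>distr M ?N ?P)"
    by (intro nn_integral_mono inner)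
  also have "\<dots> = (\<integral>\<^sup>+\<omega>. f \<omega> * ennreal (exp (l * (cmod (c \<omega>))\<^sup>2 +
       (2 * l * (cmod g)\<^sup>2 * h + 4 * l\<^sup>2 * (cmod (c \<omega>))\<^sup>2 * (cmod g)\<^sup>2 * h))) \<partial>M)"
    by (subst nn_integral_distr) auto
  finally show ?thesis .
qed

end

lemma (in prob_space) normal_second_moment:
  assumes "0 < \<sigma>" "distributed M lborel X (normal_density 0 \<sigma>)"
  shows "integrable M (\<lambda>\<omega>. (X \<omega>)\<^sup>2)" "expectation (\<lambda>\<omega>. (X \<omega>)\<^sup>2) = \<sigma>\<^sup>2"
proof -
  have "integrable lborel (\<lambda>x. normal_density 0 \<sigma> x * (x - 0)^2)"
    by (rule integrable_normal_moment[OF assms(1)])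
  then show "integrable M (\<lambda>\<omega>. (X \<omega>)\<^sup>2)"
    using distributed_integrable[OF assms(2), of "\<lambda>x. x\<^sup>2"] by simp
  show "expectation (\<lambda>\<omega>. (X \<omega>)\<^sup>2) = \<sigma>\<^sup>2"
    using normal_distributed_variance[OF assms] normal_distributed_expectation[OF assms] by simp
qed

text \<open>The expectation of the series is \<open>v\<close> times the sum of the
  \<open>(cmod (c k))^2\<close>, hence finite. This serves both the increments and the Wiener
  process at a fixed time.\<close>

lemma (in prob_space) AE_suminf_weighted_squares:
  fixes X :: "nat \<Rightarrow> 'a \<Rightarrow> real" and c :: "nat \<Rightarrow> complex"
  assumes X [measurable]: "\<And>k. X k \<in> borel_measurable M"
    and v: "0 \<le> v" "\<And>k. (\<integral>\<^sup>+\<omega>. ennreal ((X k \<omega>)\<^sup>2) \<partial>M) = ennreal v"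
    and c: "summable (\<lambda>k. (cmod (c k))\<^sup>2)"
  shows "AE \<omega> in M. (\<Sum>k. ennreal ((cmod (of_real (X k \<omega>) * c k))\<^sup>2)) < \<infinity>"
proof -
  have "(\<integral>\<^sup>+\<omega>. (\<Sum>k. ennreal ((cmod (of_real (X k \<omega>) * c k))\<^sup>2)) \<partial>M) =
    (\<Sum>k. \<integral>\<^sup>+\<omega>. ennreal ((cmod (c k))\<^sup>2) * ennreal ((X k \<omega>)\<^sup>2) \<partial>M)"
    by (subst nn_integral_suminf[symmetric], measurable)
       (simp add: norm_mult power_mult_distrib ennreal_mult[symmetric] mult.commute)
  also have "\<dots> = (\<Sum>k. ennreal ((cmod (c k))\<^sup>2 * v))"
    using v by (intro suminf_cong) (simp add: nn_integral_cmult ennreal_mult)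
  also have "\<dots> = ennreal (\<Sum>k. (cmod (c k))\<^sup>2 * v)"
    using c v by (intro suminf_ennreal2 summable_mult2) auto
  finally have "(\<integral>\<^sup>+\<omega>. (\<Sum>k. ennreal ((cmod (of_real (X k \<omega>) * c k))\<^sup>2)) \<partial>M) \<noteq> \<infinity>" by simp
  then have "AE \<omega> in M. (\<Sum>k. ennreal ((cmod (of_real (X k \<omega>) * c k))\<^sup>2)) \<noteq> \<infinity>"
    by (intro nn_integral_PInf_AE) measurable
  then show ?thesis by (simp add: less_top)
qed

text \<open>The last coordinate is integrated first, with the remaining factors as weight; its
  replacement is \<open>gen A\<close>-measurable and joins \<open>f\<close>, which is why the
  induction leaves \<open>f\<close> arbitrary.\<close>

lemma (in gaussian_array) exp_prod_step:
  fixes f :: "'w \<Rightarrow> ennreal" and c :: "nat \<Rightarrow> 'w \<Rightarrow> complex"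
  assumes "f \<in> borel_measurable (gen A)" and c: "\<And>k. c k \<in> borel_measurable (gen A)"
    and A: "\<And>k. (n, k) \<notin> A"
    and l: "0 \<le> l" "\<And>k. 2 * l * (cmod (g k))\<^sup>2 * h \<le> 1/2"
  shows "(\<integral>\<^sup>+\<omega>. f \<omega> * (\<Prod>k<K. ennreal (exp (l * (cmod (c k \<omega> + of_real (\<xi> (n, k) \<omega>) * g k))\<^sup>2))) \<partial>M) \<le>
    (\<integral>\<^sup>+\<omega>. f \<omega> * (\<Prod>k<K. ennreal (exp (l * (cmod (c k \<omega>))\<^sup>2 +
       (2 * l * (cmod (g k))\<^sup>2 * h + 4 * l\<^sup>2 * (cmod (c k \<omega>))\<^sup>2 * (cmod (g k))\<^sup>2 * h)))) \<partial>M)"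
  using assms(1)
proof (induct K arbitrary: f)
  case (Suc K)
  let ?p = "\<lambda>k \<omega>. ennreal (exp (l * (cmod (c k \<omega> + of_real (\<xi> (n, k) \<omega>) * g k))\<^sup>2))"
  let ?q = "\<lambda>k \<omega>. ennreal (exp (l * (cmod (c k \<omega>))\<^sup>2 +
       (2 * l * (cmod (g k))\<^sup>2 * h + 4 * l\<^sup>2 * (cmod (c k \<omega>))\<^sup>2 * (cmod (g k))\<^sup>2 * h)))"
  \<comment> \<open>Contains the indices of the factors still carrying noise but not
    \<open>(n, K)\<close>, so \<open>\<xi> (n, K)\<close> is independent of the whole
    weight.\<close>
  let ?A = "A \<union> {n} \<times> {..<K}"
  note [measurable] = measurable_gen_mono[OF Suc(2), of ?A, simplified] measurable_gen_mono[OF c, of ?A, simplified]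
  have [measurable]: "k < K \<Longrightarrow> \<xi> (n, k) \<in> borel_measurable (gen ?A)" for k
    by (rule measurable_gen_\<xi>) auto
  have fp: "(\<lambda>\<omega>. f \<omega> * (\<Prod>k<K. ?p k \<omega>)) \<in> borel_measurable (gen ?A)" by measurable
  note [measurable] = Suc(2) c
  have fq: "(\<lambda>\<omega>. f \<omega> * ?q K \<omega>) \<in> borel_measurable (gen A)" by measurable
  have "(\<integral>\<^sup>+\<omega>. f \<omega> * (\<Prod>k<Suc K. ?p k \<omega>) \<partial>M) = (\<integral>\<^sup>+\<omega>. (f \<omega> * (\<Prod>k<K. ?p k \<omega>)) * ?p K \<omega> \<partial>M)"
    by (simp add: mult_ac)
  also have "\<dots> \<le> (\<integral>\<^sup>+\<omega>. (f \<omega> * (\<Prod>k<K. ?p k \<omega>)) * ?q K \<omega> \<partial>M)"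
    by (rule gaussian_exp_step[OF fp measurable_gen_mono[OF c] _ l(1) l(2)]) (use A in auto)
  also have "\<dots> = (\<integral>\<^sup>+\<omega>. (f \<omega> * ?q K \<omega>) * (\<Prod>k<K. ?p k \<omega>) \<partial>M)" by (simp add: mult_ac)
  also have "\<dots> \<le> (\<integral>\<^sup>+\<omega>. (f \<omega> * ?q K \<omega>) * (\<Prod>k<K. ?q k \<omega>) \<partial>M)" by (rule Suc(1)[OF fq])
  also have "\<dots> = (\<integral>\<^sup>+\<omega>. f \<omega> * (\<Prod>k<Suc K. ?q k \<omega>) \<partial>M)" by (simp add: mult_ac)
  finally show ?case .
qed simp

section \<open>Exponential moments of abstract one-step schemes\<close>

locale gaussian_noise = gaussian_array M \<xi> h for M :: "'w measure" and \<xi> h +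
  fixes e :: "nat \<Rightarrow> 'd::finite L2" and g :: "nat \<Rightarrow> complex"
  assumes e: "complete_orthonormal e" and g: "summable (\<lambda>k. (cmod (g k))\<^sup>2)"
begin

text \<open>For the coefficients \<open>- \<i> \<alpha> \<gamma> k\<close> used later this is
  \<open>\<alpha>^2 Tr(Q)\<close>.\<close>

definition G :: real where "G = (\<Sum>k. (cmod (g k))\<^sup>2)"

lemma G_nonneg: "0 \<le> G" unfolding G_def by (rule suminf_nonneg[OF g]) simp

lemma g_le_G: "(cmod (g k))\<^sup>2 \<le> G"
  unfolding G_def using sum_le_suminf[OF g, of "{k}"] by simp

text \<open>The guard provides an everywhere defined, \<open>gen\<close>-measurable version of the
  noise increment: off the null set of divergence the value is 0 instead of an unspecified
  \<open>suminf\<close>.\<close>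

definition dW :: "nat \<Rightarrow> 'w \<Rightarrow> 'd L2" where
  "dW n \<omega> = (if (\<Sum>k. ennreal ((cmod (of_real (\<xi> (n, k) \<omega>) * g k))\<^sup>2)) < \<infinity>
     then \<Sum>k. (of_real (\<xi> (n, k) \<omega>) * g k) *\<^sub>C e k else 0)"

lemma cinner_dW: "cinner (e k) (dW n \<omega>) =
  (if (\<Sum>k. ennreal ((cmod (of_real (\<xi> (n, k) \<omega>) * g k))\<^sup>2)) < \<infinity> then of_real (\<xi> (n, k) \<omega>) * g k else 0)"
proof (cases "(\<Sum>k. ennreal ((cmod (of_real (\<xi> (n, k) \<omega>) * g k))\<^sup>2)) < \<infinity>")
  case True
  then have "summable (\<lambda>k. (cmod (of_real (\<xi> (n, k) \<omega>) * g k))\<^sup>2)"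
    by (intro summable_suminf_not_top) auto
  from orthonormal_sums(2)[OF complete_orthonormal_imp_orthonormal[OF e] this] True
  show ?thesis by (simp add: dW_def)
qed (simp add: dW_def)

lemma measurable_dW: "dW n \<in> borel_measurable (gen ({n} \<times> UNIV))"
proof -
  have [measurable]: "\<xi> (n, k) \<in> borel_measurable (gen ({n} \<times> UNIV))" for k
    by (rule measurable_gen_\<xi>) auto
  show ?thesis
    by (rule iffD2[OF borel_measurable_L2_iff[OF e]]) (unfold cinner_dW, measurable)
qed

lemma AE_dW: "AE \<omega> in M. (\<Sum>k. ennreal ((cmod (of_real (\<xi> (n, k) \<omega>) * g k))\<^sup>2)) < \<infinity>"
proof (rule AE_suminf_weighted_squares[OF _ _ _ g])
  show "(\<integral>\<^sup>+\<omega>. ennreal ((\<xi> (n, k) \<omega>)\<^sup>2) \<partial>M) = ennreal h" for k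
    using normal_second_moment[OF _ dist_\<xi>[of "(n, k)"]] h_pos by (subst nn_integral_eq_integral) auto
qed (use h_pos in auto)

text \<open>By Parseval the exponential of the squared norm is an infinite product over coordinates;
  \<open>exp_prod_step\<close> treats the finite products and Fatou's lemma the limit. The mixed
  terms are summed using the crude bound \<open>(cmod (g k))^2 \<le> G\<close>.\<close>

lemma exp_norm_step:
  assumes B: "B \<in> borel_measurable (gen A)" and A: "\<And>k. (n, k) \<notin> A"
    and l: "0 \<le> l" "2 * l * G * h \<le> 1/2"
  shows "(\<integral>\<^sup>+\<omega>. ennreal (exp (l * (norm (B \<omega> + dW n \<omega>))\<^sup>2)) \<partial>M) \<le>
    (\<integral>\<^sup>+\<omega>. ennreal (exp (l * (1 + 4 * l * G * h) * (norm (B \<omega>))\<^sup>2 + 2 * l * G * h)) \<partial>M)"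
proof -
  define c where "c k \<omega> = cinner (e k) (B \<omega>)" for k \<omega>
  have cm: "c k \<in> borel_measurable (gen A)" for k unfolding c_def by (rule measurable_cinner[OF B])
  note [measurable] = measurable_gen_imp[OF cm]
  have lk: "2 * l * (cmod (g k))\<^sup>2 * h \<le> 1/2" for k
  proof -
    have "2 * l * (cmod (g k))\<^sup>2 * h \<le> 2 * l * G * h"
      using l h_pos g_le_G by (intro mult_right_mono mult_left_mono) auto
    then show ?thesis using l by linarith
  qed
  let ?p = "\<lambda>k \<omega>. exp (l * (cmod (c k \<omega> + of_real (\<xi> (n, k) \<omega>) * g k))\<^sup>2)"
  have "AE \<omega> in M. ennreal (exp (l * (norm (B \<omega> + dW n \<omega>))\<^sup>2)) = liminf (\<lambda>K. \<Prod>k<K. ennreal (?p k \<omega>))"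
    using AE_dW[of n]
  proof eventually_elim
    case (elim \<omega>)
    have "(\<lambda>k. (cmod (c k \<omega> + of_real (\<xi> (n, k) \<omega>) * g k))\<^sup>2) sums (norm (B \<omega> + dW n \<omega>))\<^sup>2"
      using Parseval[OF e, of "B \<omega> + dW n \<omega>"] elim by (simp add: cinner_add_right cinner_dW c_def)
    then have "(\<lambda>K. ennreal (exp (l * (\<Sum>k<K. (cmod (c k \<omega> + of_real (\<xi> (n, k) \<omega>) * g k))\<^sup>2))))
        \<longlonglongrightarrow> ennreal (exp (l * (norm (B \<omega> + dW n \<omega>))\<^sup>2))"
      unfolding sums_def by (intro tendsto_ennrealI tendsto_intros)
    moreover have "(\<Prod>k<K. ennreal (?p k \<omega>)) = ennreal (exp (l * (\<Sum>k<K. (cmod (c k \<omega> + of_real (\<xi> (n, k) \<omega>) * g k))\<^sup>2)))" for K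
      by (simp add: prod_ennreal sum_distrib_left exp_sum)
    ultimately have "(\<lambda>K. \<Prod>k<K. ennreal (?p k \<omega>)) \<longlonglongrightarrow> ennreal (exp (l * (norm (B \<omega> + dW n \<omega>))\<^sup>2))"
      by (simp only:)
    then show ?case by (intro lim_imp_Liminf[symmetric] sequentially_bot)
  qed
  then have "(\<integral>\<^sup>+\<omega>. ennreal (exp (l * (norm (B \<omega> + dW n \<omega>))\<^sup>2)) \<partial>M) =
      (\<integral>\<^sup>+\<omega>. liminf (\<lambda>K. \<Prod>k<K. ennreal (?p k \<omega>)) \<partial>M)"
    by (rule nn_integral_cong_AE)
  also have "\<dots> \<le> liminf (\<lambda>K. \<integral>\<^sup>+\<omega>. (\<Prod>k<K. ennreal (?p k \<omega>)) \<partial>M)"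
    by (rule nn_integral_liminf) measurable
  also have "\<dots> \<le> liminf (\<lambda>K. \<integral>\<^sup>+\<omega>. ennreal (exp (l * (1 + 4 * l * G * h) * (norm (B \<omega>))\<^sup>2 + 2 * l * G * h)) \<partial>M)"
  proof (intro Liminf_mono always_eventually allI)
    fix K
    let ?q = "\<lambda>k \<omega>. exp (l * (cmod (c k \<omega>))\<^sup>2 +
       (2 * l * (cmod (g k))\<^sup>2 * h + 4 * l\<^sup>2 * (cmod (c k \<omega>))\<^sup>2 * (cmod (g k))\<^sup>2 * h))"
    have "(\<integral>\<^sup>+\<omega>. (\<Prod>k<K. ennreal (?p k \<omega>)) \<partial>M) \<le> (\<integral>\<^sup>+\<omega>. (\<Prod>k<K. ennreal (?q k \<omega>)) \<partial>M)"
      using exp_prod_step[where f = "\<lambda>_. 1" and K = K, OF _ cm A l(1) lk] by simp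
    also have "\<dots> \<le> (\<integral>\<^sup>+\<omega>. ennreal (exp (l * (1 + 4 * l * G * h) * (norm (B \<omega>))\<^sup>2 + 2 * l * G * h)) \<partial>M)"
    proof (rule nn_integral_mono)
      fix \<omega>
      have 1: "(\<Sum>k<K. (cmod (c k \<omega>))\<^sup>2) \<le> (norm (B \<omega>))\<^sup>2"
        unfolding c_def by (rule Bessel[OF complete_orthonormal_imp_orthonormal[OF e]]) simp
      have 2: "(\<Sum>k<K. (cmod (g k))\<^sup>2) \<le> G" unfolding G_def by (rule sum_le_suminf[OF g]) auto
      have 3: "(\<Sum>k<K. (cmod (c k \<omega>))\<^sup>2 * (cmod (g k))\<^sup>2) \<le> (norm (B \<omega>))\<^sup>2 * G"
      proof -
        have "(\<Sum>k<K. (cmod (c k \<omega>))\<^sup>2 * (cmod (g k))\<^sup>2) \<le> (\<Sum>k<K. (cmod (c k \<omega>))\<^sup>2 * G)"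
          by (intro sum_mono mult_left_mono g_le_G) simp
        also have "\<dots> \<le> (norm (B \<omega>))\<^sup>2 * G"
          unfolding sum_distrib_right[symmetric] using 1 G_nonneg by (rule mult_right_mono)
        finally show ?thesis .
      qed
      have "(\<Sum>k<K. l * (cmod (c k \<omega>))\<^sup>2 + (2 * l * (cmod (g k))\<^sup>2 * h + 4 * l\<^sup>2 * (cmod (c k \<omega>))\<^sup>2 * (cmod (g k))\<^sup>2 * h))
        = l * (\<Sum>k<K. (cmod (c k \<omega>))\<^sup>2) + 2 * l * h * (\<Sum>k<K. (cmod (g k))\<^sup>2) +
          4 * l\<^sup>2 * h * (\<Sum>k<K. (cmod (c k \<omega>))\<^sup>2 * (cmod (g k))\<^sup>2)"
        by (simp add: sum.distrib sum_distrib_left mult_ac)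
      also have "\<dots> \<le> l * (norm (B \<omega>))\<^sup>2 + 2 * l * h * G + 4 * l\<^sup>2 * h * ((norm (B \<omega>))\<^sup>2 * G)"
        using 1 2 3 l h_pos by (intro add_mono mult_left_mono) auto
      also have "\<dots> = l * (1 + 4 * l * G * h) * (norm (B \<omega>))\<^sup>2 + 2 * l * G * h"
        by (simp add: algebra_simps power2_eq_square)
      finally show "(\<Prod>k<K. ennreal (?q k \<omega>)) \<le> ennreal (exp (l * (1 + 4 * l * G * h) * (norm (B \<omega>))\<^sup>2 + 2 * l * G * h))"
        unfolding prod_ennreal[OF exp_ge_zero] exp_sum[OF finite_lessThan, symmetric]
        by (intro ennreal_leI) simp
    qed
    finally show "(\<integral>\<^sup>+\<omega>. (\<Prod>k<K. ennreal (?p k \<omega>)) \<partial>M) \<le> \<dots>" .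
  qed
  finally show ?thesis by (simp add: Liminf_const)
qed

primrec scheme :: "('d L2 \<Rightarrow> 'd L2) \<Rightarrow> 'd L2 \<Rightarrow> nat \<Rightarrow> 'w \<Rightarrow> 'd L2" where
  "scheme B v 0 \<omega> = v"
| "scheme B v (Suc n) \<omega> = free_group h (B (scheme B v n \<omega>) + dW n \<omega>)"

text \<open>Iterate \<open>n\<close> depends only on increments with index below \<open>n\<close>,
  which makes it independent of \<open>dW n\<close> in the next step.\<close>

lemma measurable_scheme:
  assumes "continuous_on UNIV B"
  shows "scheme B v n \<in> borel_measurable (gen ({..<n} \<times> UNIV))"
proof (induct n)
  case (Suc n)
  have "(\<lambda>\<omega>. B (scheme B v n \<omega>)) \<in> borel_measurable (gen ({..<Suc n} \<times> UNIV))"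
    by (rule measurable_compose[OF measurable_gen_mono[OF Suc] borel_measurable_continuous_onI[OF assms]]) auto
  moreover have "dW n \<in> borel_measurable (gen ({..<Suc n} \<times> UNIV))"
    by (rule measurable_gen_mono[OF measurable_dW]) auto
  ultimately have "(\<lambda>\<omega>. free_group h (B (scheme B v n \<omega>) + dW n \<omega>)) \<in> borel_measurable (gen ({..<Suc n} \<times> UNIV))"
    by (intro borel_measurable_bounded_linear[OF bounded_linear_free_group] borel_measurable_L2_add[OF e])
  moreover have "scheme B v (Suc n) = (\<lambda>\<omega>. free_group h (B (scheme B v n \<omega>) + dW n \<omega>))" by auto
  ultimately show ?case by (simp only:)
qed simp

text \<open>The exponent is enlarged backwards in time, from \<open>l\<close> to at most \<open>L\<close>, to absorb the
  variance of the stochastic increments.\<close>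

lemma scheme_exp_moment:
  assumes B: "continuous_on UNIV B" "\<And>w. (norm (B w))\<^sup>2 \<le> (norm w)\<^sup>2 + \<delta>"
    and L: "0 \<le> L" "2 * L * G * h \<le> 1/2" and "0 \<le> l" "l * exp (4 * G * L * h * real n) \<le> L"
  shows "(\<integral>\<^sup>+\<omega>. ennreal (exp (l * (norm (scheme B v n \<omega>))\<^sup>2)) \<partial>M) \<le>
    ennreal (exp (L * ((norm v)\<^sup>2 + real n * \<delta> + 2 * G * h * real n)))"
  using assms(5,6)
proof (induct n arbitrary: l)
  case 0
  then show ?case by (auto intro!: ennreal_leI mult_right_mono simp: emeasure_space_1)
next
  case (Suc n)
  have \<delta>: "0 \<le> \<delta>" using B(2)[of 0] by (simp add: order_trans[OF zero_le_power2])
  \<comment> \<open>Logarithmic growth of the exponent per step: as long as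
    \<open>l \<le> L\<close>, the factor \<open>1 + 4 l G h\<close> is at most \<open>exp x\<close>.
    The induction hypothesis is used with the exponent \<open>l * exp x\<close>, whose remaining
    growth over \<open>n\<close> steps still ends below \<open>L\<close>.\<close>
  define x where "x = 4 * G * L * h"
  have x: "0 \<le> x" using G_nonneg L(1) h_pos by (simp add: x_def)
  have lx: "l * exp x * exp (x * real n) \<le> L"
  proof -
    have "4 * G * L * h * real (Suc n) = x + x * real n" by (simp add: x_def algebra_simps)
    then show ?thesis using Suc(3) by (simp add: exp_add mult.assoc)
  qed
  have "l * exp x * 1 \<le> l * exp x * exp (x * real n)" using Suc(2) x by (intro mult_left_mono) auto
  with lx have l'L: "l * exp x \<le> L" by simp
  have "l * 1 \<le> l * exp x" using Suc(2) x by (intro mult_left_mono) auto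
  with l'L have lL: "l \<le> L" by simp
  have lG: "2 * l * G * h \<le> 2 * L * G * h"
    using lL G_nonneg h_pos by (intro mult_right_mono mult_left_mono) auto
  have "1 + 4 * l * G * h \<le> 1 + x"
    using lG by (simp add: x_def mult_ac)
  also have "\<dots> \<le> exp x" by (rule exp_ge_add_one_self)
  finally have fac: "l * (1 + 4 * l * G * h) \<le> l * exp x" using Suc(2) by (intro mult_left_mono) auto
  have "(\<integral>\<^sup>+\<omega>. ennreal (exp (l * (norm (scheme B v (Suc n) \<omega>))\<^sup>2)) \<partial>M) \<le>
      (\<integral>\<^sup>+\<omega>. ennreal (exp (l * (norm (B (scheme B v n \<omega>) + dW n \<omega>))\<^sup>2)) \<partial>M)"
    using Suc(2) by (intro nn_integral_mono ennreal_leI) (auto intro!: mult_left_mono power_mono norm_free_group_le)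
  also have "\<dots> \<le> (\<integral>\<^sup>+\<omega>. ennreal (exp (l * (1 + 4 * l * G * h) * (norm (B (scheme B v n \<omega>)))\<^sup>2 + 2 * l * G * h)) \<partial>M)"
    using lG L(2) Suc(2)
    by (intro exp_norm_step[where A = "{..<n} \<times> UNIV"] measurable_compose[OF measurable_scheme[OF B(1)] borel_measurable_continuous_onI[OF B(1)]])
       auto
  also have "\<dots> \<le> (\<integral>\<^sup>+\<omega>. ennreal (exp (L * \<delta> + 2 * L * G * h)) * ennreal (exp ((l * exp x) * (norm (scheme B v n \<omega>))\<^sup>2)) \<partial>M)"
  proof (intro nn_integral_mono)
    fix \<omega>
    have "l * (1 + 4 * l * G * h) * (norm (B (scheme B v n \<omega>)))\<^sup>2 \<le> l * exp x * ((norm (scheme B v n \<omega>))\<^sup>2 + \<delta>)"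
      by (rule mult_mono[OF fac B(2)]) (use Suc(2) in auto)
    also have "\<dots> \<le> l * exp x * (norm (scheme B v n \<omega>))\<^sup>2 + L * \<delta>"
      using l'L \<delta> mult_right_mono[of "l * exp x" L \<delta>] by (simp add: distrib_left)
    finally show "ennreal (exp (l * (1 + 4 * l * G * h) * (norm (B (scheme B v n \<omega>)))\<^sup>2 + 2 * l * G * h)) \<le>
        ennreal (exp (L * \<delta> + 2 * L * G * h)) * ennreal (exp ((l * exp x) * (norm (scheme B v n \<omega>))\<^sup>2))"
      using lG by (simp add: ennreal_mult[symmetric] exp_add[symmetric] ennreal_leI)
  qed
  also have "\<dots> = ennreal (exp (L * \<delta> + 2 * L * G * h)) * (\<integral>\<^sup>+\<omega>. ennreal (exp ((l * exp x) * (norm (scheme B v n \<omega>))\<^sup>2)) \<partial>M)"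
  proof (rule nn_integral_cmult)
    have [measurable]: "scheme B v n \<in> borel_measurable M"
      by (rule measurable_gen_imp[OF measurable_scheme[OF B(1)]])
    show "(\<lambda>\<omega>. ennreal (exp ((l * exp x) * (norm (scheme B v n \<omega>))\<^sup>2))) \<in> borel_measurable M" by measurable
  qed
  also have "\<dots> \<le> ennreal (exp (L * \<delta> + 2 * L * G * h)) * ennreal (exp (L * ((norm v)\<^sup>2 + real n * \<delta> + 2 * G * h * real n)))"
    using Suc(2) lx by (intro mult_left_mono Suc(1)) (auto simp: x_def)
  also have "\<dots> = ennreal (exp (L * ((norm v)\<^sup>2 + real (Suc n) * \<delta> + 2 * G * h * real (Suc n))))"
    by (simp add: ennreal_mult[symmetric] exp_add[symmetric] algebra_simps)
  finally show ?case .
qed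

end

section \<open>Wiener increments\<close>

locale wiener_family = prob_space M for M :: "'w measure" +
  fixes Fs :: "real \<Rightarrow> 'w measure" and \<beta> :: "nat \<Rightarrow> real \<Rightarrow> 'w \<Rightarrow> real"
  assumes basis: "stochastic_basis M Fs" and wiener: "indep_wiener_processes M Fs \<beta>"
begin

lemma wiener_k: "wiener_process M Fs (\<beta> k)"
  using wiener by (simp add: indep_wiener_processes_def)

lemma subalgebra_Fs: "0 \<le> t \<Longrightarrow> subalgebra M (Fs t)"
  using basis by (simp add: stochastic_basis_def)

lemma measurable_Fs: "0 \<le> s \<Longrightarrow> s \<le> t \<Longrightarrow> \<beta> k s \<in> borel_measurable (Fs t)"
  using basis wiener_k[of k] unfolding stochastic_basis_def wiener_process_def
  by (meson measurable_from_subalg)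

lemma measurable_\<beta>: "0 \<le> t \<Longrightarrow> \<beta> k t \<in> borel_measurable M"
  using measurable_from_subalg[OF subalgebra_Fs measurable_Fs[OF _ order_refl]] by blast

lemma AE_\<beta>_0: "AE \<omega> in M. \<beta> k 0 \<omega> = 0"
  using wiener_k[of k] by (simp add: wiener_process_def)

lemma distributed_increment:
  "0 \<le> s \<Longrightarrow> s < t \<Longrightarrow> distributed M lborel (\<lambda>\<omega>. \<beta> k t \<omega> - \<beta> k s \<omega>) (normal_density 0 (sqrt (t - s)))"
  using wiener_k[of k] by (simp add: wiener_process_def)

lemma indep_increment:
  "0 \<le> s \<Longrightarrow> s < t \<Longrightarrow> indep_set (sets (Fs s)) {(\<lambda>\<omega>. \<beta> k t \<omega> - \<beta> k s \<omega>) -` B \<inter> space M | B. B \<in> sets borel}"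
  using wiener_k[of k] by (simp add: wiener_process_def)

lemma indep_paths: "indep_vars (\<lambda>_. \<Pi>\<^sub>M t\<in>{0..}. borel) (\<lambda>k \<omega>. \<lambda>t\<in>{0..}. \<beta> k t \<omega>) UNIV"
  using wiener by (simp add: indep_wiener_processes_def)

definition incr :: "real \<Rightarrow> nat \<times> nat \<Rightarrow> 'w \<Rightarrow> real" where
  "incr h i \<omega> = \<beta> (snd i) (real (Suc (fst i)) * h) \<omega> - \<beta> (snd i) (real (fst i) * h) \<omega>"

lemma measurable_incr: "0 < h \<Longrightarrow> incr h i \<in> borel_measurable M"
  unfolding incr_def by (intro borel_measurable_diff measurable_\<beta>) auto

text \<open>The increments before step \<open>N\<close> are measurable for the filtration at time
  \<open>N h\<close>, of which the next increment is independent; the product is built up step by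
  step.\<close>

lemma prob_incr_one:
  assumes h: "0 < h" and B: "\<And>n. B n \<in> sets borel"
  shows "prob (space M \<inter> (\<Inter>n<N. incr h (n, k) -` B n)) = (\<Prod>n<N. prob (incr h (n, k) -` B n \<inter> space M))"
proof (induct N)
  case (Suc N)
  have Nh: "0 \<le> real N * h" "real N * h < real (Suc N) * h" using h by auto
  have sp: "space (Fs (real N * h)) = space M" using subalgebra_Fs[OF Nh(1)] by (simp add: subalgebra_def)
  have past: "incr h (n, k) \<in> borel_measurable (Fs (real N * h))" if "n < N" for n
  proof -
    have "real (Suc n) * h \<le> real N * h" using that h by (intro mult_right_mono) auto
    moreover have "real n * h \<le> real N * h" using that h by (intro mult_right_mono) auto
    ultimately show ?thesis unfolding incr_def fst_conv snd_conv
      using h by (intro borel_measurable_diff measurable_Fs) auto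
  qed
  have "space (Fs (real N * h)) \<inter> (\<Inter>n<N. incr h (n, k) -` B n) \<in> sets (Fs (real N * h))"
  proof (cases "N = 0")
    case False
    then have "space (Fs (real N * h)) \<inter> (\<Inter>n<N. incr h (n, k) -` B n) =
      (\<Inter>n<N. incr h (n, k) -` B n \<inter> space (Fs (real N * h)))" by auto
    moreover have "\<dots> \<in> sets (Fs (real N * h))"
      by (rule sets.finite_INT) (use False measurable_sets[OF past B] in auto)
    ultimately show ?thesis by (simp only:)
  qed simp
  then have E: "space M \<inter> (\<Inter>n<N. incr h (n, k) -` B n) \<in> sets (Fs (real N * h))" unfolding sp .
  have "prob ((space M \<inter> (\<Inter>n<N. incr h (n, k) -` B n)) \<inter> (incr h (N, k) -` B N \<inter> space M)) =
     prob (space M \<inter> (\<Inter>n<N. incr h (n, k) -` B n)) * prob (incr h (N, k) -` B N \<inter> space M)"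
    by (rule indep_setD[OF indep_increment[OF Nh, of k] E]) (use B in \<open>auto simp: incr_def[abs_def]\<close>)
  moreover have "(space M \<inter> (\<Inter>n<N. incr h (n, k) -` B n)) \<inter> (incr h (N, k) -` B N \<inter> space M) =
     space M \<inter> (\<Inter>n<Suc N. incr h (n, k) -` B n)"
    by (auto simp: lessThan_Suc)
  ultimately show ?case using Suc by simp
qed (simp add: prob_space)

text \<open>Independence between the processes is given for whole paths, so the condition on the
  increments of process \<open>k\<close> is written as a measurable set \<open>S k\<close> of paths;
  \<open>prob_incr_one\<close> then splits each process in time.\<close>

lemma prob_incr:
  assumes h: "0 < h" and B: "\<And>i. B i \<in> sets borel" and K: "0 < K"
  shows "prob (\<Inter>k<K. space M \<inter> (\<Inter>n<N. incr h (n, k) -` B (n, k))) =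
    (\<Prod>k<K. \<Prod>n<N. prob (incr h (n, k) -` B (n, k) \<inter> space M))"
proof -
  let ?P = "Pi\<^sub>M {0..} (\<lambda>t. borel) :: (real \<Rightarrow> real) measure"
  define S where "S k = {y \<in> space ?P. \<forall>n<N. y (real (Suc n) * h) - y (real n * h) \<in> B (n, k)}" for k
  have S: "S k \<in> sets ?P" for k
  proof -
    have [measurable]: "(\<lambda>y. y (real n * h)) \<in> borel_measurable ?P" for n
      using h by (intro measurable_component_singleton) auto
    have [measurable]: "B (n, k) \<in> sets borel" for n by (rule B)
    show ?thesis unfolding S_def by measurable
  qed
  have eq: "(\<lambda>\<omega>. \<lambda>t\<in>{0..}. \<beta> k t \<omega>) -` S k \<inter> space M = space M \<inter> (\<Inter>n<N. incr h (n, k) -` B (n, k))" for k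
  proof -
    have "0 \<le> h * real n" "0 \<le> h + h * real n" for n
      using h by simp_all
    then show ?thesis by (auto simp: S_def incr_def space_PiM algebra_simps)
  qed
  have "prob (\<Inter>k\<in>{..<K}. (\<lambda>\<omega>. \<lambda>t\<in>{0..}. \<beta> k t \<omega>) -` S k \<inter> space M) =
    (\<Prod>k\<in>{..<K}. prob ((\<lambda>\<omega>. \<lambda>t\<in>{0..}. \<beta> k t \<omega>) -` S k \<inter> space M))"
    by (rule indep_varsD[OF indep_paths]) (use K S in auto)
  then show ?thesis unfolding eq using prob_incr_one[OF h, of "\<lambda>n. B (n, _)"] B by simp
qed

lemma indep_incr:
  assumes h: "0 < h"
  shows "indep_vars (\<lambda>_. borel) (incr h) UNIV"
  unfolding indep_vars_def2
proof (intro conjI ballI indep_setsI)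
  show "incr h i \<in> borel_measurable M" for i by (rule measurable_incr[OF h])
  show "{incr h i -` A \<inter> space M |A. A \<in> sets borel} \<subseteq> events" for i
    using measurable_sets[OF measurable_incr[OF h]] by blast
  fix A :: "nat \<times> nat \<Rightarrow> 'w set" and J :: "(nat \<times> nat) set"
  assume J: "J \<noteq> {}" "finite J" and "\<forall>j\<in>J. A j \<in> {incr h j -` A \<inter> space M |A. A \<in> sets borel}"
  then have "\<forall>j\<in>J. \<exists>B. A j = incr h j -` B \<inter> space M \<and> B \<in> sets borel" by blast
  then obtain B where B: "\<And>j. j \<in> J \<Longrightarrow> A j = incr h j -` B j \<inter> space M" "\<And>j. j \<in> J \<Longrightarrow> B j \<in> sets borel"
    by metis
  \<comment> \<open>Padding with \<open>UNIV\<close> enlarges the arbitrary finite index set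
    \<open>J\<close> to a rectangle, to which \<open>prob_incr\<close> applies; the added factors
    equal 1.\<close>
  define B' where "B' j = (if j \<in> J then B j else UNIV)" for j
  have B': "B' j \<in> sets borel" for j using B(2) by (auto simp: B'_def)
  obtain N where N: "\<And>j. j \<in> J \<Longrightarrow> fst j < N"
    using finite_nat_set_iff_bounded[of "fst ` J"] J by auto
  obtain K where K: "\<And>j. j \<in> J \<Longrightarrow> snd j < K"
    using finite_nat_set_iff_bounded[of "snd ` J"] J by auto
  have K0: "0 < K" using J(1) K by fastforce
  have "(\<Inter>j\<in>J. A j) = (\<Inter>k<K. space M \<inter> (\<Inter>n<N. incr h (n, k) -` B' (n, k)))" (is "?L = ?R")
  proof (intro set_eqI iffI)
    fix \<omega> assume "\<omega> \<in> ?L"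
    then show "\<omega> \<in> ?R" using B(1) J(1) K0 by (auto simp: B'_def)
  next
    fix \<omega> assume R: "\<omega> \<in> ?R"
    show "\<omega> \<in> ?L"
    proof
      fix j assume j: "j \<in> J"
      obtain n k where nk: "j = (n, k)" by (cases j)
      then have "n < N" "k < K" using N[OF j] K[OF j] by auto
      then have "\<omega> \<in> incr h (n, k) -` B' (n, k) \<inter> space M" using R by (auto split: if_splits)
      then show "\<omega> \<in> A j" using B(1)[OF j] j nk by (simp add: B'_def)
    qed
  qed
  then have "prob (\<Inter>j\<in>J. A j) = prob (\<Inter>k<K. space M \<inter> (\<Inter>n<N. incr h (n, k) -` B' (n, k)))"
    by (simp only:)
  also have "\<dots> = (\<Prod>k<K. \<Prod>n<N. prob (incr h (n, k) -` B' (n, k) \<inter> space M))"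
    by (rule prob_incr[OF h B' K0])
  also have "\<dots> = (\<Prod>n<N. \<Prod>k<K. prob (incr h (n, k) -` B' (n, k) \<inter> space M))" by (rule prod.swap)
  also have "\<dots> = (\<Prod>j\<in>{..<N} \<times> {..<K}. prob (incr h j -` B' j \<inter> space M))"
    by (simp add: prod.cartesian_product case_prod_beta)
  also have "\<dots> = (\<Prod>j\<in>J. prob (incr h j -` B' j \<inter> space M))"
  proof (rule prod.mono_neutral_right)
    show "J \<subseteq> {..<N} \<times> {..<K}" using N K by force
    show "\<forall>j\<in>{..<N} \<times> {..<K} - J. prob (incr h j -` B' j \<inter> space M) = 1"
      by (auto simp: B'_def prob_space)
  qed simp
  also have "\<dots> = (\<Prod>j\<in>J. prob (A j))" using B(1) by (intro prod.cong) (auto simp: B'_def)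
  finally show "prob (\<Inter>j\<in>J. A j) = (\<Prod>j\<in>J. prob (A j))" .
qed

lemma gaussian_array_incr:
  assumes h: "0 < h"
  shows "gaussian_array M (incr h) h"
proof
  show "0 < h" "indep_vars (\<lambda>_. borel) (incr h) UNIV" using h indep_incr by auto
  fix i :: "nat \<times> nat"
  have "distributed M lborel (\<lambda>\<omega>. \<beta> (snd i) (real (Suc (fst i)) * h) \<omega> - \<beta> (snd i) (real (fst i) * h) \<omega>)
     (normal_density 0 (sqrt (real (Suc (fst i)) * h - real (fst i) * h)))"
    using h by (intro distributed_increment) auto
  then show "distributed M lborel (incr h i) (normal_density 0 (sqrt h))"
    unfolding incr_def[abs_def] by (simp add: algebra_simps)
qed

lemma second_moment_diff:
  assumes "0 \<le> s" "0 \<le> t"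
  shows "integrable M (\<lambda>\<omega>. (\<beta> k t \<omega> - \<beta> k s \<omega>)\<^sup>2)" (is ?A)
    "expectation (\<lambda>\<omega>. (\<beta> k t \<omega> - \<beta> k s \<omega>)\<^sup>2) = \<bar>t - s\<bar>" (is ?B)
proof -
  have *: "integrable M (\<lambda>\<omega>. (\<beta> k t \<omega> - \<beta> k s \<omega>)\<^sup>2) \<and> expectation (\<lambda>\<omega>. (\<beta> k t \<omega> - \<beta> k s \<omega>)\<^sup>2) = t - s"
    if "0 \<le> s" "s < t" for s t
    using normal_second_moment[OF _ distributed_increment[OF that]] that by simp
  show ?A ?B
    using *[of s t] *[of t s] assms by (cases s t rule: linorder_cases; simp add: power2_commute[of "\<beta> k s _"])+
qed

lemma second_moment:
  assumes "0 \<le> t"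
  shows "integrable M (\<lambda>\<omega>. (\<beta> k t \<omega>)\<^sup>2)" "expectation (\<lambda>\<omega>. (\<beta> k t \<omega>)\<^sup>2) = t"
proof -
  have ae: "AE \<omega> in M. (\<beta> k t \<omega> - \<beta> k 0 \<omega>)\<^sup>2 = (\<beta> k t \<omega>)\<^sup>2" using AE_\<beta>_0[of k] by eventually_elim simp
  have m: "(\<lambda>\<omega>. (\<beta> k t \<omega> - \<beta> k 0 \<omega>)\<^sup>2) \<in> borel_measurable M" "(\<lambda>\<omega>. (\<beta> k t \<omega>)\<^sup>2) \<in> borel_measurable M"
    using measurable_\<beta>[OF assms] measurable_\<beta>[OF order_refl] by auto
  show "integrable M (\<lambda>\<omega>. (\<beta> k t \<omega>)\<^sup>2)"
    using second_moment_diff(1)[OF order_refl assms] integrable_cong_AE[OF m ae] by blast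
  show "expectation (\<lambda>\<omega>. (\<beta> k t \<omega>)\<^sup>2) = t"
    using second_moment_diff(2)[OF order_refl assms] integral_cong_AE[OF m ae] assms by simp
qed

end

section \<open>The \<open>Q\<close>-Wiener process and the bound for the splitting scheme\<close>

locale Q_wiener_noise = wiener_family M Fs \<beta> for M :: "'w measure" and Fs \<beta> +
  fixes e :: "nat \<Rightarrow> 'd::finite L2" and \<gamma> :: "nat \<Rightarrow> complex"
  assumes onb: "complete_orthonormal e" and \<gamma>: "summable (\<lambda>k. (cmod (\<gamma> k))\<^sup>2)"
begin

abbreviation W :: "real \<Rightarrow> 'w \<Rightarrow> 'd L2" where "W \<equiv> Q_wiener \<gamma> e \<beta>"

lemma AE_summable:
  assumes t: "0 \<le> t"
  shows "AE \<omega> in M. summable (\<lambda>k. (cmod (\<gamma> k * of_real (\<beta> k t \<omega>)))\<^sup>2)"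
proof -
  have "AE \<omega> in M. (\<Sum>k. ennreal ((cmod (of_real (\<beta> k t \<omega>) * \<gamma> k))\<^sup>2)) < \<infinity>"
  proof (rule AE_suminf_weighted_squares[OF measurable_\<beta>[OF t] t _ \<gamma>])
    show "(\<integral>\<^sup>+\<omega>. ennreal ((\<beta> k t \<omega>)\<^sup>2) \<partial>M) = ennreal t" for k
      using second_moment[OF t, of k] by (subst nn_integral_eq_integral) auto
  qed
  then show ?thesis by eventually_elim (auto intro: summable_suminf_not_top simp: mult.commute)
qed

text \<open>The exceptional null set depends on \<open>t\<close>, so this is later combined over
  finitely or countably many times only.\<close>

lemma AE_W:
  assumes t: "0 \<le> t"
  shows "AE \<omega> in M. (\<lambda>k. (\<gamma> k * of_real (\<beta> k t \<omega>)) *\<^sub>C e k) sums W t \<omega> \<and>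
    (\<forall>k. cinner (e k) (W t \<omega>) = \<gamma> k * of_real (\<beta> k t \<omega>))"
  using AE_summable[OF t]
proof eventually_elim
  case (elim \<omega>)
  note s = orthonormal_sums[OF complete_orthonormal_imp_orthonormal[OF onb] elim]
  show ?case using summable_sums[OF s(1)] s(2) by (simp add: Q_wiener_def)
qed

text \<open>The factor \<open>- \<i> \<alpha>\<close> is absorbed into the coefficients, so that
  adding \<open>dW n\<close> means subtracting \<open>\<i> \<alpha> \<delta>W\<close> in the
  scheme.\<close>

lemma gaussian_noise_incr:
  assumes "0 < h" 
  shows "gaussian_noise M (incr h) h e (\<lambda>k. - (\<i> * of_real \<alpha> * \<gamma> k))"
proof -
  interpret gaussian_array M "incr h" h by (rule gaussian_array_incr[OF assms])
  show ?thesis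
    by standard (auto simp: onb norm_mult power_mult_distrib intro!: summable_mult \<gamma>)
qed

lemma G_eq:
  fixes h :: real
  assumes "0 < h"
  shows "gaussian_noise.G (\<lambda>k. - (\<i> * of_real \<alpha> * \<gamma> k)) = \<alpha>\<^sup>2 * trace_Q \<gamma>"
  unfolding gaussian_noise.G_def[OF gaussian_noise_incr[OF assms]] trace_Q_def
  using suminf_mult[OF \<gamma>, of "\<alpha>\<^sup>2"] by (simp add: norm_mult power_mult_distrib)

lemma AE_dW_eq:
  assumes h: "0 < h"
  shows "AE \<omega> in M. \<forall>n. gaussian_noise.dW (incr h) e (\<lambda>k. - (\<i> * of_real \<alpha> * \<gamma> k)) n \<omega> =
    - ((\<i> * of_real \<alpha>) *\<^sub>C (W (real (Suc n) * h) \<omega> - W (real n * h) \<omega>))"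
  unfolding AE_all_countable
proof
  fix n
  interpret gaussian_noise M "incr h" h e "\<lambda>k. - (\<i> * of_real \<alpha> * \<gamma> k)" by (rule gaussian_noise_incr[OF h])
  have 0: "0 \<le> real (Suc n) * h" "0 \<le> real n * h" using h by auto
  show "AE \<omega> in M. dW n \<omega> = - ((\<i> * of_real \<alpha>) *\<^sub>C (W (real (Suc n) * h) \<omega> - W (real n * h) \<omega>))"
    using AE_dW[of n] AE_W[OF 0(1)] AE_W[OF 0(2)]
  proof eventually_elim
    case (elim \<omega>)
    show ?case
    proof (rule complete_orthonormal_eqI[OF onb])
      fix k
      have "cinner (e k) (- v) = - cinner (e k) v" for v
        using cinner_diff_right[of "e k" 0 v] by simp
      then show "cinner (e k) (dW n \<omega>) = cinner (e k) (- ((\<i> * of_real \<alpha>) *\<^sub>C (W (real (Suc n) * h) \<omega> - W (real n * h) \<omega>)))"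
        using elim(2,3) by (simp only: cinner_dW elim(1) if_True cinner_scaleC_right cinner_diff_right)
          (simp add: incr_def algebra_simps)
    qed
  qed
qed

text \<open>The factor \<open>1/16\<close> is chosen so that \<open>exp (8 \<alpha>\<^sup>2 Tr(Q) \<mu> T) \<le> 2\<close>, whence the exponent
  never exceeds \<open>2 \<mu>\<close>.\<close>

lemma scheme_exp_moment_le:
  assumes h: "0 < h" and \<mu>: "0 < \<mu>" and T: "real n * h \<le> T" "0 < n" "\<mu> * \<alpha>\<^sup>2 * T * trace_Q \<gamma> < 1/16"
    and B: "continuous_on UNIV B" "\<And>w. (norm (B w))\<^sup>2 \<le> (norm w)\<^sup>2 + \<delta>" and \<delta>: "real n * \<delta> \<le> 1"
  shows "(\<integral>\<^sup>+\<omega>. ennreal (exp (\<mu> * (norm (gaussian_noise.scheme (incr h) h e (\<lambda>k. - (\<i> * of_real \<alpha> * \<gamma> k)) B v n \<omega>))\<^sup>2)) \<partial>M)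
    \<le> ennreal (exp (2 * \<mu> * (norm v)\<^sup>2 + 2 * \<mu> + 1))"
proof -
  interpret gaussian_noise M "incr h" h e "\<lambda>k. - (\<i> * of_real \<alpha> * \<gamma> k)" by (rule gaussian_noise_incr[OF h])
  have G: "G = \<alpha>\<^sup>2 * trace_Q \<gamma>" by (rule G_eq[OF h])
  have \<mu>GT: "\<mu> * G * T < 1/16" using T(3) unfolding G by (simp add: mult_ac)
  have nh: "\<mu> * G * (real n * h) < 1/16"
  proof -
    have "\<mu> * G * (real n * h) \<le> \<mu> * G * T" using \<mu> G_nonneg T(1) by (intro mult_left_mono) auto
    then show ?thesis using \<mu>GT by linarith
  qed
  \<comment> \<open>Since \<open>n\<close> is positive, one step is no longer than the whole
    interval; smallness of \<open>\<mu> G T\<close> therefore yields the one-step condition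
    \<open>2 L G h \<le> 1/2\<close> for \<open>L = 2 \<mu>\<close>, whatever the step size.\<close>
  have "1 * h \<le> real n * h" using T(2) h by (intro mult_right_mono) auto
  then have "\<mu> * G * h \<le> \<mu> * G * (real n * h)" using \<mu> G_nonneg by (intro mult_left_mono) auto
  with nh have h16: "\<mu> * G * h < 1/16" by linarith
  have e2: "exp (1/2::real) \<le> 2"
    using exp_bound_half[of "1/2 :: real"] by simp
  have "\<mu> * exp (4 * G * (2 * \<mu>) * h * real n) \<le> \<mu> * exp (1/2)"
    using nh \<mu> by (simp add: mult_ac)
  also have "\<dots> \<le> 2 * \<mu>" using e2 \<mu> by simp
  finally have l: "\<mu> * exp (4 * G * (2 * \<mu>) * h * real n) \<le> 2 * \<mu>" .
  have "(\<integral>\<^sup>+\<omega>. ennreal (exp (\<mu> * (norm (scheme B v n \<omega>))\<^sup>2)) \<partial>M) \<le>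
      ennreal (exp (2 * \<mu> * ((norm v)\<^sup>2 + real n * \<delta> + 2 * G * h * real n)))"
    by (rule scheme_exp_moment[OF B _ _ _ l]) (use \<mu> h16 in \<open>auto simp: mult_ac\<close>)
  also have "\<dots> \<le> ennreal (exp (2 * \<mu> * (norm v)\<^sup>2 + 2 * \<mu> + 1))"
  proof (intro ennreal_leI, unfold exp_le_cancel_iff)
    \<comment> \<open>Origin of the constant: \<open>2 \<mu>\<close> pays for the accumulated defect
      \<open>n \<delta> \<le> 1\<close>, and 1 for the accumulated variance.\<close>
    have "2 * \<mu> * (real n * \<delta>) \<le> 2 * \<mu> * 1" using \<delta> \<mu> by (intro mult_left_mono) auto
    moreover have "2 * \<mu> * (2 * G * h * real n) \<le> 1" using nh by (simp add: mult_ac)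
    ultimately show "2 * \<mu> * ((norm v)\<^sup>2 + real n * \<delta> + 2 * G * h * real n) \<le> 2 * \<mu> * (norm v)\<^sup>2 + 2 * \<mu> + 1"
      by (simp add: distrib_left)
  qed
  finally show ?thesis .
qed

text \<open>Almost surely this is the abstract scheme with \<open>B\<close> the phase flow, which
  preserves the norm, so the defect \<open>\<delta>\<close> is 0.\<close>

lemma splitting_exp_moment:
  assumes h: "0 < h" and \<mu>: "0 < \<mu>" and T: "real n * h \<le> T" "\<mu> * \<alpha>\<^sup>2 * T * trace_Q \<gamma> < 1/16"
    and N: "nonlinearity V F"
  shows "(\<integral>\<^sup>+\<omega>. ennreal (exp (\<mu> * (norm (splitting W \<alpha> V u0 h n \<omega>))\<^sup>2)) \<partial>M) \<le>
    ennreal (exp (2 * \<mu> * (norm u0)\<^sup>2 + 2 * \<mu> + 1))"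
proof (cases "n = 0")
  case True
  have "\<mu> * (norm u0)\<^sup>2 \<le> 2 * \<mu> * (norm u0)\<^sup>2 + 2 * \<mu> + 1" using \<mu> by (auto intro!: add_nonneg_nonneg)
  then show ?thesis using True by (auto simp: emeasure_space_1 intro!: ennreal_leI)
next
  case False
  interpret gaussian_noise M "incr h" h e "\<lambda>k. - (\<i> * of_real \<alpha> * \<gamma> k)" by (rule gaussian_noise_incr[OF h])
  have "AE \<omega> in M. splitting W \<alpha> V u0 h n \<omega> = scheme (phase_flow V h) u0 n \<omega>"
    using AE_dW_eq[OF h, of \<alpha>]
  proof eventually_elim
    case (elim \<omega>)
    show ?case by (induct n) (use elim in \<open>auto simp: scheme.simps\<close>)
  qed
  then have "(\<integral>\<^sup>+\<omega>. ennreal (exp (\<mu> * (norm (splitting W \<alpha> V u0 h n \<omega>))\<^sup>2)) \<partial>M) =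
      (\<integral>\<^sup>+\<omega>. ennreal (exp (\<mu> * (norm (scheme (phase_flow V h) u0 n \<omega>))\<^sup>2)) \<partial>M)"
    by (intro nn_integral_cong_AE) (erule eventually_mono, simp)
  also have "\<dots> \<le> ennreal (exp (2 * \<mu> * (norm u0)\<^sup>2 + 2 * \<mu> + 1))"
    using False h by (intro scheme_exp_moment_le[OF h \<mu> T(1) _ T(2), where \<delta> = 0] continuous_phase_flow[OF N])
      (auto simp: norm_phase_flow[OF N])
  finally show ?thesis .
qed

end

section \<open>Ito inequality\<close>

lemma norm_sum_scaleR_square:
  fixes a :: "'p \<Rightarrow> 'b::real_inner"
  shows "(norm (\<Sum>p\<in>P. x p *\<^sub>R a p))\<^sup>2 = (\<Sum>p\<in>P. \<Sum>q\<in>P. (x p * x q) * inner (a p) (a q))"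
proof -
  have "(norm (\<Sum>p\<in>P. x p *\<^sub>R a p))\<^sup>2 = (\<Sum>p\<in>P. inner (x p *\<^sub>R a p) (\<Sum>q\<in>P. x q *\<^sub>R a q))"
    unfolding power2_norm_eq_inner by (rule inner_sum_left)
  also have "\<dots> = (\<Sum>p\<in>P. \<Sum>q\<in>P. inner (x p *\<^sub>R a p) (x q *\<^sub>R a q))"
    by (simp only: inner_sum_right)
  finally show ?thesis by (simp add: mult_ac)
qed

context wiener_family
begin

lemma expectation_\<beta>:
  assumes "0 \<le> t"
  shows "integrable M (\<beta> k t)" "expectation (\<beta> k t) = 0"
proof -
  have [measurable]: "\<beta> k t \<in> borel_measurable M" "\<beta> k 0 \<in> borel_measurable M"
    using measurable_\<beta> assms by auto
  show "integrable M (\<beta> k t)"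
    by (rule square_integrable_imp_integrable[OF _ second_moment(1)[OF assms]]) measurable
  show "expectation (\<beta> k t) = 0"
  proof (cases "t = 0")
    case True
    then show ?thesis using AE_\<beta>_0[of k] by (intro integral_eq_zero_AE) simp
  next
    case False
    then have "expectation (\<lambda>\<omega>. \<beta> k t \<omega> - \<beta> k 0 \<omega>) = 0"
      using assms by (intro normal_distributed_expectation[OF _ distributed_increment]) auto
    moreover have "expectation (\<lambda>\<omega>. \<beta> k t \<omega> - \<beta> k 0 \<omega>) = expectation (\<beta> k t)"
      using AE_\<beta>_0[of k] by (intro integral_cong_AE) (auto elim: eventually_mono)
    ultimately show ?thesis by simp
  qed
qed

lemma integrable_\<beta>_mult:
  assumes "0 \<le> s" "0 \<le> t"
  shows "integrable M (\<lambda>\<omega>. \<beta> k s \<omega> * \<beta> l t \<omega>)"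
proof (rule Bochner_Integration.integrable_bound)
  show "integrable M (\<lambda>\<omega>. (\<beta> k s \<omega>)\<^sup>2 + (\<beta> l t \<omega>)\<^sup>2)"
    using second_moment(1) assms by auto
  show "(\<lambda>\<omega>. \<beta> k s \<omega> * \<beta> l t \<omega>) \<in> borel_measurable M"
    using measurable_\<beta> assms by auto
  have "\<bar>x\<bar> * \<bar>y\<bar> \<le> x\<^sup>2 + y\<^sup>2" for x y :: real
    using sum_squares_bound[of "\<bar>x\<bar>" "\<bar>y\<bar>"] mult_nonneg_nonneg[OF abs_ge_zero[of x] abs_ge_zero[of y]]
    unfolding power2_abs by linarith
  then show "AE \<omega> in M. norm (\<beta> k s \<omega> * \<beta> l t \<omega>) \<le> norm ((\<beta> k s \<omega>)\<^sup>2 + (\<beta> l t \<omega>)\<^sup>2)"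
    by (simp add: abs_mult)
qed

text \<open>Polarisation of the variance of the increment for one process; independence and zero
  means for two different ones.\<close>

lemma covariance_\<beta>:
  assumes st: "0 \<le> s" "0 \<le> t"
  shows "expectation (\<lambda>\<omega>. \<beta> k s \<omega> * \<beta> l t \<omega>) = (if k = l then min s t else 0)"
proof (cases "k = l")
  case True
  have "expectation (\<lambda>\<omega>. \<beta> l s \<omega> * \<beta> l t \<omega>) =
    expectation (\<lambda>\<omega>. ((\<beta> l s \<omega>)\<^sup>2 + (\<beta> l t \<omega>)\<^sup>2 - (\<beta> l t \<omega> - \<beta> l s \<omega>)\<^sup>2) / 2)"
    by (intro Bochner_Integration.integral_cong) (auto simp: power2_eq_square algebra_simps)
  also have "\<dots> = (s + t - \<bar>t - s\<bar>) / 2"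
    using second_moment second_moment_diff st by simp
  finally show ?thesis using True by (cases "s \<le> t") auto
next
  case False
  \<comment> \<open>Assigns one evaluation time to each process, so that independence of paths
    specialises to the two values at different times.\<close>
  define q where "q m = (if m = k then s else t)" for m
  have q: "0 \<le> q m" for m using st by (simp add: q_def)
  have "indep_vars (\<lambda>_. borel) (\<lambda>m \<omega>. (\<lambda>t\<in>{0..}. \<beta> m t \<omega>) (q m)) UNIV"
    by (rule indep_vars_compose2[OF indep_paths]) (use q in auto)
  then have "indep_vars (\<lambda>_. borel) (\<lambda>m \<omega>. \<beta> m (q m) \<omega>) UNIV" using q by simp
  then have "indep_vars (\<lambda>_. borel) (\<lambda>m \<omega>. \<beta> m (q m) \<omega>) {k, l}" by (rule indep_vars_subset) simp
  then have "expectation (\<lambda>\<omega>. \<Prod>m\<in>{k, l}. \<beta> m (q m) \<omega>) = (\<Prod>m\<in>{k, l}. expectation (\<beta> m (q m)))"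
    using expectation_\<beta>(1)[OF q] by (intro indep_vars_lebesgue_integral) auto
  then show ?thesis using False expectation_\<beta>(2)[OF st(1)] by (simp add: q_def)
qed

lemma second_moment_sum:
  fixes a :: "'p \<Rightarrow> 'd::finite L2"
  assumes "finite P" and t: "\<And>p. p \<in> P \<Longrightarrow> 0 \<le> t p"
  shows "(\<integral>\<^sup>+\<omega>. ennreal ((norm (\<Sum>p\<in>P. \<beta> (\<kappa> p) (t p) \<omega> *\<^sub>R a p))\<^sup>2) \<partial>M) =
    ennreal (\<Sum>p\<in>P. \<Sum>q\<in>P. (if \<kappa> p = \<kappa> q then min (t p) (t q) else 0) * inner (a p) (a q))"
proof -
  have eq: "(norm (\<Sum>p\<in>P. \<beta> (\<kappa> p) (t p) \<omega> *\<^sub>R a p))\<^sup>2 =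
    (\<Sum>p\<in>P. \<Sum>q\<in>P. (\<beta> (\<kappa> p) (t p) \<omega> * \<beta> (\<kappa> q) (t q) \<omega>) * inner (a p) (a q))" for \<omega>
    by (rule norm_sum_scaleR_square)
  have int: "integrable M (\<lambda>\<omega>. (norm (\<Sum>p\<in>P. \<beta> (\<kappa> p) (t p) \<omega> *\<^sub>R a p))\<^sup>2)"
    unfolding eq using t by (intro Bochner_Integration.integrable_sum integrable_mult_left integrable_\<beta>_mult) auto
  have "expectation (\<lambda>\<omega>. (norm (\<Sum>p\<in>P. \<beta> (\<kappa> p) (t p) \<omega> *\<^sub>R a p))\<^sup>2) =
    (\<Sum>p\<in>P. \<Sum>q\<in>P. expectation (\<lambda>\<omega>. (\<beta> (\<kappa> p) (t p) \<omega> * \<beta> (\<kappa> q) (t q) \<omega>) * inner (a p) (a q)))"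
    unfolding eq using t
    by (subst Bochner_Integration.integral_sum,
        intro Bochner_Integration.integrable_sum integrable_mult_left integrable_\<beta>_mult, blast, blast)
       (intro sum.cong refl Bochner_Integration.integral_sum integrable_mult_left integrable_\<beta>_mult, blast, blast)
  also have "\<dots> = (\<Sum>p\<in>P. \<Sum>q\<in>P. (if \<kappa> p = \<kappa> q then min (t p) (t q) else 0) * inner (a p) (a q))"
    using t by (intro sum.cong refl) (simp add: covariance_\<beta>)
  finally show ?thesis using int by (subst nn_integral_eq_integral) auto
qed

end

text \<open>\<open>min (t i) (t j)\<close> is the length of the overlap of \<open>{0<..t i}\<close>
  and \<open>{0<..t j}\<close>, and also the covariance of a Wiener process at these times. That
  coincidence with \<open>second_moment_sum\<close> is the Ito isometry.\<close>

lemma integral_step_sum: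
  fixes a :: "'i \<Rightarrow> 'd::finite L2"
  assumes "finite I" and t: "\<And>i. i \<in> I \<Longrightarrow> 0 \<le> t i"
  shows "(\<integral>\<^sup>+s. ennreal ((norm (\<Sum>i\<in>I. indicator {0<..t i} s *\<^sub>R a i))\<^sup>2) \<partial>lborel) =
    ennreal (\<Sum>i\<in>I. \<Sum>j\<in>I. min (t i) (t j) * inner (a i) (a j))"
    "(\<lambda>s. (norm (\<Sum>i\<in>I. indicator {0<..t i} s *\<^sub>R a i))\<^sup>2) \<in> borel_measurable lborel"
    "0 \<le> (\<Sum>i\<in>I. \<Sum>j\<in>I. min (t i) (t j) * inner (a i) (a j))"
proof -
  have eq: "(norm (\<Sum>i\<in>I. indicator {0<..t i} s *\<^sub>R a i))\<^sup>2 =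
    (\<Sum>i\<in>I. \<Sum>j\<in>I. indicator {0<..min (t i) (t j)} s * inner (a i) (a j))" for s
  proof -
    have "(norm (\<Sum>i\<in>I. indicator {0<..t i} s *\<^sub>R a i))\<^sup>2 =
      (\<Sum>i\<in>I. \<Sum>j\<in>I. (indicator {0<..t i} s * indicator {0<..t j} s) * inner (a i) (a j))"
      by (rule norm_sum_scaleR_square)
    also have "\<dots> = (\<Sum>i\<in>I. \<Sum>j\<in>I. indicator {0<..min (t i) (t j)} s * inner (a i) (a j))"
      by (intro sum.cong refl) (auto split: split_indicator)
    finally show ?thesis .
  qed
  have Ioc: "emeasure lborel {0<..m} < \<infinity>" for m :: real
    by (cases "0 \<le> m") auto
  have i1: "integrable lborel (\<lambda>s. indicator {0<..min (t i) (t j)} s * inner (a i) (a j))" for i j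
    by (intro integrable_mult_left integrable_real_indicator Ioc) simp
  have int: "integrable lborel (\<lambda>s. (norm (\<Sum>i\<in>I. indicator {0<..t i} s *\<^sub>R a i))\<^sup>2)"
    unfolding eq by (intro Bochner_Integration.integrable_sum i1)
  then show "(\<lambda>s. (norm (\<Sum>i\<in>I. indicator {0<..t i} s *\<^sub>R a i))\<^sup>2) \<in> borel_measurable lborel" by auto
  have "integral\<^sup>L lborel (\<lambda>s. (norm (\<Sum>i\<in>I. indicator {0<..t i} s *\<^sub>R a i))\<^sup>2) =
    (\<Sum>i\<in>I. \<Sum>j\<in>I. integral\<^sup>L lborel (\<lambda>s. indicator {0<..min (t i) (t j)} s * inner (a i) (a j)))"
    unfolding eq
    by (subst Bochner_Integration.integral_sum, intro Bochner_Integration.integrable_sum i1)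
       (intro sum.cong refl Bochner_Integration.integral_sum i1)
  also have "\<dots> = (\<Sum>i\<in>I. \<Sum>j\<in>I. min (t i) (t j) * inner (a i) (a j))"
    using t by (intro sum.cong refl) (simp add: measure_def)
  finally have L: "integral\<^sup>L lborel (\<lambda>s. (norm (\<Sum>i\<in>I. indicator {0<..t i} s *\<^sub>R a i))\<^sup>2) =
    (\<Sum>i\<in>I. \<Sum>j\<in>I. min (t i) (t j) * inner (a i) (a j))" .
  show "0 \<le> (\<Sum>i\<in>I. \<Sum>j\<in>I. min (t i) (t j) * inner (a i) (a j))"
    unfolding L[symmetric] by (rule Bochner_Integration.integral_nonneg) simp
  show "(\<integral>\<^sup>+s. ennreal ((norm (\<Sum>i\<in>I. indicator {0<..t i} s *\<^sub>R a i))\<^sup>2) \<partial>lborel) =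
    ennreal (\<Sum>i\<in>I. \<Sum>j\<in>I. min (t i) (t j) * inner (a i) (a j))"
    using int L by (subst nn_integral_eq_integral) auto
qed

context Q_wiener_noise
begin

lemma bounded_linear_\<gamma>_e:
  assumes "bounded_linear A"
  shows "A ((\<gamma> k * of_real b) *\<^sub>C e k) = b *\<^sub>R A (\<gamma> k *\<^sub>C e k)"
proof -
  have "(\<gamma> k * of_real b) *\<^sub>C e k = b *\<^sub>R (\<gamma> k *\<^sub>C e k)"
    by (simp add: scaleR_L2_def scaleC_scaleC mult.commute)
  then show ?thesis using linear_scale[OF bounded_linear.linear[OF assms]] by simp
qed

text \<open>Formulated with values \<open>W (t i)\<close> instead of increments, so that step
  integrals over different partitions can be combined without a common refinement. The noise is cut
  off at \<open>K\<close> modes, where equality holds, and Fatou's lemma in \<open>K\<close> leaves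
  an inequality.\<close>

lemma Ito_inequality_sum:
  fixes A :: "'i \<Rightarrow> 'd L2 \<Rightarrow> 'd L2"
  assumes I: "finite I" and t: "\<And>i. i \<in> I \<Longrightarrow> 0 \<le> t i" and A: "\<And>i. i \<in> I \<Longrightarrow> bounded_linear (A i)"
  shows "(\<integral>\<^sup>+\<omega>. ennreal ((norm (\<Sum>i\<in>I. A i (W (t i) \<omega>)))\<^sup>2) \<partial>M) \<le>
    (\<integral>\<^sup>+s. (\<Sum>k. ennreal ((norm (\<Sum>i\<in>I. indicator {0<..t i} s *\<^sub>R A i (\<gamma> k *\<^sub>C e k)))\<^sup>2)) \<partial>lborel)"
    (is "_ \<le> ?R")
proof -
  define a where "a i k = A i (\<gamma> k *\<^sub>C e k)" for i k
  define Y where "Y K \<omega> = (\<Sum>p\<in>{..<K} \<times> I. \<beta> (fst p) (t (snd p)) \<omega> *\<^sub>R a (snd p) (fst p))" for K \<omega>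
  have m [measurable]: "p \<in> {..<K} \<times> I \<Longrightarrow> \<beta> (fst p) (t (snd p)) \<in> borel_measurable M" for p K
    using t by (intro measurable_\<beta>) auto
  have "AE \<omega> in M. \<forall>i\<in>I. (\<lambda>k. (\<gamma> k * of_real (\<beta> k (t i) \<omega>)) *\<^sub>C e k) sums W (t i) \<omega>"
    using I t by (intro AE_finite_allI) (auto intro: eventually_mono[OF AE_W])
  then have "AE \<omega> in M. ennreal ((norm (\<Sum>i\<in>I. A i (W (t i) \<omega>)))\<^sup>2) = liminf (\<lambda>K. ennreal ((norm (Y K \<omega>))\<^sup>2))"
  proof eventually_elim
    case (elim \<omega>)
    have "(\<lambda>k. A i ((\<gamma> k * of_real (\<beta> k (t i) \<omega>)) *\<^sub>C e k)) sums A i (W (t i) \<omega>)" if "i \<in> I" for i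
      using elim that by (intro bounded_linear.sums[OF A]) auto
    then have "(\<lambda>k. \<Sum>i\<in>I. \<beta> k (t i) \<omega> *\<^sub>R a i k) sums (\<Sum>i\<in>I. A i (W (t i) \<omega>))"
      by (intro sums_sum) (simp add: bounded_linear_\<gamma>_e[OF A] a_def)
    then have "(\<lambda>K. Y K \<omega>) \<longlonglongrightarrow> (\<Sum>i\<in>I. A i (W (t i) \<omega>))"
      unfolding sums_def Y_def sum.cartesian_product case_prod_beta .
    then have "(\<lambda>K. ennreal ((norm (Y K \<omega>))\<^sup>2)) \<longlonglongrightarrow> ennreal ((norm (\<Sum>i\<in>I. A i (W (t i) \<omega>)))\<^sup>2)"
      by (intro tendsto_ennrealI tendsto_intros)
    then show ?case by (intro lim_imp_Liminf[symmetric] sequentially_bot)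
  qed
  then have "(\<integral>\<^sup>+\<omega>. ennreal ((norm (\<Sum>i\<in>I. A i (W (t i) \<omega>)))\<^sup>2) \<partial>M) =
      (\<integral>\<^sup>+\<omega>. liminf (\<lambda>K. ennreal ((norm (Y K \<omega>))\<^sup>2)) \<partial>M)"
    by (rule nn_integral_cong_AE)
  also have "\<dots> \<le> liminf (\<lambda>K. \<integral>\<^sup>+\<omega>. ennreal ((norm (Y K \<omega>))\<^sup>2) \<partial>M)"
  proof (rule nn_integral_liminf)
    fix K
    have "Y K \<in> borel_measurable M"
      unfolding Y_def using t
      by (intro borel_measurable_L2_sum[OF onb] borel_measurable_bounded_linear[OF bounded_linear_scaleR_left] m) auto
    then show "(\<lambda>\<omega>. ennreal ((norm (Y K \<omega>))\<^sup>2)) \<in> borel_measurable M" by measurable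
  qed
  also have "\<dots> \<le> liminf (\<lambda>K. ?R)"
  proof (intro Liminf_mono always_eventually allI)
    fix K
    have "(\<integral>\<^sup>+\<omega>. ennreal ((norm (Y K \<omega>))\<^sup>2) \<partial>M) =
      ennreal (\<Sum>p\<in>{..<K} \<times> I. \<Sum>q\<in>{..<K} \<times> I. (if fst p = fst q then min (t (snd p)) (t (snd q)) else 0) *
        inner (a (snd p) (fst p)) (a (snd q) (fst q)))"
      unfolding Y_def by (rule second_moment_sum) (use I t in auto)
    also have "(\<Sum>p\<in>{..<K} \<times> I. \<Sum>q\<in>{..<K} \<times> I. (if fst p = fst q then min (t (snd p)) (t (snd q)) else 0) *
        inner (a (snd p) (fst p)) (a (snd q) (fst q))) =
        (\<Sum>k<K. \<Sum>i\<in>I. \<Sum>j\<in>I. min (t i) (t j) * inner (a i k) (a j k))"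
    proof -
      have "(\<Sum>q\<in>{..<K} \<times> I. (if k = fst q then min (t i) (t (snd q)) else 0) * inner (a i k) (a (snd q) (fst q))) =
          (\<Sum>j\<in>I. min (t i) (t j) * inner (a i k) (a j k))" if "k < K" for k i
      proof -
        have "(\<Sum>q\<in>{..<K} \<times> I. (if k = fst q then min (t i) (t (snd q)) else 0) * inner (a i k) (a (snd q) (fst q))) =
          (\<Sum>l<K. \<Sum>j\<in>I. (if k = l then min (t i) (t j) else 0) * inner (a i k) (a j l))"
          unfolding sum.cartesian_product by (simp add: case_prod_beta)
        also have "\<dots> = (\<Sum>l<K. if k = l then \<Sum>j\<in>I. min (t i) (t j) * inner (a i k) (a j l) else 0)"
          by (intro sum.cong) auto
        finally show ?thesis using that by (simp add: sum.delta)
      qed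
      then show ?thesis
        unfolding sum.cartesian_product[of _ I "{..<K}"] case_prod_beta
        by (intro sum.cong refl) (clarsimp cong: if_cong)
    qed
    also have "ennreal \<dots> = (\<Sum>k<K. \<integral>\<^sup>+s. ennreal ((norm (\<Sum>i\<in>I. indicator {0<..t i} s *\<^sub>R a i k))\<^sup>2) \<partial>lborel)"
      by (simp add: integral_step_sum(1)[OF I t] sum_ennreal integral_step_sum(3)[OF I t])
    also have "\<dots> = (\<integral>\<^sup>+s. (\<Sum>k<K. ennreal ((norm (\<Sum>i\<in>I. indicator {0<..t i} s *\<^sub>R a i k))\<^sup>2)) \<partial>lborel)"
      using integral_step_sum(2)[OF I t] by (intro nn_integral_sum[symmetric] measurable_compose[OF _ measurable_ennreal]) auto
    also have "\<dots> \<le> ?R" unfolding a_def by (intro nn_integral_mono sum_le_suminf) auto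
    finally show "(\<integral>\<^sup>+\<omega>. ennreal ((norm (Y K \<omega>))\<^sup>2) \<partial>M) \<le> ?R" .
  qed
  finally show ?thesis by (simp add: Liminf_const)
qed


lemma Ito_inequality_step_diff:
  assumes p: "\<And>i. i < m \<Longrightarrow> 0 \<le> p i \<and> p i \<le> p (Suc i)" and A: "\<And>i. i < m \<Longrightarrow> bounded_linear (A i)"
    and p': "\<And>i. i < m' \<Longrightarrow> 0 \<le> p' i \<and> p' i \<le> p' (Suc i)" and A': "\<And>i. i < m' \<Longrightarrow> bounded_linear (A' i)"
  shows "(\<integral>\<^sup>+\<omega>. ennreal ((norm (step_integral m p A W \<omega> - step_integral m' p' A' W \<omega>))\<^sup>2) \<partial>M) \<le>
    (\<integral>\<^sup>+s. (\<Sum>k. ennreal ((norm (step_operator m p A s (\<gamma> k *\<^sub>C e k) - step_operator m' p' A' s (\<gamma> k *\<^sub>C e k)))\<^sup>2)) \<partial>lborel)"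
proof -
  \<comment> \<open>One index per end point of each cell: \<open>Inl\<close> and \<open>Inr\<close>
    select the partition, \<open>True\<close> the right and \<open>False\<close> the left end point.
    The signs sit in \<open>B\<close>.\<close>
  define I where "I = ({..<m} <+> {..<m'}) \<times> (UNIV :: bool set)"
  define t where "t x = (case fst x of Inl i \<Rightarrow> if snd x then p (Suc i) else p i
    | Inr i \<Rightarrow> if snd x then p' (Suc i) else p' i)" for x :: "(nat + nat) \<times> bool"
  define B where "B x v = (case fst x of Inl i \<Rightarrow> (if snd x then 1 else -1) *\<^sub>R A i v
    | Inr i \<Rightarrow> (if snd x then -1 else 1) *\<^sub>R A' i v)" for x :: "(nat + nat) \<times> bool" and v :: "'d L2"
  have I: "finite I" by (simp add: I_def)
  have t: "0 \<le> t x" if "x \<in> I" for x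
    using that p p' by (force simp: I_def t_def split: sum.splits)
  have BL: "bounded_linear (B x)" if "x \<in> I" for x
  proof (cases "fst x")
    case (Inl i)
    then have "i < m" using that by (auto simp: I_def)
    then show ?thesis unfolding B_def[abs_def] Inl sum.case
      by (intro bounded_linear_compose[OF bounded_linear_scaleR_right] A)
  next
    case (Inr i)
    then have "i < m'" using that by (auto simp: I_def)
    then show ?thesis unfolding B_def[abs_def] Inr sum.case
      by (intro bounded_linear_compose[OF bounded_linear_scaleR_right] A')
  qed
  have sumI: "(\<Sum>x\<in>I. f x) = (\<Sum>i<m. f (Inl i, True) + f (Inl i, False)) + (\<Sum>i<m'. f (Inr i, True) + f (Inr i, False))"
    for f :: "(nat + nat) \<times> bool \<Rightarrow> 'd L2"
  proof -
    have "(\<Sum>x\<in>I. f x) = (\<Sum>a\<in>{..<m} <+> {..<m'}. \<Sum>b\<in>UNIV. f (a, b))"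
      unfolding I_def sum.cartesian_product by (simp add: case_prod_beta)
    then show ?thesis by (simp add: sum.Plus UNIV_bool add.commute)
  qed
  have 1: "(\<Sum>x\<in>I. B x (W (t x) \<omega>)) = step_integral m p A W \<omega> - step_integral m' p' A' W \<omega>" for \<omega>
  proof -
    have "step_integral m p A W \<omega> = (\<Sum>i<m. A i (W (p (Suc i)) \<omega>) - A i (W (p i) \<omega>))"
      unfolding step_integral_def
      using linear_diff[OF bounded_linear.linear[OF A]] by (intro sum.cong refl) simp
    moreover have "step_integral m' p' A' W \<omega> = (\<Sum>i<m'. A' i (W (p' (Suc i)) \<omega>) - A' i (W (p' i) \<omega>))"
      unfolding step_integral_def
      using linear_diff[OF bounded_linear.linear[OF A']] by (intro sum.cong refl) simp
    ultimately show ?thesis unfolding sumI B_def t_def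
      by (simp add: sum.distrib sum_subtractf sum_negf)
  qed
  have 2: "(\<Sum>x\<in>I. indicator {0<..t x} s *\<^sub>R B x v) = step_operator m p A s v - step_operator m' p' A' s v" for s v
  proof -
    have ind: "indicator {a<..b} s = (indicator {0<..b} s - indicator {0<..a} s :: real)" if "0 \<le> a" "a \<le> b" for a b
      using that by (auto split: split_indicator)
    have "step_operator m p A s v = (\<Sum>i<m. indicator {0<..p (Suc i)} s *\<^sub>R A i v - indicator {0<..p i} s *\<^sub>R A i v)"
      unfolding step_operator_def using p by (intro sum.cong refl) (subst ind, auto simp: scaleR_diff_left)
    moreover have "step_operator m' p' A' s v = (\<Sum>i<m'. indicator {0<..p' (Suc i)} s *\<^sub>R A' i v - indicator {0<..p' i} s *\<^sub>R A' i v)"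
      unfolding step_operator_def using p' by (intro sum.cong refl) (subst ind, auto simp: scaleR_diff_left)
    ultimately show ?thesis unfolding sumI B_def t_def
      by (simp add: sum.distrib sum_subtractf sum_negf)
  qed
  show ?thesis
    by (rule Ito_inequality_sum[where I = I and t = t and A = B, unfolded 1 2]) (fact I t BL)+
qed

end

lemma ennreal_norm_diff_square_le:
  fixes a b c :: "'a::real_inner"
  shows "ennreal ((norm (a - c))\<^sup>2) \<le> 2 * ennreal ((norm (a - b))\<^sup>2) + 2 * ennreal ((norm (b - c))\<^sup>2)"
proof -
  have "(norm (a - c))\<^sup>2 \<le> (norm (a - b) + norm (b - c))\<^sup>2"
    by (intro power_mono) (use norm_triangle_ineq[of "a - b" "b - c"] in auto)
  also have "\<dots> \<le> 2 * (norm (a - b))\<^sup>2 + 2 * (norm (b - c))\<^sup>2"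
    using sum_squares_bound[of "norm (a - b)" "norm (b - c)"] by (simp add: power2_sum)
  finally show ?thesis
    by (simp add: ennreal_leI ennreal_plus[symmetric] ennreal_mult''[symmetric] del: ennreal_plus
      flip: ennreal_numeral)
qed

lemma partition_bounds:
  fixes p :: "nat \<Rightarrow> real"
  assumes "p 0 = 0" "\<And>i. i < m \<Longrightarrow> p i \<le> p (Suc i)"
  shows "i \<le> m \<Longrightarrow> 0 \<le> p i" "i \<le> m \<Longrightarrow> p i \<le> p m"
proof -
  show "i \<le> m \<Longrightarrow> 0 \<le> p i"
    by (induct i) (use assms in \<open>auto intro: order_trans\<close>)
  show "p i \<le> p m" if "i \<le> m"
    using that by (induct rule: inc_induct) (use assms in \<open>auto intro: order_trans\<close>)
qed

lemma step_operator_outside: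
  assumes p: "p 0 = 0" "\<And>i. i < m \<Longrightarrow> p i \<le> p (Suc i)" and "s \<notin> {0..p m}"
  shows "step_operator m p A s v = 0"
  unfolding step_operator_def
proof (rule sum.neutral, safe)
  fix i assume "i < m"
  then show "indicator {p i<..p (Suc i)} s *\<^sub>R A i v = 0"
    using partition_bounds(1)[where p = p and m = m and i = i, OF p] partition_bounds(2)[where p = p and m = m and i = "Suc i", OF p] assms(3)
    by (auto simp: indicator_def)
qed

context Q_wiener_noise
begin

text \<open>\<open>W t\<close> is a \<open>suminf\<close> with unspecified values where the series
  diverges; measurability can be asserted only for a version set to 0 there.\<close>

lemma AE_measurable_W:
  assumes t: "0 \<le> t"
  shows "\<exists>Y\<in>borel_measurable M. AE \<omega> in M. W t \<omega> = Y \<omega>"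
proof -
  note [measurable] = measurable_\<beta>[OF t]
  define Y where "Y \<omega> = (if (\<Sum>k. ennreal ((cmod (\<gamma> k * of_real (\<beta> k t \<omega>)))\<^sup>2)) < \<infinity> then W t \<omega> else 0)" for \<omega>
  have c: "cinner (e k) (Y \<omega>) = (if (\<Sum>k. ennreal ((cmod (\<gamma> k * of_real (\<beta> k t \<omega>)))\<^sup>2)) < \<infinity>
      then \<gamma> k * of_real (\<beta> k t \<omega>) else 0)" for k \<omega>
  proof (cases "(\<Sum>k. ennreal ((cmod (\<gamma> k * of_real (\<beta> k t \<omega>)))\<^sup>2)) < \<infinity>")
    case True
    then have "summable (\<lambda>k. (cmod (\<gamma> k * of_real (\<beta> k t \<omega>)))\<^sup>2)"
      by (intro summable_suminf_not_top) auto
    from orthonormal_sums(2)[OF complete_orthonormal_imp_orthonormal[OF onb] this] True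
    show ?thesis by (simp add: Y_def Q_wiener_def)
  qed (simp add: Y_def)
  have "Y \<in> borel_measurable M"
    by (rule iffD2[OF borel_measurable_L2_iff[OF onb]]) (unfold c, measurable)
  moreover have "AE \<omega> in M. W t \<omega> = Y \<omega>"
    using AE_summable[OF t]
  proof eventually_elim
    case (elim \<omega>)
    then show ?case by (simp add: Y_def suminf_ennreal2)
  qed
  ultimately show ?thesis by blast
qed

lemma AE_measurable_step_integral:
  assumes p: "\<And>i. i < m \<Longrightarrow> 0 \<le> p i \<and> p i \<le> p (Suc i)" and A: "\<And>i. i < m \<Longrightarrow> bounded_linear (A i)"
  shows "\<exists>Y\<in>borel_measurable M. AE \<omega> in M. step_integral m p A W \<omega> = Y \<omega>"
proof -
  have "\<forall>i. \<exists>Y. i \<le> m \<longrightarrow> 0 \<le> p i \<longrightarrow> Y \<in> borel_measurable M \<and> (AE \<omega> in M. W (p i) \<omega> = Y \<omega>)"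
    using AE_measurable_W by blast
  then obtain Y where "\<forall>i. i \<le> m \<longrightarrow> 0 \<le> p i \<longrightarrow> Y i \<in> borel_measurable M \<and> (AE \<omega> in M. W (p i) \<omega> = Y i \<omega>)"
    by metis
  then have Y: "Y i \<in> borel_measurable M" "AE \<omega> in M. W (p i) \<omega> = Y i \<omega>"
    "Y (Suc i) \<in> borel_measurable M" "AE \<omega> in M. W (p (Suc i)) \<omega> = Y (Suc i) \<omega>" if "i < m" for i
    using that p[OF that] by (auto intro: order_trans)
  define Z where "Z \<omega> = (\<Sum>i<m. A i (Y (Suc i) \<omega> - Y i \<omega>))" for \<omega>
  have "Z \<in> borel_measurable M"
    unfolding Z_def
  proof (rule borel_measurable_L2_sum[OF onb])
    fix i assume "i \<in> {..<m}"
    then show "(\<lambda>\<omega>. A i (Y (Suc i) \<omega> - Y i \<omega>)) \<in> borel_measurable M"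
      using Y by (intro borel_measurable_bounded_linear[OF A] borel_measurable_L2_diff[OF onb]) auto
  qed
  moreover have "AE \<omega> in M. \<forall>i\<in>{..<m}. W (p i) \<omega> = Y i \<omega> \<and> W (p (Suc i)) \<omega> = Y (Suc i) \<omega>"
    using Y by (intro AE_finite_allI) auto
  then have "AE \<omega> in M. step_integral m p A W \<omega> = Z \<omega>"
    by eventually_elim (simp add: step_integral_def Z_def)
  ultimately show ?thesis by blast
qed

lemma measurable_step_operator:
  fixes v :: "'d L2"
  shows "(\<lambda>s. step_operator m p A s v) \<in> borel_measurable borel"
  unfolding step_operator_def
  by (intro borel_measurable_L2_sum[OF onb] borel_measurable_bounded_linear[OF bounded_linear_scaleR_left]) simp

text \<open>\<open>has_wiener_integral\<close> supplies only some approximating step functions.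
  Passing through them, with the Ito inequality between two step integrals, and letting
  \<open>n\<close> tend to infinity permits any chosen partition; the factor 4 comes from splitting
  a square twice.\<close>

lemma wiener_integral_step_diff:
  assumes Z: "has_wiener_integral M \<gamma> e \<beta> \<Psi> t Z"
    and \<Psi>: "\<And>k. (\<lambda>s. \<Psi> s (\<gamma> k *\<^sub>C e k)) \<in> borel_measurable borel"
    and q: "q 0 = 0" "q l = t" "\<And>i. i < l \<Longrightarrow> q i \<le> q (Suc i)" and B: "\<And>i. i < l \<Longrightarrow> bounded_linear (B i)"
  shows "(\<integral>\<^sup>+\<omega>. ennreal ((norm (Z \<omega> - step_integral l q B W \<omega>))\<^sup>2) \<partial>M) \<le>
    4 * (\<integral>\<^sup>+s\<in>{0..t}. (\<Sum>k. ennreal ((norm (\<Psi> s (\<gamma> k *\<^sub>C e k) - step_operator l q B s (\<gamma> k *\<^sub>C e k)))\<^sup>2)) \<partial>lborel)"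
    (is "?L \<le> 4 * ?R")
proof -
  obtain m p A where pA': "\<forall>n. p n 0 = 0 \<and> p n (m n) = t \<and> (\<forall>i<m n. p n i \<le> p n (Suc i)) \<and> (\<forall>i. bounded_linear (A n i))"
    and lim1: "(\<lambda>n. \<integral>\<^sup>+s\<in>{0..t}. (\<Sum>k. ennreal ((norm (\<Psi> s (\<gamma> k *\<^sub>C e k) -
         step_operator (m n) (p n) (A n) s (\<gamma> k *\<^sub>C e k)))\<^sup>2)) \<partial>lborel) \<longlonglongrightarrow> 0" (is "?\<delta> \<longlonglongrightarrow> 0")
    and lim2: "(\<lambda>n. \<integral>\<^sup>+\<omega>. ennreal ((norm (Z \<omega> - step_integral (m n) (p n) (A n) W \<omega>))\<^sup>2) \<partial>M) \<longlonglongrightarrow> 0" (is "?\<epsilon> \<longlonglongrightarrow> 0")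
    using Z unfolding has_wiener_integral_def
    by (elim conjE exE) (rule that; assumption)
  have pA: "p n 0 = 0" "p n (m n) = t" "i < m n \<Longrightarrow> p n i \<le> p n (Suc i)" "bounded_linear (A n i)" for n i
    using pA' by auto
  have Zm: "Z \<in> borel_measurable M" using Z by (simp add: has_wiener_integral_def)
  have p0: "0 \<le> p n i \<and> p n i \<le> p n (Suc i)" if "i < m n" for n i
    using partition_bounds(1)[of "p n" "m n" i] pA that by auto
  have q0: "0 \<le> q i \<and> q i \<le> q (Suc i)" if "i < l" for i
    using partition_bounds(1)[of q l i] q that by auto
  let ?I = "\<lambda>n. step_integral (m n) (p n) (A n) W" and ?J = "step_integral l q B W"
  let ?o = "\<lambda>n k s. step_operator (m n) (p n) (A n) s (\<gamma> k *\<^sub>C e k)" and ?q = "\<lambda>k s. step_operator l q B s (\<gamma> k *\<^sub>C e k)"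
  have bound: "?L \<le> 2 * ?\<epsilon> n + 4 * ?\<delta> n + 4 * ?R" for n
  proof -
    obtain Y where Y: "Y \<in> borel_measurable M" "AE \<omega> in M. ?I n \<omega> = Y \<omega>"
      using AE_measurable_step_integral[of "m n" "p n" "A n"] p0 pA(4) by metis
    obtain Y' where Y': "Y' \<in> borel_measurable M" "AE \<omega> in M. ?J \<omega> = Y' \<omega>"
      using AE_measurable_step_integral[of l q B] q0 B by metis
    have "(\<lambda>\<omega>. Z \<omega> - Y \<omega>) \<in> borel_measurable M" "(\<lambda>\<omega>. Y \<omega> - Y' \<omega>) \<in> borel_measurable M"
      using Zm Y Y' by (auto intro: borel_measurable_L2_diff[OF onb])
    note [measurable] = measurable_compose[OF this(1) borel_measurable_norm] measurable_compose[OF this(2) borel_measurable_norm]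
    have "?L \<le> (\<integral>\<^sup>+\<omega>. 2 * ennreal ((norm (Z \<omega> - Y \<omega>))\<^sup>2) + 2 * ennreal ((norm (Y \<omega> - Y' \<omega>))\<^sup>2) \<partial>M)"
      using Y(2) Y'(2) by (intro nn_integral_mono_AE, eventually_elim) (simp add: ennreal_norm_diff_square_le)
    also have "\<dots> = 2 * (\<integral>\<^sup>+\<omega>. ennreal ((norm (Z \<omega> - Y \<omega>))\<^sup>2) \<partial>M) + 2 * (\<integral>\<^sup>+\<omega>. ennreal ((norm (Y \<omega> - Y' \<omega>))\<^sup>2) \<partial>M)"
      by (subst nn_integral_add) (auto simp: nn_integral_cmult)
    also have "(\<integral>\<^sup>+\<omega>. ennreal ((norm (Z \<omega> - Y \<omega>))\<^sup>2) \<partial>M) = ?\<epsilon> n"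
      using Y(2) by (intro nn_integral_cong_AE, eventually_elim) simp
    also have "(\<integral>\<^sup>+\<omega>. ennreal ((norm (Y \<omega> - Y' \<omega>))\<^sup>2) \<partial>M) = (\<integral>\<^sup>+\<omega>. ennreal ((norm (?I n \<omega> - ?J \<omega>))\<^sup>2) \<partial>M)"
      using Y(2) Y'(2) by (intro nn_integral_cong_AE, eventually_elim) simp
    finally have a: "?L \<le> 2 * ?\<epsilon> n + 2 * (\<integral>\<^sup>+\<omega>. ennreal ((norm (?I n \<omega> - ?J \<omega>))\<^sup>2) \<partial>M)" .
    have "(\<integral>\<^sup>+\<omega>. ennreal ((norm (?I n \<omega> - ?J \<omega>))\<^sup>2) \<partial>M) \<le> (\<integral>\<^sup>+s. (\<Sum>k. ennreal ((norm (?o n k s - ?q k s))\<^sup>2)) \<partial>lborel)"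
      by (rule Ito_inequality_step_diff) (use p0 q0 pA(4) B in auto)
    also have "\<dots> \<le> (\<integral>\<^sup>+s. 2 * ((\<Sum>k. ennreal ((norm (\<Psi> s (\<gamma> k *\<^sub>C e k) - ?o n k s))\<^sup>2)) * indicator {0..t} s) +
        2 * ((\<Sum>k. ennreal ((norm (\<Psi> s (\<gamma> k *\<^sub>C e k) - ?q k s))\<^sup>2)) * indicator {0..t} s) \<partial>lborel)"
    proof (rule nn_integral_mono)
      fix s
      show "(\<Sum>k. ennreal ((norm (?o n k s - ?q k s))\<^sup>2)) \<le> 2 * ((\<Sum>k. ennreal ((norm (\<Psi> s (\<gamma> k *\<^sub>C e k) - ?o n k s))\<^sup>2)) * indicator {0..t} s) +
        2 * ((\<Sum>k. ennreal ((norm (\<Psi> s (\<gamma> k *\<^sub>C e k) - ?q k s))\<^sup>2)) * indicator {0..t} s)"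
      \<comment> \<open>The Ito inequality integrates over the whole line, but both step operators
        vanish outside the interval.\<close>
      proof (cases "s \<in> {0..t}")
        case True
        have "(\<Sum>k. ennreal ((norm (?o n k s - ?q k s))\<^sup>2)) \<le>
            (\<Sum>k. 2 * ennreal ((norm (\<Psi> s (\<gamma> k *\<^sub>C e k) - ?o n k s))\<^sup>2) + 2 * ennreal ((norm (\<Psi> s (\<gamma> k *\<^sub>C e k) - ?q k s))\<^sup>2))"
          by (intro suminf_le summableI) (metis ennreal_norm_diff_square_le norm_minus_commute)
        then show ?thesis using True by (simp add: suminf_add[symmetric] summableI)
      next
        case False
        then have "?o n k s = 0" "?q k s = 0" for k
          using step_operator_outside[of "p n" "m n" s] step_operator_outside[of q l s] pA q by auto
        then show ?thesis by simp
      qed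
    qed
    also have "\<dots> = 2 * ?\<delta> n + 2 * ?R"
    proof -
      have [measurable]: "(\<lambda>s. norm (\<Psi> s (\<gamma> k *\<^sub>C e k) - step_operator m p A s (\<gamma> k *\<^sub>C e k))) \<in> borel_measurable borel"
        for k m p A
        by (intro measurable_compose[OF borel_measurable_L2_diff[OF onb \<Psi> measurable_step_operator] borel_measurable_norm])
      show ?thesis by (subst nn_integral_add) (auto simp: nn_integral_cmult)
    qed
    finally have b: "(\<integral>\<^sup>+\<omega>. ennreal ((norm (?I n \<omega> - ?J \<omega>))\<^sup>2) \<partial>M) \<le> 2 * ?\<delta> n + 2 * ?R" .
    have eq: "2 * x + 2 * (2 * y + 2 * z) = 2 * x + 4 * y + 4 * z" for x y z :: ennreal
      by (simp add: distrib_left mult.assoc[symmetric] add.assoc)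
    show ?thesis
      by (rule order_trans[OF a]) (unfold eq[symmetric], intro add_left_mono mult_left_mono b, simp)
  qed
  have lim: "(\<lambda>n. 2 * ?\<epsilon> n + 4 * ?\<delta> n + 4 * ?R) \<longlonglongrightarrow> 2 * 0 + 4 * 0 + 4 * ?R"
    by (intro tendsto_add ennreal_tendsto_cmult lim1 lim2 tendsto_const) auto
  have "?L \<le> 2 * 0 + 4 * 0 + 4 * ?R"
    by (rule LIMSEQ_le_const[OF lim], rule exI[of _ 0], intro allI impI, rule bound)
  then show ?thesis by simp
qed

end

section \<open>Truncation, Gronwall and Riemann sums\<close>

definition radial_proj :: "real \<Rightarrow> 'a::real_normed_vector \<Rightarrow> 'a" where
  "radial_proj R w = (min 1 (R / norm w)) *\<^sub>R w"

lemma radial_proj_inside: "norm w \<le> R \<Longrightarrow> radial_proj R w = w"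
  by (cases "w = 0") (auto simp: radial_proj_def min_def field_simps)

lemma norm_radial_proj_le: "0 < R \<Longrightarrow> norm (radial_proj R w) \<le> R"
  by (cases "w = 0") (auto simp: radial_proj_def min_def field_simps)

text \<open>With the larger vector called \<open>u\<close>, the difference splits into
  \<open>a (u - v)\<close> and \<open>(a - b) v\<close>, each of norm at most
  \<open>norm (u - v)\<close>; hence the factor 2.\<close>

lemma radial_proj_Lipschitz:
  assumes R: "0 < R"
  shows "norm (radial_proj R u - radial_proj R v) \<le> 2 * norm (u - v)"
proof -
  have *: "norm (radial_proj R u - radial_proj R v) \<le> 2 * norm (u - v)" if uv: "norm v \<le> norm u" for u v :: 'a
  proof (cases "norm u \<le> R")
    case True
    then show ?thesis using uv by (simp add: radial_proj_inside)
  next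
    case False
    define a where "a = R / norm u"
    have u0: "0 < norm u" "R < norm u" using False R by linarith+
    then have a: "0 < a" "a < 1" using R by (simp_all add: a_def del: zero_less_norm_iff)
    then have "radial_proj R u = a *\<^sub>R u" by (simp add: a_def radial_proj_def)
    note a = a this
    define b where "b = min 1 (R / norm v)"
    have b: "radial_proj R v = b *\<^sub>R v" by (simp add: b_def radial_proj_def)
    have diff: "norm u - norm v \<le> norm (u - v)" by (rule norm_triangle_ineq2)
    have "\<bar>a - b\<bar> * norm v \<le> norm u - norm v"
    proof (cases "norm v \<le> R")
      case True
      have "(norm u - R) * norm v \<le> (norm u - norm v) * norm v"
        using True by (intro mult_right_mono) auto
      also have "\<dots> \<le> (norm u - norm v) * norm u" using uv by (intro mult_left_mono) auto
      finally have 2: "(1 - a) * norm v \<le> norm u - norm v" using u0 by (simp add: a_def field_simps)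
      have "v = 0 \<or> b = 1" using True by (auto simp: b_def min_def field_simps)
      then show ?thesis using 2 a uv by auto
    next
      case v: False
      then have v0: "0 < norm v" "R < norm v" using R by linarith+
      then have "R / norm v < 1" using R by (simp del: zero_less_norm_iff)
      then have "b = R / norm v" by (simp add: b_def)
      moreover have "R / norm u \<le> R / norm v" using uv v R by (intro divide_left_mono mult_pos_pos) auto
      ultimately have "\<bar>a - b\<bar> * norm v = R - a * norm v" using v R by (auto simp: a_def left_diff_distrib)
      also have "\<dots> = a * (norm u - norm v)" using u0 R by (simp add: a_def right_diff_distrib)
      also have "\<dots> \<le> 1 * (norm u - norm v)" using a uv by (intro mult_right_mono) auto
      finally show ?thesis by simp
    qed
    moreover have "radial_proj R u - radial_proj R v = a *\<^sub>R (u - v) + (a - b) *\<^sub>R v"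
      unfolding a(3) b by (simp add: algebra_simps)
    then have "norm (radial_proj R u - radial_proj R v) \<le> a * norm (u - v) + \<bar>a - b\<bar> * norm v"
      using norm_triangle_ineq[of "a *\<^sub>R (u - v)" "(a - b) *\<^sub>R v"] a by simp
    moreover have "a * norm (u - v) \<le> 1 * norm (u - v)" using a by (intro mult_right_mono) auto
    ultimately show ?thesis using diff by linarith
  qed
  show ?thesis
    using *[of v u] *[of u v] by (cases "norm v \<le> norm u") (auto simp: norm_minus_commute)
qed

text \<open>The cut-off acts only inside \<open>F\<close>. Since the projection is a real multiple
  of \<open>w\<close>, the increment stays orthogonal to \<open>w\<close> in the real inner
  product.\<close>

definition truncated_euler :: "('d::finite L2 \<Rightarrow> 'd L2) \<Rightarrow> real \<Rightarrow> real \<Rightarrow> 'd L2 \<Rightarrow> 'd L2" where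
  "truncated_euler F R h w = w - (\<i> * of_real h) *\<^sub>C F (radial_proj R w)"

text \<open>On the ball of radius \<open>R\<close> the local Lipschitz factor is bounded by a
  constant, and the projection maps everything into that ball; \<open>F 0 = 0\<close> then gives
  boundedness.\<close>

lemma truncated_nonlinearity:
  fixes F :: "'d::finite L2 \<Rightarrow> 'd L2"
  assumes N: "nonlinearity V F" and R: "0 < R"
  obtains L where "0 \<le> L" "\<And>u w. norm (F (radial_proj R u) - F (radial_proj R w)) \<le> L * norm (u - w)"
    "\<And>w. norm (F (radial_proj R w)) \<le> L * R"
proof -
  obtain C K where CK: "0 < C" "0 < K"
    "\<And>u w. norm (F u - F w) \<le> (C + K * ((norm w)\<^sup>2 + (norm u)\<^sup>2)) * norm (u - w)"
    using N unfolding nonlinearity_def by blast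
  define l where "l = C + K * (R\<^sup>2 + R\<^sup>2)"
  have l: "0 \<le> l" using CK by (simp add: l_def)
  have p: "(norm (radial_proj R w))\<^sup>2 \<le> R\<^sup>2" for w :: "'d L2"
    using norm_radial_proj_le[OF R, of w] by (intro power_mono) auto
  have le: "norm (F (radial_proj R u) - F (radial_proj R w)) \<le> l * norm (radial_proj R u - radial_proj R w)" for u w
  proof -
    have "(C + K * ((norm (radial_proj R w))\<^sup>2 + (norm (radial_proj R u))\<^sup>2)) \<le> l"
      unfolding l_def using CK p by (intro add_left_mono mult_left_mono add_mono) auto
    then show ?thesis using CK(3) by (meson mult_right_mono norm_ge_zero order_trans)
  qed
  show ?thesis
  proof (rule that[of "2 * l"])
    fix u w :: "'d L2"
    have "l * norm (radial_proj R u - radial_proj R w) \<le> l * (2 * norm (u - w))"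
      using l radial_proj_Lipschitz[OF R] by (intro mult_left_mono) auto
    then show "norm (F (radial_proj R u) - F (radial_proj R w)) \<le> 2 * l * norm (u - w)"
      using le[of u w] by simp
    have "norm (F (radial_proj R w)) \<le> l * norm (radial_proj R w)"
      using le[of w 0] nonlinearity_zero[OF N] R by (simp add: radial_proj_inside)
    also have "\<dots> \<le> 2 * l * R" using l norm_radial_proj_le[OF R, of w] by (intro mult_mono) auto
    finally show "norm (F (radial_proj R w)) \<le> 2 * l * R" .
  qed (use l in simp)
qed

lemma continuous_truncated_euler:
  fixes F :: "'d::finite L2 \<Rightarrow> 'd L2"
  assumes N: "nonlinearity V F" and R: "0 < R"
  shows "continuous_on UNIV (truncated_euler F R h)"
proof -
  obtain L where L: "0 \<le> L" "\<And>u w. norm (F (radial_proj R u) - F (radial_proj R w)) \<le> L * norm (u - w)"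
    by (rule truncated_nonlinearity[OF N R]) blast
  have "L-lipschitz_on UNIV (\<lambda>w. F (radial_proj R w))"
    by (rule lipschitz_onI) (use L in \<open>auto simp: dist_norm\<close>)
  from lipschitz_on_continuous_on[OF this] show ?thesis
    unfolding truncated_euler_def by (intro continuous_intros)
qed

text \<open>Pythagoras, because \<open>inner w (\<i> h F)\<close> vanishes by
  \<open>Im_cinner_nonlinearity\<close>. Over \<open>t / h\<close> steps the excess of order
  \<open>h^2\<close> adds up to order \<open>h\<close>.\<close>

lemma norm_truncated_euler:
  fixes F :: "'d::finite L2 \<Rightarrow> 'd L2"
  assumes N: "nonlinearity V F" and R: "0 < R"
  shows "(norm (truncated_euler F R h w))\<^sup>2 = (norm w)\<^sup>2 + h\<^sup>2 * (norm (F (radial_proj R w)))\<^sup>2"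
proof -
  let ?X = "(\<i> * of_real h) *\<^sub>C F (radial_proj R w)"
  have "Im (cinner w (F (radial_proj R w))) = 0"
  proof (cases "w = 0")
    case False
    define c where "c = min 1 (R / norm w)"
    have c: "0 < c" using False R by (simp add: c_def)
    have "cinner (radial_proj R w) (F (radial_proj R w)) = of_real c * cinner w (F (radial_proj R w))"
      by (simp add: radial_proj_def c_def[symmetric] scaleR_L2_def cinner_scaleC_left)
    then show ?thesis using Im_cinner_nonlinearity[OF N, of "radial_proj R w"] c by simp
  qed (simp add: cinner_commute[of 0])
  then have "inner w ?X = 0" by (simp add: inner_L2_def cinner_scaleC_right)
  then show ?thesis
    unfolding truncated_euler_def
    by (simp add: power2_norm_eq_inner inner_diff inner_commute)
       (simp add: power2_norm_eq_inner[symmetric] norm_scaleC norm_mult power_mult_distrib)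
qed

text \<open>The induction bounds the partial sums of \<open>d\<close>, which grow by the factor
  \<open>1 + c\<close> per step up to the source \<open>\<rho>\<close>.\<close>

lemma discrete_Gronwall:
  fixes d \<rho> :: "nat \<Rightarrow> real"
  assumes "0 \<le> c" and d: "\<And>n. n \<le> N \<Longrightarrow> d n \<le> \<rho> n + c * (\<Sum>i<n. d i)" and \<rho>: "\<And>n. n \<le> N \<Longrightarrow> 0 \<le> \<rho> n"
  shows "d N \<le> \<rho> N + c * exp (c * real N) * (\<Sum>i<N. \<rho> i)"
proof -
  have "(\<Sum>i<n. d i) \<le> (1 + c)^n * (\<Sum>i<n. \<rho> i)" if "n \<le> N" for n
    using that
  proof (induct n)
    case (Suc n)
    have "(\<Sum>i<Suc n. d i) \<le> (1 + c) * (\<Sum>i<n. d i) + \<rho> n" using d[of n] Suc(2) by (simp add: algebra_simps)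
    also have "\<dots> \<le> (1 + c) * ((1 + c)^n * (\<Sum>i<n. \<rho> i)) + \<rho> n"
      using Suc assms(1) by (intro add_right_mono mult_left_mono) auto
    also have "\<dots> \<le> (1 + c) * ((1 + c)^n * (\<Sum>i<n. \<rho> i)) + (1 + c)^Suc n * \<rho> n"
    proof -
      have "1 * \<rho> n \<le> (1 + c)^Suc n * \<rho> n"
        using assms(1) \<rho>[of n] Suc(2) by (intro mult_right_mono one_le_power) auto
      then show ?thesis by simp
    qed
    finally show ?case by (simp add: algebra_simps)
  qed simp
  from this[of N] have "(\<Sum>i<N. d i) \<le> (1 + c)^N * (\<Sum>i<N. \<rho> i)" by simp
  also have "\<dots> \<le> exp c ^ N * (\<Sum>i<N. \<rho> i)"
    using assms(1) \<rho> by (intro mult_right_mono power_mono exp_ge_add_one_self sum_nonneg) auto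
  also have "exp c ^ N = exp (c * real N)" by (simp add: exp_of_nat_mult[symmetric] mult.commute)
  finally have "c * (\<Sum>i<N. d i) \<le> c * (exp (c * real N) * (\<Sum>i<N. \<rho> i))"
    using assms(1) by (intro mult_left_mono)
  then show ?thesis using d[of N] by simp
qed

text \<open>Uniformity over all \<open>n \<le> N\<close> is what the Gronwall argument requires; it
  follows from uniform continuity of \<open>(a, s)\<close> to \<open>S(a) G(s)\<close> on a compact
  square.\<close>

lemma Riemann_sum_convolution:
  fixes G :: "real \<Rightarrow> 'd::finite L2"
  assumes G: "continuous_on {0..t} G" and t: "0 < t" and \<epsilon>: "0 < \<epsilon>"
  shows "\<exists>N0. \<forall>N\<ge>N0. \<forall>n\<le>N.
    norm (integral {0..real n * (t / real N)} (\<lambda>s. free_group (real n * (t / real N) - s) (G s)) -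
      (\<Sum>i<n. (t / real N) *\<^sub>R free_group (real n * (t / real N) - real i * (t / real N)) (G (real i * (t / real N))))) \<le> \<epsilon>"
proof -
  have "continuous_on ({0..t} \<times> {0..t}) (\<lambda>x. free_group (fst x) (G (snd x)))"
    by (intro continuous_on_free_group continuous_intros continuous_on_compose2[OF G]) auto
  then have "uniformly_continuous_on ({0..t} \<times> {0..t}) (\<lambda>x. free_group (fst x) (G (snd x)))"
    by (rule compact_uniformly_continuous) (intro compact_Times compact_Icc)
  then obtain d where d: "0 < d" "\<And>x y. x \<in> {0..t} \<times> {0..t} \<Longrightarrow> y \<in> {0..t} \<times> {0..t} \<Longrightarrow> dist y x < d \<Longrightarrow>
      dist (free_group (fst y) (G (snd y))) (free_group (fst x) (G (snd x))) < \<epsilon> / t"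
    using \<epsilon> t unfolding uniformly_continuous_on_def by (metis divide_pos_pos)
  \<comment> \<open>Within a cell both entries of \<open>(r - s, s)\<close> move by at most
    \<open>h = t / N\<close>, so their distance is at most \<open>2 h\<close>, which has to stay
    below \<open>d\<close>.\<close>
  obtain N0 :: nat where N0: "2 * t / d < real N0" using reals_Archimedean2 by blast
  show ?thesis
  proof (intro exI[of _ "Suc N0"] allI impI)
    fix N n assume N: "Suc N0 \<le> N" and n: "n \<le> N"
    define h where "h = t / real N"
    have Np: "0 < real N" using N by simp
    have h: "0 < h" using t Np by (simp add: h_def)
    have "2 * t / d < real N" using N N0 by linarith
    then have hd: "2 * h < d" using d(1) Np by (simp add: h_def field_simps)
    define r where "r = real n * h"
    have "real n * h \<le> real N * h" using n h by (intro mult_right_mono) auto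
    then have r: "r \<le> t" using Np by (simp add: r_def h_def)
    have "0 \<le> r" using h by (simp add: r_def)
    note r = this r
    have cont: "continuous_on {0..r} (\<lambda>s. free_group (r - s) (G s))"
      using r by (intro continuous_on_free_group continuous_intros continuous_on_subset[OF G]) auto
    have "norm (integral {0..real k * h} (\<lambda>s. free_group (r - s) (G s)) -
        (\<Sum>i<k. h *\<^sub>R free_group (r - real i * h) (G (real i * h)))) \<le> real k * (h * (\<epsilon> / t))" if "k \<le> n" for k
      using that
    proof (induct k)
      case (Suc k)
      let ?f = "\<lambda>s. free_group (r - s) (G s)"
      define a b where "a = real k * h" and "b = real (Suc k) * h"
      have "real (Suc k) * h \<le> r" using Suc(2) h unfolding r_def by (intro mult_right_mono) auto
      then have ab: "0 \<le> a" "a \<le> b" "b \<le> r" "b = a + h" using h by (auto simp: a_def b_def algebra_simps)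
      have c0: "continuous_on {0..b} ?f" using ab by (intro continuous_on_subset[OF cont]) auto
      have c1: "continuous_on {a..b} ?f" using ab by (intro continuous_on_subset[OF cont]) auto
      have split: "integral {0..a} ?f + integral {a..b} ?f = integral {0..b} ?f"
        using ab by (intro Henstock_Kurzweil_Integration.integral_combine integrable_continuous_real c0) auto
      have "integral {a..b} (\<lambda>s. ?f s - ?f a) = integral {a..b} ?f - integral {a..b} (\<lambda>s. ?f a)"
        using c1 by (intro integral_diff integrable_continuous_real) auto
      also have "integral {a..b} (\<lambda>s. ?f a) = h *\<^sub>R ?f a" using ab by simp
      finally have diff: "integral {a..b} ?f - h *\<^sub>R ?f a = integral {a..b} (\<lambda>s. ?f s - ?f a)" by simp
      have "norm (integral {a..b} (\<lambda>s. ?f s - ?f a)) \<le> \<epsilon> / t * (b - a)"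
      proof (rule integral_bound)
        show "continuous_on {a..b} (\<lambda>s. ?f s - ?f a)" using c1 by (intro continuous_intros)
        fix s assume s: "s \<in> {a..b}"
        have "dist (r - s, s) (r - a, a) \<le> dist (r - s) (r - a) + dist s a"
          unfolding dist_Pair_Pair by (rule sqrt_sum_squares_le_sum) auto
        also have "\<dots> \<le> 2 * h" using s ab by (simp add: dist_real_def)
        finally have "dist (r - s, s) (r - a, a) < d" using hd by simp
        then have "dist (free_group (fst (r - s, s)) (G (snd (r - s, s)))) (free_group (fst (r - a, a)) (G (snd (r - a, a)))) < \<epsilon> / t"
          using s ab r by (intro d(2)) auto
        then show "norm (?f s - ?f a) \<le> \<epsilon> / t" by (simp add: dist_norm)
      qed (use ab in auto)
      also have "\<epsilon> / t * (b - a) = h * (\<epsilon> / t)" using ab by simp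
      finally have last: "norm (integral {a..b} ?f - h *\<^sub>R ?f a) \<le> h * (\<epsilon> / t)" unfolding diff .
      have "integral {0..b} ?f - (\<Sum>i<Suc k. h *\<^sub>R ?f (real i * h)) =
        (integral {0..a} ?f - (\<Sum>i<k. h *\<^sub>R ?f (real i * h))) + (integral {a..b} ?f - h *\<^sub>R ?f a)"
        unfolding split[symmetric] by (simp add: a_def)
      also have "norm \<dots> \<le> real k * (h * (\<epsilon> / t)) + h * (\<epsilon> / t)"
        using Suc last by (intro norm_triangle_le add_mono) (auto simp: a_def)
      also have "\<dots> = real (Suc k) * (h * (\<epsilon> / t))" by (simp only: of_nat_Suc distrib_right mult_1_left add.commute)
      finally show ?case unfolding b_def .
    qed simp
    from this[OF order_refl] have "norm (integral {0..r} (\<lambda>s. free_group (r - s) (G s)) -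
        (\<Sum>i<n. h *\<^sub>R free_group (r - real i * h) (G (real i * h)))) \<le> real n * (h * (\<epsilon> / t))"
      by (simp add: r_def)
    also have "\<dots> = r * (\<epsilon> / t)" by (simp add: r_def)
    also have "\<dots> \<le> t * (\<epsilon> / t)" using r \<epsilon> t by (intro mult_right_mono) auto
    also have "\<dots> = \<epsilon>" using t by simp
    finally show "norm (integral {0..real n * (t / real N)} (\<lambda>s. free_group (real n * (t / real N) - s) (G s)) -
      (\<Sum>i<n. (t / real N) *\<^sub>R free_group (real n * (t / real N) - real i * (t / real N)) (G (real i * (t / real N))))) \<le> \<epsilon>"
      unfolding r_def h_def .
  qed
qed

section \<open>Discrete stochastic convolutions\<close>

text \<open>The series of the \<open>f j\<close> has finite expectation, so it converges almost
  surely and its terms vanish.\<close>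

lemma AE_tendsto_zero:
  fixes f :: "nat \<Rightarrow> 'a \<Rightarrow> real"
  assumes f: "\<And>j. f j \<in> borel_measurable M" "\<And>j \<omega>. 0 \<le> f j \<omega>"
    and int: "\<And>j. (\<integral>\<^sup>+\<omega>. ennreal (f j \<omega>) \<partial>M) \<le> ennreal ((1/2)^j)"
  shows "AE \<omega> in M. (\<lambda>j. f j \<omega>) \<longlonglongrightarrow> 0"
proof -
  have "(\<integral>\<^sup>+\<omega>. (\<Sum>j. ennreal (f j \<omega>)) \<partial>M) = (\<Sum>j. \<integral>\<^sup>+\<omega>. ennreal (f j \<omega>) \<partial>M)"
    using f by (intro nn_integral_suminf) auto
  also have "\<dots> \<le> (\<Sum>j. ennreal ((1/2)^j))" by (intro suminf_le int summableI)
  also have "\<dots> = ennreal (\<Sum>j. (1/2)^j)" by (intro suminf_ennreal2 summable_geometric) auto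
  also have "\<dots> < \<infinity>" by simp
  finally have "(\<integral>\<^sup>+\<omega>. (\<Sum>j. ennreal (f j \<omega>)) \<partial>M) \<noteq> \<infinity>" by simp
  then have "AE \<omega> in M. (\<Sum>j. ennreal (f j \<omega>)) \<noteq> \<infinity>"
    using f by (intro nn_integral_PInf_AE) auto
  then show ?thesis
    by eventually_elim (use f(2) in \<open>auto intro!: summable_LIMSEQ_zero summable_suminf_not_top\<close>)
qed

lemma partition_cell:
  fixes s h :: real
  assumes "0 < s" "s \<le> real n * h"
  shows "\<exists>i<n. real i * h < s \<and> s \<le> real (Suc i) * h"
  using assms(2)
proof (induct n)
  case (Suc n)
  then show ?case by (cases "s \<le> real n * h") (auto intro: less_SucI)
qed (use assms(1) in simp)

lemma step_operator_cell:
  assumes h: "0 < h" and i: "i < n" "real i * h < s" "s \<le> real (Suc i) * h"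
  shows "step_operator n (\<lambda>i. real i * h) A s v = A i v"
proof -
  have "step_operator n (\<lambda>i. real i * h) A s v = indicator {real i * h<..real (Suc i) * h} s *\<^sub>R A i v +
      (\<Sum>j\<in>{..<n} - {i}. indicator {real j * h<..real (Suc j) * h} s *\<^sub>R A j v)"
    unfolding step_operator_def using i by (intro sum.remove) auto
  also have "(\<Sum>j\<in>{..<n} - {i}. indicator {real j * h<..real (Suc j) * h} s *\<^sub>R A j v) = 0"
  proof (rule sum.neutral, rule ballI)
      fix j assume "j \<in> {..<n} - {i}"
      then consider "Suc j \<le> i" | "Suc i \<le> j" by fastforce
      then have "s \<notin> {real j * h<..real (Suc j) * h}"
      proof cases
        case 1
        then have "real (Suc j) * h \<le> real i * h" using h by (intro mult_right_mono) auto
        then show ?thesis using i by auto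
      next
        case 2
        then have "real (Suc i) * h \<le> real j * h" using h by (intro mult_right_mono) auto
        then show ?thesis using i by auto
      qed
      then show "indicator {real j * h<..real (Suc j) * h} s *\<^sub>R A j v = 0" by simp
  qed
  finally show ?thesis using i by simp
qed

context Q_wiener_noise
begin

text \<open>The sum depends on \<open>a - b\<close> alone up to an inequality. As a function of that
  shift it is a uniformly convergent series with majorant \<open>4 (cmod (\<gamma> k))^2\<close>,
  hence continuous and zero at 0.\<close>

lemma noise_equicontinuous:
  assumes \<epsilon>: "0 < \<epsilon>"
  shows "\<exists>d>0. \<forall>a b. \<bar>a - b\<bar> \<le> d \<longrightarrow>
    (\<Sum>k. ennreal ((norm (free_group a (\<gamma> k *\<^sub>C e k) - free_group b (\<gamma> k *\<^sub>C e k)))\<^sup>2)) \<le> ennreal \<epsilon>"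
proof -
  define f where "f k r = (norm (free_group r (\<gamma> k *\<^sub>C e k) - free_group 0 (\<gamma> k *\<^sub>C e k)))\<^sup>2" for k r
  have f0: "0 \<le> f k r" for k r by (simp add: f_def)
  have fle: "f k r \<le> 4 * (cmod (\<gamma> k))\<^sup>2" for k r
  proof -
    have "norm (\<gamma> k *\<^sub>C e k) = cmod (\<gamma> k)"
      using norm_orthonormal[OF complete_orthonormal_imp_orthonormal[OF onb], of k] by (simp add: norm_scaleC)
    then have "norm (free_group r (\<gamma> k *\<^sub>C e k) - free_group 0 (\<gamma> k *\<^sub>C e k)) \<le> 2 * cmod (\<gamma> k)"
      using norm_triangle_ineq4[of "free_group r (\<gamma> k *\<^sub>C e k)" "free_group 0 (\<gamma> k *\<^sub>C e k)"]
        norm_free_group_le[of r "\<gamma> k *\<^sub>C e k"] norm_free_group_le[of 0 "\<gamma> k *\<^sub>C e k"] by linarith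
    then have "f k r \<le> (2 * cmod (\<gamma> k))\<^sup>2" unfolding f_def by (intro power_mono) auto
    then show ?thesis by (simp add: power_mult_distrib)
  qed
  have sum4: "summable (\<lambda>k. 4 * (cmod (\<gamma> k))\<^sup>2)" using \<gamma> by (intro summable_mult)
  have sf: "summable (\<lambda>k. f k r)" for r
    by (rule summable_comparison_test[OF _ sum4]) (use fle f0 in auto)
  have "uniform_limit UNIV (\<lambda>n r. \<Sum>k<n. f k r) (\<lambda>r. \<Sum>k. f k r) sequentially"
    by (rule Weierstrass_m_test[OF _ sum4]) (use fle f0 in auto)
  then have "continuous_on UNIV (\<lambda>r. \<Sum>k. f k r)"
    by (rule uniform_limit_theorem[rotated])
       (auto simp: f_def intro!: always_eventually continuous_intros continuous_on_free_group_time)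
  then have "isCont (\<lambda>r. \<Sum>k. f k r) 0" by (simp add: continuous_on_eq_continuous_at)
  then have "((\<lambda>r. \<Sum>k. f k r) \<longlongrightarrow> 0) (at 0)" by (simp add: isCont_def f_def)
  then obtain d where d: "0 < d" "\<And>r. r \<noteq> 0 \<Longrightarrow> \<bar>r\<bar> < d \<Longrightarrow> (\<Sum>k. f k r) < \<epsilon>"
    using \<epsilon> unfolding LIM_def dist_real_def by (metis abs_less_iff diff_zero)
  have "(\<Sum>k. ennreal ((norm (free_group a (\<gamma> k *\<^sub>C e k) - free_group b (\<gamma> k *\<^sub>C e k)))\<^sup>2)) \<le> ennreal \<epsilon>"
    if "\<bar>a - b\<bar> \<le> d / 2" for a b
  proof -
    have "(\<Sum>k. ennreal ((norm (free_group a (\<gamma> k *\<^sub>C e k) - free_group b (\<gamma> k *\<^sub>C e k)))\<^sup>2)) \<le> (\<Sum>k. ennreal (f k (a - b)))"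
      unfolding f_def by (intro suminf_le summableI ennreal_leI power_mono norm_free_group_time_diff_le norm_ge_zero)
    also have "\<dots> = ennreal (\<Sum>k. f k (a - b))" by (intro suminf_ennreal2 f0 sf)
    also have "\<dots> \<le> ennreal \<epsilon>"
    proof (cases "a - b = 0")
      case True
      then show ?thesis by (simp add: f_def)
    next
      case False
      then show ?thesis using d(2)[of "a - b"] that d(1) by (intro ennreal_leI) auto
    qed
    finally show ?thesis .
  qed
  then show ?thesis using d(1) by (intro exI[of _ "d / 2"]) auto
qed

text \<open>The stochastic convolution at time \<open>n h\<close> with its kernel frozen at left end
  points: precisely the noise term obtained by unrolling the scheme.\<close>

definition discrete_convolution :: "real \<Rightarrow> nat \<Rightarrow> 'w \<Rightarrow> 'd L2" where
  "discrete_convolution h n =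
     step_integral n (\<lambda>i. real i * h) (\<lambda>i. free_group (real n * h - real i * h)) W"

lemma discrete_convolution_error:
  assumes h: "0 < h" and Z: "has_wiener_integral M \<gamma> e \<beta> (\<lambda>s. free_group (real n * h - s)) (real n * h) Z"
    and \<delta>: "0 \<le> \<delta>" "\<And>a b. \<bar>a - b\<bar> \<le> h \<Longrightarrow>
      (\<Sum>k. ennreal ((norm (free_group a (\<gamma> k *\<^sub>C e k) - free_group b (\<gamma> k *\<^sub>C e k)))\<^sup>2)) \<le> ennreal \<delta>"
  shows "(\<integral>\<^sup>+\<omega>. ennreal ((norm (Z \<omega> - discrete_convolution h n \<omega>))\<^sup>2) \<partial>M) \<le> ennreal (4 * \<delta> * (real n * h))"
proof -
  let ?t = "real n * h"
  let ?B = "\<lambda>i. free_group (?t - real i * h) :: 'd L2 \<Rightarrow> 'd L2"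
  have t: "0 \<le> ?t" using h by simp
  have cont: "continuous_on UNIV (\<lambda>s. free_group (?t - s) v)" for v :: "'d L2"
    by (intro continuous_on_free_group continuous_intros)
  have "(\<integral>\<^sup>+\<omega>. ennreal ((norm (Z \<omega> - discrete_convolution h n \<omega>))\<^sup>2) \<partial>M) \<le>
    4 * (\<integral>\<^sup>+s\<in>{0..?t}. (\<Sum>k. ennreal ((norm (free_group (?t - s) (\<gamma> k *\<^sub>C e k) -
       step_operator n (\<lambda>i. real i * h) ?B s (\<gamma> k *\<^sub>C e k)))\<^sup>2)) \<partial>lborel)"
    unfolding discrete_convolution_def
    by (rule wiener_integral_step_diff[OF Z])
       (use h in \<open>auto intro!: borel_measurable_continuous_onI cont bounded_linear_free_group\<close>)
  also have "(\<integral>\<^sup>+s\<in>{0..?t}. (\<Sum>k. ennreal ((norm (free_group (?t - s) (\<gamma> k *\<^sub>C e k) -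
       step_operator n (\<lambda>i. real i * h) ?B s (\<gamma> k *\<^sub>C e k)))\<^sup>2)) \<partial>lborel) \<le>
      (\<integral>\<^sup>+s. ennreal \<delta> * indicator {0..?t} s \<partial>lborel)"
  \<comment> \<open>The half-open cells cover the interval except for the point 0, which is a null
    set.\<close>
  proof (rule nn_integral_mono_AE, use AE_lborel_singleton[of "0::real"] in eventually_elim)
    case (elim s)
    show ?case
    proof (cases "s \<in> {0..?t}")
      case True
      then have "0 < s" "s \<le> ?t" using elim by auto
      from partition_cell[OF this] obtain i where i: "i < n" "real i * h < s" "s \<le> real (Suc i) * h" by blast
      have "\<bar>(?t - s) - (?t - real i * h)\<bar> \<le> h" using i by (simp add: algebra_simps)
      from \<delta>(2)[OF this] show ?thesis using True step_operator_cell[OF h i, of ?B] by simp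
    qed simp
  qed
  also have "(\<integral>\<^sup>+s. ennreal \<delta> * indicator {0..?t} s \<partial>lborel) = ennreal (\<delta> * ?t)"
    using t \<delta>(1) by (simp add: nn_integral_cmult ennreal_mult[symmetric])
  also have "4 * ennreal (\<delta> * ?t) = ennreal (4 * \<delta> * ?t)"
    using t \<delta>(1) by (simp add: ennreal_mult mult.assoc)
  finally show ?thesis by (simp add: mult_left_mono)
qed

lemma AE_measurable_discrete_convolution:
  assumes "0 < h"
  shows "\<exists>Y\<in>borel_measurable M. AE \<omega> in M. discrete_convolution h n \<omega> = Y \<omega>"
  unfolding discrete_convolution_def
  using assms by (intro AE_measurable_step_integral bounded_linear_free_group) auto

text \<open>The weights match what the pathwise Gronwall estimate consumes: a time average of the
  squared errors, with weight \<open>h\<close>, and the final error, with weight 1. They add up to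
  \<open>t + 1\<close>, so errors of order \<open>(1/2)^j / (t + 1)\<close> in mean square make the
  expectations summable.\<close>

lemma discrete_convolution_subsequence:
  assumes t: "0 < t" and Z: "\<And>s. 0 \<le> s \<Longrightarrow> has_wiener_integral M \<gamma> e \<beta> (\<lambda>r. free_group (s - r)) s (Z s)"
  shows "\<exists>r. (\<forall>j. j < r j) \<and> (AE \<omega> in M. (\<lambda>j. \<Sum>n\<le>r j. (if n < r j then t / real (r j) else 1) *
    (norm (Z (real n * (t / real (r j))) \<omega> - discrete_convolution (t / real (r j)) n \<omega>))\<^sup>2) \<longlonglongrightarrow> 0)"
proof -
  let ?P = "\<lambda>j N. j < N \<and> (\<forall>n\<le>N. (\<integral>\<^sup>+\<omega>. ennreal ((norm (Z (real n * (t / real N)) \<omega> - discrete_convolution (t / real N) n \<omega>))\<^sup>2) \<partial>M)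
      \<le> ennreal ((1/2)^j / (t + 1)))"
  have "\<exists>N>j. \<forall>n\<le>N. (\<integral>\<^sup>+\<omega>. ennreal ((norm (Z (real n * (t / real N)) \<omega> - discrete_convolution (t / real N) n \<omega>))\<^sup>2) \<partial>M)
      \<le> ennreal ((1/2)^j / (t + 1))" for j
  proof -
    \<comment> \<open>Makes the bound \<open>4 \<delta> t\<close> of
      \<open>discrete_convolution_error\<close> equal to \<open>(1/2)^j / (t + 1)\<close>.\<close>
    define \<delta> where "\<delta> = (1/2)^j / (t + 1) / (4 * t)"
    have \<delta>: "0 < \<delta>" using t by (simp add: \<delta>_def)
    from noise_equicontinuous[OF this] obtain d where d: "0 < d" "\<And>a b. \<bar>a - b\<bar> \<le> d \<Longrightarrow>
      (\<Sum>k. ennreal ((norm (free_group a (\<gamma> k *\<^sub>C e k) - free_group b (\<gamma> k *\<^sub>C e k)))\<^sup>2)) \<le> ennreal \<delta>" by blast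
    obtain N0 :: nat where N0: "t / d < real N0" using reals_Archimedean2 by blast
    define N where "N = Suc (max j N0)"
    have N: "j < N" "real N0 < real N" "0 < real N" by (auto simp: N_def)
    have h: "0 < t / real N" using t N by simp
    have "t / d < real N" using N0 N by linarith
    then have hd: "t / real N \<le> d" using d(1) N by (simp add: field_simps)
    have "(\<integral>\<^sup>+\<omega>. ennreal ((norm (Z (real n * (t / real N)) \<omega> - discrete_convolution (t / real N) n \<omega>))\<^sup>2) \<partial>M)
      \<le> ennreal ((1/2)^j / (t + 1))" if n: "n \<le> N" for n
    proof -
      have "real n * (t / real N) \<le> real N * (t / real N)" using n h by (intro mult_right_mono) auto
      then have nt: "real n * (t / real N) \<le> t" using N by simp
      have "(\<integral>\<^sup>+\<omega>. ennreal ((norm (Z (real n * (t / real N)) \<omega> - discrete_convolution (t / real N) n \<omega>))\<^sup>2) \<partial>M)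
        \<le> ennreal (4 * \<delta> * (real n * (t / real N)))"
      proof (rule discrete_convolution_error[OF h])
        show "has_wiener_integral M \<gamma> e \<beta> (\<lambda>s. free_group (real n * (t / real N) - s)) (real n * (t / real N)) (Z (real n * (t / real N)))"
          by (rule Z, rule mult_nonneg_nonneg) (use h in auto)
      qed (use hd \<delta> d(2) in auto)
      also have "\<dots> \<le> ennreal (4 * \<delta> * t)" using nt \<delta> by (intro ennreal_leI mult_left_mono) auto
      also have "4 * \<delta> * t = (1/2)^j / (t + 1)" using t by (simp add: \<delta>_def)
      finally show ?thesis .
    qed
    then show ?thesis using N(1) by blast
  qed
  then have "\<forall>j. \<exists>N. ?P j N" by (rule allI)
  then have "\<exists>r. \<forall>j. ?P j (r j)" by (rule choice)
  then obtain r where rP: "\<forall>j. ?P j (r j)" by (rule exE)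
  have r: "j < r j" "n \<le> r j \<Longrightarrow>
      (\<integral>\<^sup>+\<omega>. ennreal ((norm (Z (real n * (t / real (r j))) \<omega> - discrete_convolution (t / real (r j)) n \<omega>))\<^sup>2) \<partial>M)
      \<le> ennreal ((1/2)^j / (t + 1))" for j n
    using rP[rule_format, of j] by simp_all
  define h where "h j = t / real (r j)" for j
  have h: "0 < h j" for j using t r(1)[of j] by (simp add: h_def)
  \<comment> \<open>Measurable versions of the discrete convolutions, needed to exchange sums and
    expectations.\<close>
  define Y where "Y j n = (SOME Y. Y \<in> borel_measurable M \<and> (AE \<omega> in M. discrete_convolution (h j) n \<omega> = Y \<omega>))" for j n
  have Y: "Y j n \<in> borel_measurable M" "AE \<omega> in M. discrete_convolution (h j) n \<omega> = Y j n \<omega>" for j n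
    using someI_ex[OF AE_measurable_discrete_convolution[OF h[of j], of n, unfolded Bex_def]]
    unfolding Y_def by blast+
  define c where "c j n = (if n < r j then h j else 1)" for j n
  have c0: "0 \<le> c j n" for j n using h[of j] by (simp add: c_def)
  define f where "f j \<omega> = (\<Sum>n\<le>r j. c j n * (norm (Z (real n * h j) \<omega> - Y j n \<omega>))\<^sup>2)" for j \<omega>
  have Zm: "Z (real n * h j) \<in> borel_measurable M" for n j
    using Z[of "real n * h j"] h[of j] unfolding has_wiener_integral_def by (simp only: mult_nonneg_nonneg of_nat_0_le_iff less_imp_le simp_thms)
  note [measurable] = measurable_compose[OF borel_measurable_L2_diff[OF onb Zm Y(1)] borel_measurable_norm]
  have "AE \<omega> in M. (\<lambda>j. f j \<omega>) \<longlonglongrightarrow> 0"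
  proof (rule AE_tendsto_zero)
    show "f j \<in> borel_measurable M" for j unfolding f_def by measurable
    show "0 \<le> f j \<omega>" for j \<omega> unfolding f_def using c0 by (intro sum_nonneg) auto
    fix j
    have "(\<integral>\<^sup>+\<omega>. ennreal (f j \<omega>) \<partial>M) = (\<integral>\<^sup>+\<omega>. (\<Sum>n\<le>r j. ennreal (c j n) * ennreal ((norm (Z (real n * h j) \<omega> - Y j n \<omega>))\<^sup>2)) \<partial>M)"
      unfolding f_def using c0 by (intro nn_integral_cong) (simp add: sum_ennreal[symmetric] ennreal_mult)
    also have "\<dots> = (\<Sum>n\<le>r j. ennreal (c j n) * (\<integral>\<^sup>+\<omega>. ennreal ((norm (Z (real n * h j) \<omega> - Y j n \<omega>))\<^sup>2) \<partial>M))"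
      by (subst nn_integral_sum) (auto simp: nn_integral_cmult)
    also have "\<dots> \<le> (\<Sum>n\<le>r j. ennreal (c j n) * ennreal ((1/2)^j / (t + 1)))"
    proof (intro sum_mono mult_left_mono)
      fix n assume "n \<in> {..r j}"
      moreover have "(\<integral>\<^sup>+\<omega>. ennreal ((norm (Z (real n * h j) \<omega> - Y j n \<omega>))\<^sup>2) \<partial>M) =
         (\<integral>\<^sup>+\<omega>. ennreal ((norm (Z (real n * h j) \<omega> - discrete_convolution (h j) n \<omega>))\<^sup>2) \<partial>M)"
        using Y(2)[of j n] by (intro nn_integral_cong_AE, eventually_elim) simp
      ultimately show "(\<integral>\<^sup>+\<omega>. ennreal ((norm (Z (real n * h j) \<omega> - Y j n \<omega>))\<^sup>2) \<partial>M) \<le> ennreal ((1/2)^j / (t + 1))"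
        using r(2)[of n j] by (simp add: h_def)
    qed simp
    also have "\<dots> = ennreal ((\<Sum>n\<le>r j. c j n) * ((1/2)^j / (t + 1)))"
      unfolding sum_distrib_right[symmetric] sum_ennreal[OF c0]
      using c0 t by (intro ennreal_mult[symmetric] sum_nonneg) auto
    also have "(\<Sum>n\<le>r j. c j n) = t + 1"
    proof -
      have "(\<Sum>n<r j. c j n) = real (r j) * h j" by (simp add: c_def)
      also have "\<dots> = t" using r(1)[of j] by (simp add: h_def)
      finally show ?thesis unfolding lessThan_Suc_atMost[symmetric] by (simp add: c_def)
    qed
    also have "(t + 1) * ((1/2)^j / (t + 1)) = (1/2)^j" using t by simp
    finally show "(\<integral>\<^sup>+\<omega>. ennreal (f j \<omega>) \<partial>M) \<le> ennreal ((1/2)^j)" .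
  qed
  moreover have "AE \<omega> in M. \<forall>j n. discrete_convolution (h j) n \<omega> = Y j n \<omega>"
    unfolding AE_all_countable using Y(2) by blast
  ultimately have "AE \<omega> in M. (\<lambda>j. \<Sum>n\<le>r j. c j n * (norm (Z (real n * h j) \<omega> - discrete_convolution (h j) n \<omega>))\<^sup>2) \<longlonglongrightarrow> 0"
    by eventually_elim (simp add: f_def)
  then show ?thesis using r(1) unfolding c_def h_def by blast
qed

end

section \<open>Convergence to the exact solution\<close>

text \<open>Discrete Duhamel formula, put in the same form as the mild equation so that both can be
  subtracted term by term. Starting from \<open>free_group 0 u0\<close> makes it hold at
  \<open>n = 0\<close>.\<close>

lemma scheme_closed_form:
  fixes w D P :: "nat \<Rightarrow> 'd::finite L2"
  assumes "w 0 = free_group 0 u0"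
    and w: "\<And>n. w (Suc n) = free_group h (w n - (\<i> * of_real h) *\<^sub>C P n - (\<i> * of_real \<alpha>) *\<^sub>C D n)"
  shows "w n = free_group (real n * h) u0
    - \<i> *\<^sub>C (\<Sum>i<n. h *\<^sub>R free_group (real n * h - real i * h) (P i))
    - (\<i> * of_real \<alpha>) *\<^sub>C (\<Sum>i<n. free_group (real n * h - real i * h) (D i))"
proof (induct n)
  case (Suc n)
  have sc: "free_group h (r *\<^sub>R v) = r *\<^sub>R free_group h v" for r and v :: "'d L2"
    by (simp add: scaleR_L2_def free_group_scaleC)
  have shift: "h + real n * h = real (Suc n) * h" "h + (real n * h - real i * h) = real (Suc n) * h - real i * h" for i
    by (simp_all add: algebra_simps)
  have last: "real (Suc n) * h - real n * h = h" by (simp add: algebra_simps)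
  have "w (Suc n) = free_group (real (Suc n) * h) u0
    - \<i> *\<^sub>C (\<Sum>i<n. h *\<^sub>R free_group (real (Suc n) * h - real i * h) (P i))
    - (\<i> * of_real \<alpha>) *\<^sub>C (\<Sum>i<n. free_group (real (Suc n) * h - real i * h) (D i))
    - (\<i> * of_real h) *\<^sub>C free_group h (P n) - (\<i> * of_real \<alpha>) *\<^sub>C free_group h (D n)"
    unfolding w[of n] Suc free_group_diff free_group_scaleC free_group_sum sc free_group_free_group shift ..
  moreover have "(\<i> * of_real h) *\<^sub>C free_group h (P n) = \<i> *\<^sub>C (h *\<^sub>R free_group h (P n))"
    by (simp add: scaleR_L2_def scaleC_scaleC)
  ultimately show ?case
    by (simp only: sum.lessThan_Suc last scaleC_add_right) (simp add: algebra_simps)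
qed (use assms(1) in simp)

text \<open>A deterministic estimate for one path: the difference consists of a quadrature error, a
  Lipschitz term fed back through Gronwall, and the error of the stochastic convolution, which
  enters only through the weighted sum \<open>f\<close>.\<close>

lemma path_error:
  fixes u :: "real \<Rightarrow> 'd::finite L2" and F :: "'d L2 \<Rightarrow> 'd L2" and w D z :: "nat \<Rightarrow> 'd L2"
  assumes N: "0 < N" and t: "0 < t" and h: "h = t / real N"
    and w0: "w 0 = free_group 0 u0"
    and w: "\<And>n. w (Suc n) = free_group h (w n - (\<i> * of_real h) *\<^sub>C F (radial_proj R (w n)) - (\<i> * of_real \<alpha>) *\<^sub>C D n)"
    and u: "\<And>n. u (real n * h) = free_group (real n * h) u0
      - \<i> *\<^sub>C integral {0..real n * h} (\<lambda>s. free_group (real n * h - s) (F (u s))) - (\<i> * of_real \<alpha>) *\<^sub>C z n"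
    and R: "\<And>s. s \<in> {0..t} \<Longrightarrow> norm (u s) \<le> R"
    and L: "0 \<le> L" "\<And>v w. norm (F (radial_proj R v) - F (radial_proj R w)) \<le> L * norm (v - w)"
    and \<alpha>: "0 \<le> \<alpha>"
    and Riem: "\<And>n. n \<le> N \<Longrightarrow> norm (integral {0..real n * h} (\<lambda>s. free_group (real n * h - s) (F (u s))) -
      (\<Sum>i<n. h *\<^sub>R free_group (real n * h - real i * h) (F (u (real i * h))))) \<le> \<epsilon>"
    and f: "f = (\<Sum>n\<le>N. (if n < N then h else 1) *
      (norm (z n - (\<Sum>i<n. free_group (real n * h - real i * h) (D i))))\<^sup>2)"
  shows "norm (w N - u t) \<le> \<epsilon> + \<alpha> * sqrt f + L * exp (L * t) * (t * \<epsilon> + \<alpha> * sqrt (t * f))"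
proof -
  have hp: "0 < h" and Nh: "real N * h = t" using N t by (auto simp: h)
  define x where "x n = norm (z n - (\<Sum>i<n. free_group (real n * h - real i * h) (D i)))" for n
  define \<rho> where "\<rho> n = \<epsilon> + \<alpha> * x n" for n
  have x0: "0 \<le> x n" for n by (simp add: x_def)
  have \<epsilon>0: "0 \<le> \<epsilon>" using Riem[of 0] by simp
  have f_eq: "f = h * (\<Sum>n<N. (x n)\<^sup>2) + (x N)\<^sup>2"
  proof -
    have "f = (\<Sum>n<N. h * (x n)\<^sup>2) + (x N)\<^sup>2"
      unfolding f lessThan_Suc_atMost[symmetric] x_def by simp
    then show ?thesis by (simp add: sum_distrib_left)
  qed
  have d: "norm (w n - u (real n * h)) \<le> \<rho> n + (L * h) * (\<Sum>i<n. norm (w i - u (real i * h)))" if n: "n \<le> N" for n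
  proof -
    have tri: "norm a \<le> norm b + norm c + norm d" if "a = b + c + d" for a b c d :: "'d L2"
      using norm_triangle_ineq[of "b + c" d] norm_triangle_ineq[of b c] unfolding that by linarith
    let ?S = "\<lambda>i. free_group (real n * h - real i * h) :: 'd L2 \<Rightarrow> 'd L2"
    let ?I = "integral {0..real n * h} (\<lambda>s. free_group (real n * h - s) (F (u s)))"
    let ?P = "\<Sum>i<n. h *\<^sub>R ?S i (F (radial_proj R (w i)))" and ?Q = "\<Sum>i<n. h *\<^sub>R ?S i (F (u (real i * h)))"
    have "w n - u (real n * h) = \<i> *\<^sub>C (?I - ?Q) + \<i> *\<^sub>C (?Q - ?P) + (\<i> * of_real \<alpha>) *\<^sub>C (z n - (\<Sum>i<n. ?S i (D i)))"
    proof -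
      have "w n = free_group (real n * h) u0 - \<i> *\<^sub>C ?P - (\<i> * of_real \<alpha>) *\<^sub>C (\<Sum>i<n. ?S i (D i))"
        by (rule scheme_closed_form[where P = "\<lambda>i. F (radial_proj R (w i))", OF w0 w])
      then show ?thesis using u[of n] by (simp add: scaleC_diff_right)
    qed
    then have "norm (w n - u (real n * h)) \<le> norm (\<i> *\<^sub>C (?I - ?Q)) + norm (\<i> *\<^sub>C (?Q - ?P)) +
        norm ((\<i> * of_real \<alpha>) *\<^sub>C (z n - (\<Sum>i<n. ?S i (D i))))"
      by (rule tri)
    moreover have "norm ((\<i> * of_real \<alpha>) *\<^sub>C (z n - (\<Sum>i<n. ?S i (D i)))) = \<alpha> * x n"
      using \<alpha> by (simp add: norm_scaleC norm_mult x_def)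
    moreover have "norm (\<i> *\<^sub>C (?I - ?Q)) \<le> \<epsilon>" using Riem[OF n] by (simp add: norm_scaleC)
    moreover have "norm (\<i> *\<^sub>C (?Q - ?P)) \<le> (L * h) * (\<Sum>i<n. norm (w i - u (real i * h)))"
    proof -
      have "norm (\<i> *\<^sub>C (?Q - ?P)) = norm (\<Sum>i<n. h *\<^sub>R ?S i (F (u (real i * h)) - F (radial_proj R (w i))))"
        by (simp add: norm_scaleC sum_subtractf free_group_diff scaleR_diff_right)
      also have "\<dots> \<le> (\<Sum>i<n. h * (L * norm (w i - u (real i * h))))"
      proof (rule order_trans[OF norm_sum sum_mono])
        fix i assume "i \<in> {..<n}"
        then have "real i * h \<le> real N * h" using n hp by (intro mult_right_mono) auto
        then have "real i * h \<in> {0..t}" using hp Nh by simp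
        \<comment> \<open>The path stays in the ball of radius \<open>R\<close>, so the truncation
          is inactive on the exact solution and matters only for \<open>w\<close>.\<close>
        then have pr: "radial_proj R (u (real i * h)) = u (real i * h)" using R by (intro radial_proj_inside)
        have "norm (?S i (F (u (real i * h)) - F (radial_proj R (w i)))) \<le> norm (F (u (real i * h)) - F (radial_proj R (w i)))"
          by (rule norm_free_group_le)
        also have "\<dots> \<le> L * norm (w i - u (real i * h))"
          using L(2)[of "u (real i * h)" "w i"] unfolding pr by (simp add: norm_minus_commute)
        finally show "norm (h *\<^sub>R ?S i (F (u (real i * h)) - F (radial_proj R (w i)))) \<le> h * (L * norm (w i - u (real i * h)))"
          using hp by (simp add: mult_left_mono)
      qed
      finally show ?thesis by (simp add: sum_distrib_left mult_ac)
    qed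
    ultimately show ?thesis unfolding \<rho>_def by linarith
  qed
  have "norm (w N - u (real N * h)) \<le> \<rho> N + (L * h) * exp ((L * h) * real N) * (\<Sum>i<N. \<rho> i)"
    by (rule discrete_Gronwall[OF _ d]) (use L hp \<alpha> x0 \<epsilon>0 in \<open>auto simp: \<rho>_def\<close>)
  also have "\<dots> = \<rho> N + L * exp (L * t) * (h * (\<Sum>i<N. \<rho> i))"
    using Nh by (simp add: mult_ac)
  finally have main: "norm (w N - u t) \<le> \<rho> N + L * exp (L * t) * (h * (\<Sum>i<N. \<rho> i))" unfolding Nh .
  have s0: "0 \<le> h * (\<Sum>n<N. (x n)\<^sup>2)" using hp by (intro mult_nonneg_nonneg sum_nonneg) auto
  have "(x N)\<^sup>2 \<le> f" using s0 by (simp add: f_eq)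
  then have xN: "x N \<le> sqrt f" by (rule real_le_rsqrt)
  \<comment> \<open>Cauchy-Schwarz over the \<open>N\<close> grid points with \<open>N h = t\<close>
    turns the time average of errors into one of squared errors.\<close>
  have "(h * (\<Sum>i<N. x i))\<^sup>2 \<le> t * f"
  proof -
    have "(\<Sum>i<N. x i)\<^sup>2 \<le> real N * (\<Sum>i<N. (x i)\<^sup>2)"
      using sum_squared_le_sum_of_squares[of x "{..<N}"] by (simp add: mult.commute)
    then have "h\<^sup>2 * (\<Sum>i<N. x i)\<^sup>2 \<le> h\<^sup>2 * (real N * (\<Sum>i<N. (x i)\<^sup>2))" by (intro mult_left_mono) auto
    also have "\<dots> = (real N * h) * (h * (\<Sum>i<N. (x i)\<^sup>2))" by (simp add: power2_eq_square mult_ac)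
    also have "\<dots> \<le> t * f" unfolding Nh f_eq using t by (intro mult_left_mono) auto
    finally show ?thesis by (simp add: power_mult_distrib)
  qed
  then have "h * (\<Sum>i<N. x i) \<le> sqrt (t * f)" by (rule real_le_rsqrt)
  then have "\<alpha> * (h * (\<Sum>i<N. x i)) \<le> \<alpha> * sqrt (t * f)" using \<alpha> by (rule mult_left_mono)
  moreover have "h * (\<Sum>i<N. \<rho> i) = t * \<epsilon> + \<alpha> * (h * (\<Sum>i<N. x i))"
    unfolding \<rho>_def Nh[symmetric] by (simp add: sum.distrib sum_distrib_left algebra_simps)
  ultimately have "h * (\<Sum>i<N. \<rho> i) \<le> t * \<epsilon> + \<alpha> * sqrt (t * f)" by simp
  then have "L * exp (L * t) * (h * (\<Sum>i<N. \<rho> i)) \<le> L * exp (L * t) * (t * \<epsilon> + \<alpha> * sqrt (t * f))"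
    using L by (intro mult_left_mono) auto
  moreover have "\<rho> N \<le> \<epsilon> + \<alpha> * sqrt f" unfolding \<rho>_def using xN \<alpha> by (intro add_left_mono mult_left_mono)
  ultimately show ?thesis using main by linarith
qed

lemma continuous_nonlinearity:
  fixes F :: "'d::finite L2 \<Rightarrow> 'd L2"
  assumes N: "nonlinearity V F"
  shows "continuous_on UNIV F"
proof -
  have "isCont F w" for w
  proof -
    define R where "R = norm w + 1"
    have R: "0 < R" by (simp add: R_def add_nonneg_pos)
    obtain L where L: "0 \<le> L" "\<And>u w. norm (F (radial_proj R u) - F (radial_proj R w)) \<le> L * norm (u - w)"
      by (rule truncated_nonlinearity[OF N R]) blast
    have "L-lipschitz_on (ball 0 R) F"
    proof (rule lipschitz_onI)
      fix u v :: "'d L2" assume "u \<in> ball 0 R" "v \<in> ball 0 R"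
      then show "dist (F u) (F v) \<le> L * dist u v"
        using L(2)[of u v] by (simp add: radial_proj_inside dist_norm)
    qed (rule L(1))
    from lipschitz_on_continuous_on[OF this] show ?thesis
      by (rule continuous_on_interior) (simp add: R_def)
  qed
  then show ?thesis by (simp add: continuous_at_imp_continuous_on)
qed

context Q_wiener_noise
begin

lemma measurable_mild_solution:
  assumes "mild_solution M Fs \<gamma> e \<beta> \<alpha> F u0 u" "0 \<le> s"
  shows "u s \<in> borel_measurable M"
proof -
  have "u s \<in> borel_measurable (Fs s)"
    using assms unfolding mild_solution_def by blast
  then show ?thesis by (rule measurable_from_subalg[OF subalgebra_Fs[OF assms(2)]])
qed

lemma nn_integral_le_of_AE_limit:
  assumes f: "\<And>j. f j \<in> borel_measurable M" and lim: "AE \<omega> in M. (\<lambda>j. f j \<omega>) \<longlonglongrightarrow> g \<omega>"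
    and le: "\<forall>\<^sub>F j in sequentially. (\<integral>\<^sup>+\<omega>. f j \<omega> \<partial>M) \<le> (C :: ennreal)"
  shows "(\<integral>\<^sup>+\<omega>. g \<omega> \<partial>M) \<le> C"
proof -
  have "(\<integral>\<^sup>+\<omega>. g \<omega> \<partial>M) = (\<integral>\<^sup>+\<omega>. liminf (\<lambda>j. f j \<omega>) \<partial>M)"
    using lim by (intro nn_integral_cong_AE, eventually_elim) (intro lim_imp_Liminf[symmetric] sequentially_bot)
  also have "\<dots> \<le> liminf (\<lambda>j. \<integral>\<^sup>+\<omega>. f j \<omega> \<partial>M)" by (rule nn_integral_liminf[OF f])
  also have "\<dots> \<le> limsup (\<lambda>j. \<integral>\<^sup>+\<omega>. f j \<omega> \<partial>M)" by (rule Liminf_le_Limsup) simp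
  also have "\<dots> \<le> C" by (rule Limsup_bounded[OF le])
  finally show ?thesis .
qed

text \<open>The exact solution is approximated by the truncated Euler splitting, for which the moment
  bound holds uniformly in the truncation radius; no adaptedness of the solution to the natural
  filtration of the noise has to be established.\<close>

lemma exact_exp_moment_pos:
  fixes F :: "'d L2 \<Rightarrow> 'd L2"
  assumes \<alpha>: "0 < \<alpha>" and \<mu>: "0 < \<mu>" and t: "0 < t" "t \<le> T" and \<kappa>: "\<mu> * \<alpha>\<^sup>2 * T * trace_Q \<gamma> < 1/16"
    and N: "nonlinearity V F" and u: "mild_solution M Fs \<gamma> e \<beta> \<alpha> F u0 u"
  shows "(\<integral>\<^sup>+\<omega>. ennreal (exp (\<mu> * (norm (u t \<omega>))\<^sup>2)) \<partial>M) \<le> ennreal (exp (2 * \<mu> * (norm u0)\<^sup>2 + 2 * \<mu> + 1))"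
    (is "_ \<le> ?C")
proof -
  \<comment> \<open>The mild equation offers a stochastic integral for each time separately; choice
    fixes one family \<open>Z\<close>, which is then used at the countably many grid times.\<close>
  define mild where "mild s Z \<longleftrightarrow> has_wiener_integral M \<gamma> e \<beta> (\<lambda>r. free_group (s - r)) s Z \<and>
    (AE \<omega> in M. u s \<omega> = free_group s u0 - \<i> *\<^sub>C integral {0..s} (\<lambda>r. free_group (s - r) (F (u r \<omega>)))
       - (\<i> * of_real \<alpha>) *\<^sub>C Z \<omega>)" for s Z
  have ex: "\<exists>Z. mild s Z" if "0 \<le> s" for s
    using u that unfolding mild_solution_def mild_def by blast
  have mild: "mild s (SOME Z. mild s Z)" if "0 \<le> s" for s by (rule someI_ex[OF ex[OF that]])
  define Z where "Z s = (SOME Z. mild s Z)" for s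
  have Zint: "has_wiener_integral M \<gamma> e \<beta> (\<lambda>r. free_group (s - r)) s (Z s)" if "0 \<le> s" for s
    using mild[OF that] unfolding mild_def Z_def by blast
  have Zeq: "AE \<omega> in M. u s \<omega> = free_group s u0 - \<i> *\<^sub>C integral {0..s} (\<lambda>r. free_group (s - r) (F (u r \<omega>)))
       - (\<i> * of_real \<alpha>) *\<^sub>C Z s \<omega>" if "0 \<le> s" for s
    using mild[OF that] unfolding mild_def Z_def by blast
  obtain r where r: "\<And>j. j < r j" and rlim: "AE \<omega> in M. (\<lambda>j. \<Sum>n\<le>r j. (if n < r j then t / real (r j) else 1) *
    (norm (Z (real n * (t / real (r j))) \<omega> - discrete_convolution (t / real (r j)) n \<omega>))\<^sup>2) \<longlonglongrightarrow> 0"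
    using discrete_convolution_subsequence[OF t(1) Zint] by blast
  define h where "h j = t / real (r j)" for j
  have rp: "0 < r j" for j using r[of j] by simp
  have h: "0 < h j" and rh: "real (r j) * h j = t" for j using t(1) rp[of j] by (simp_all add: h_def)
  define f where "f j \<omega> = (\<Sum>n\<le>r j. (if n < r j then h j else 1) *
    (norm (Z (real n * h j) \<omega> - discrete_convolution (h j) n \<omega>))\<^sup>2)" for j \<omega>
  have flim: "AE \<omega> in M. (\<lambda>j. f j \<omega>) \<longlonglongrightarrow> 0" using rlim unfolding f_def h_def .
  \<comment> \<open>\<open>m\<close> controls the truncation radius and \<open>j\<close> the step
    size; both approximations use the Wiener increments that drive \<open>u\<close>.\<close>
  define w where "w m j = gaussian_noise.scheme (incr (h j)) (h j) e (\<lambda>k. - (\<i> * of_real \<alpha> * \<gamma> k))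
    (truncated_euler F (real (Suc m)) (h j)) (free_group 0 u0)" for m j
  define D where "D j n \<omega> = W (real (Suc n) * h j) \<omega> - W (real n * h j) \<omega>" for j n \<omega>
  have AE1: "AE \<omega> in M. \<forall>j n. gaussian_noise.dW (incr (h j)) e (\<lambda>k. - (\<i> * of_real \<alpha> * \<gamma> k)) n \<omega> = - ((\<i> * of_real \<alpha>) *\<^sub>C D j n \<omega>)"
    unfolding AE_all_countable[where P = "\<lambda>j \<omega>. \<forall>n. _ j n \<omega>"] D_def using AE_dW_eq[OF h] by blast
  have "0 \<le> real n * h j" for n j using h[of j] by (intro mult_nonneg_nonneg) auto
  note AE_n = Zeq[OF this]
  have AE2: "AE \<omega> in M. \<forall>j n. u (real n * h j) \<omega> = free_group (real n * h j) u0
      - \<i> *\<^sub>C integral {0..real n * h j} (\<lambda>s. free_group (real n * h j - s) (F (u s \<omega>))) - (\<i> * of_real \<alpha>) *\<^sub>C Z (real n * h j) \<omega>"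
    unfolding AE_all_countable using AE_n by blast
  have AE3: "AE \<omega> in M. continuous_on {0..} (\<lambda>s. u s \<omega>)" using u unfolding mild_solution_def by blast
  have wm: "w m j (r j) \<in> borel_measurable M" for m j
  proof -
    interpret gaussian_noise M "incr (h j)" "h j" e "\<lambda>k. - (\<i> * of_real \<alpha> * \<gamma> k)" by (rule gaussian_noise_incr[OF h])
    show ?thesis unfolding w_def
      by (rule measurable_gen_imp[OF measurable_scheme[OF continuous_truncated_euler[OF N]]]) simp
  qed
  note [measurable] = wm
  \<comment> \<open>The limit in \<open>j\<close> is packaged as a \<open>liminf\<close>, measurable
    for every \<open>m\<close>; it agrees almost surely with the target once \<open>m\<close>
    exceeds a radius depending on the path.\<close>
  define g where "g m \<omega> = liminf (\<lambda>j. ennreal (exp (\<mu> * (norm (w m j (r j) \<omega>))\<^sup>2)))" for m \<omega>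
  have gm: "g m \<in> borel_measurable M" for m
    unfolding g_def by measurable
  have gC: "(\<integral>\<^sup>+\<omega>. g m \<omega> \<partial>M) \<le> ?C" for m
  proof -
    obtain L where L: "0 \<le> L" "\<And>w. norm (F (radial_proj (real (Suc m)) w)) \<le> L * real (Suc m)"
      by (rule truncated_nonlinearity[OF N, of "real (Suc m)"]) auto
    define K where "K = L * real (Suc m)"
    have le: "(\<integral>\<^sup>+\<omega>. ennreal (exp (\<mu> * (norm (w m j (r j) \<omega>))\<^sup>2)) \<partial>M) \<le> ?C" if j: "(t * K)\<^sup>2 \<le> real j" for j
    proof -
      have "(\<integral>\<^sup>+\<omega>. ennreal (exp (\<mu> * (norm (w m j (r j) \<omega>))\<^sup>2)) \<partial>M)
        \<le> ennreal (exp (2 * \<mu> * (norm (free_group 0 u0))\<^sup>2 + 2 * \<mu> + 1))"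
        unfolding w_def
      proof (rule scheme_exp_moment_le[OF h \<mu> _ rp \<kappa>])
        show "real (r j) * h j \<le> T" unfolding rh by (rule t(2))
        show "continuous_on UNIV (truncated_euler F (real (Suc m)) (h j))"
          by (rule continuous_truncated_euler[OF N]) simp
        show "(norm (truncated_euler F (real (Suc m)) (h j) w))\<^sup>2 \<le> (norm w)\<^sup>2 + (h j)\<^sup>2 * K\<^sup>2" for w
        proof -
          have "(norm (F (radial_proj (real (Suc m)) w)))\<^sup>2 \<le> K\<^sup>2"
            unfolding K_def using L(2)[of w] by (rule power_mono) simp
          then show ?thesis
            by (subst norm_truncated_euler[OF N]) (auto intro!: add_left_mono mult_left_mono)
        qed
        \<comment> \<open>The accumulated Euler defect \<open>N h^2 K^2\<close> is at most 1 for
          large \<open>j\<close>. How large depends on \<open>m\<close> through \<open>K\<close>,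
          but the resulting moment bound does not.\<close>
        have "real (r j) * ((h j)\<^sup>2 * K\<^sup>2) = (t * K)\<^sup>2 / real (r j)"
          using rp[of j] by (simp add: h_def power2_eq_square field_simps)
        also have "\<dots> \<le> 1" using j r[of j] by (simp add: field_simps)
        finally show "real (r j) * ((h j)\<^sup>2 * K\<^sup>2) \<le> 1" .
      qed
      also have "\<dots> \<le> ?C"
        using \<mu> norm_free_group_le[of 0 u0] by (intro ennreal_leI) (auto intro!: mult_left_mono power_mono)
      finally show ?thesis .
    qed
    obtain j0 :: nat where j0: "(t * K)\<^sup>2 \<le> real j0" using real_arch_simple by blast
    have "(\<integral>\<^sup>+\<omega>. g m \<omega> \<partial>M) \<le> liminf (\<lambda>j. \<integral>\<^sup>+\<omega>. ennreal (exp (\<mu> * (norm (w m j (r j) \<omega>))\<^sup>2)) \<partial>M)"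
      unfolding g_def by (intro nn_integral_liminf) measurable
    also have "\<dots> \<le> limsup (\<lambda>j. \<integral>\<^sup>+\<omega>. ennreal (exp (\<mu> * (norm (w m j (r j) \<omega>))\<^sup>2)) \<partial>M)"
      by (rule Liminf_le_Limsup) simp
    also have "\<dots> \<le> ?C"
      by (rule Limsup_bounded, rule eventually_sequentiallyI[of j0], rule le) (use j0 in linarith)
    finally show ?thesis .
  qed
  have "AE \<omega> in M. (\<lambda>m. g m \<omega>) \<longlonglongrightarrow> ennreal (exp (\<mu> * (norm (u t \<omega>))\<^sup>2))"
    using AE1 AE2 AE3 flim
  proof eventually_elim
    case (elim \<omega>)
    have ct: "continuous_on {0..t} (\<lambda>s. u s \<omega>)" using elim(3) by (rule continuous_on_subset) auto
    have cF: "continuous_on {0..t} (\<lambda>s. F (u s \<omega>))"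
      by (rule continuous_on_compose2[OF continuous_nonlinearity[OF N] ct]) auto
    have "bounded ((\<lambda>s. u s \<omega>) ` {0..t})"
      by (intro compact_imp_bounded compact_continuous_image ct compact_Icc)
    then obtain b where b: "\<And>s. s \<in> {0..t} \<Longrightarrow> norm (u s \<omega>) \<le> b" unfolding bounded_iff by blast
    obtain m0 :: nat where m0: "b \<le> real m0" using real_arch_simple by blast
    \<comment> \<open>For \<open>m\<close> beyond the maximum of the continuous path on
      \<open>{0..t}\<close> the truncation is inactive, so the schemes converge to the exact
      solution itself.\<close>
    have "g m \<omega> = ennreal (exp (\<mu> * (norm (u t \<omega>))\<^sup>2))" if m: "m0 \<le> m" for m
    proof -
      let ?R = "real (Suc m)"
      have R: "norm (u s \<omega>) \<le> ?R" if "s \<in> {0..t}" for s using b[OF that] m0 m by simp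
      obtain L where L: "0 \<le> L" "\<And>v w. norm (F (radial_proj ?R v) - F (radial_proj ?R w)) \<le> L * norm (v - w)"
        by (rule truncated_nonlinearity[OF N, of ?R]) auto
      have "(\<lambda>j. w m j (r j) \<omega>) \<longlonglongrightarrow> u t \<omega>"
      proof (rule LIM_zero_cancel, rule tendstoI)
        fix \<eta> :: real assume \<eta>: "0 < \<eta>"
        \<comment> \<open>Total coefficient of \<open>\<epsilon>\<close> in
          \<open>path_error\<close>; with \<open>\<epsilon> = \<eta> / (2 c)\<close> the quadrature
          error uses up half of \<open>\<eta>\<close>.\<close>
        define c where "c = 1 + L * exp (L * t) * t"
        have c: "1 \<le> c" using L t by (simp add: c_def)
        define \<epsilon> where "\<epsilon> = \<eta> / (2 * c)"
        have \<epsilon>: "0 < \<epsilon>" using \<eta> c by (simp add: \<epsilon>_def)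
        obtain N0 where N0: "\<And>N n. N0 \<le> N \<Longrightarrow> n \<le> N \<Longrightarrow>
          norm (integral {0..real n * (t / real N)} (\<lambda>s. free_group (real n * (t / real N) - s) (F (u s \<omega>))) -
            (\<Sum>i<n. (t / real N) *\<^sub>R free_group (real n * (t / real N) - real i * (t / real N)) (F (u (real i * (t / real N)) \<omega>)))) \<le> \<epsilon>"
          using Riemann_sum_convolution[OF cF t(1) \<epsilon>] by blast
        have "(\<lambda>j. \<alpha> * sqrt (f j \<omega>) + L * exp (L * t) * (\<alpha> * sqrt (t * f j \<omega>))) \<longlonglongrightarrow>
            \<alpha> * sqrt 0 + L * exp (L * t) * (\<alpha> * sqrt (t * 0))"
          by (intro tendsto_intros elim(4))
        then have "(\<lambda>j. \<alpha> * sqrt (f j \<omega>) + L * exp (L * t) * (\<alpha> * sqrt (t * f j \<omega>))) \<longlonglongrightarrow> 0" by simp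
        then have "\<forall>\<^sub>F j in sequentially. \<alpha> * sqrt (f j \<omega>) + L * exp (L * t) * (\<alpha> * sqrt (t * f j \<omega>)) < \<eta> / 2"
          by (rule order_tendstoD(2)) (use \<eta> in simp)
        then show "\<forall>\<^sub>F j in sequentially. dist (w m j (r j) \<omega> - u t \<omega>) 0 < \<eta>"
          using eventually_ge_at_top[of N0]
        proof eventually_elim
          case (elim j)
          interpret gaussian_noise M "incr (h j)" "h j" e "\<lambda>k. - (\<i> * of_real \<alpha> * \<gamma> k)" by (rule gaussian_noise_incr[OF h])
          have "norm (w m j (r j) \<omega> - u t \<omega>) \<le> \<epsilon> + \<alpha> * sqrt (f j \<omega>) + L * exp (L * t) * (t * \<epsilon> + \<alpha> * sqrt (t * f j \<omega>))"
          proof (rule path_error[where h = "h j" and R = ?R and F = F and ?u0.0 = u0 and z = "\<lambda>n. Z (real n * h j) \<omega>"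
                and D = "\<lambda>n. D j n \<omega>" and u = "\<lambda>s. u s \<omega>" and w = "\<lambda>n. w m j n \<omega>"])
            show "w m j 0 \<omega> = free_group 0 u0" by (simp add: w_def)
            show "w m j (Suc n) \<omega> = free_group (h j) (w m j n \<omega> - (\<i> * of_real (h j)) *\<^sub>C F (radial_proj ?R (w m j n \<omega>))
              - (\<i> * of_real \<alpha>) *\<^sub>C D j n \<omega>)" for n
              unfolding w_def scheme.simps \<open>\<forall>j n. gaussian_noise.dW _ e _ n \<omega> = _\<close>[rule_format] truncated_euler_def by simp
            show "f j \<omega> = (\<Sum>n\<le>r j. (if n < r j then h j else 1) *
              (norm (Z (real n * h j) \<omega> - (\<Sum>i<n. free_group (real n * h j - real i * h j) (D j i \<omega>))))\<^sup>2)"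
              unfolding f_def discrete_convolution_def step_integral_def D_def ..
            show "norm (integral {0..real n * h j} (\<lambda>s. free_group (real n * h j - s) (F (u s \<omega>))) -
              (\<Sum>i<n. h j *\<^sub>R free_group (real n * h j - real i * h j) (F (u (real i * h j) \<omega>)))) \<le> \<epsilon>" if "n \<le> r j" for n
              unfolding h_def using elim(2) r[of j] that by (intro N0) auto
          qed (use rp t(1) h_def \<open>\<forall>j n. u (real n * h j) \<omega> = _ j n\<close> R L \<alpha> in auto)
          also have "\<dots> = c * \<epsilon> + (\<alpha> * sqrt (f j \<omega>) + L * exp (L * t) * (\<alpha> * sqrt (t * f j \<omega>)))"
            by (simp add: c_def algebra_simps)
          also have "c * \<epsilon> = \<eta> / 2" using c by (simp add: \<epsilon>_def)
          finally show ?case using elim(1) by (simp add: dist_norm)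
        qed
      qed
      then have "(\<lambda>j. ennreal (exp (\<mu> * (norm (w m j (r j) \<omega>))\<^sup>2))) \<longlonglongrightarrow> ennreal (exp (\<mu> * (norm (u t \<omega>))\<^sup>2))"
        by (intro tendsto_ennrealI tendsto_intros)
      then show ?thesis unfolding g_def by (intro lim_imp_Liminf sequentially_bot)
    qed
    then show ?case by (intro tendsto_eventually eventually_sequentiallyI[of m0]) simp
  qed
  then show ?thesis by (rule nn_integral_le_of_AE_limit[OF gm]) (simp add: gC)
qed

text \<open>A grid on \<open>{0..t}\<close> needs \<open>t > 0\<close>; the remaining time 0 is
  reached from \<open>T / (n + 1)\<close> by path continuity and Fatou's lemma.\<close>

lemma exact_exp_moment:
  fixes F :: "'d L2 \<Rightarrow> 'd L2"
  assumes \<alpha>: "0 < \<alpha>" and \<mu>: "0 < \<mu>" and t: "0 \<le> t" "t \<le> T" and T: "0 < T" and \<kappa>: "\<mu> * \<alpha>\<^sup>2 * T * trace_Q \<gamma> < 1/16"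
    and N: "nonlinearity V F" and u: "mild_solution M Fs \<gamma> e \<beta> \<alpha> F u0 u"
  shows "(\<integral>\<^sup>+\<omega>. ennreal (exp (\<mu> * (norm (u t \<omega>))\<^sup>2)) \<partial>M) \<le> ennreal (exp (2 * \<mu> * (norm u0)\<^sup>2 + 2 * \<mu> + 1))"
proof (cases "t = 0")
  case False
  then show ?thesis using t by (intro exact_exp_moment_pos[OF \<alpha> \<mu> _ _ \<kappa> N u]) auto
next
  case True
  define s where "s n = T / real (Suc n)" for n
  have s: "0 < s n" "s n \<le> T" for n using T by (auto simp: s_def field_simps)
  have s0: "s \<longlonglongrightarrow> 0"
    unfolding s_def divide_inverse by (intro tendsto_mult_right_zero LIMSEQ_inverse_real_of_nat)
  have "AE \<omega> in M. continuous_on {0..} (\<lambda>s. u s \<omega>)" using u unfolding mild_solution_def by blast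
  then have "AE \<omega> in M. (\<lambda>n. ennreal (exp (\<mu> * (norm (u (s n) \<omega>))\<^sup>2))) \<longlonglongrightarrow> ennreal (exp (\<mu> * (norm (u t \<omega>))\<^sup>2))"
  proof eventually_elim
    case (elim \<omega>)
    have "(\<lambda>n. u (s n) \<omega>) \<longlonglongrightarrow> u 0 \<omega>"
      by (rule continuous_on_tendsto_compose[OF elim s0]) (use s in \<open>auto intro!: always_eventually less_imp_le\<close>)
    then show ?case unfolding True by (intro tendsto_ennrealI tendsto_intros)
  qed
  then show ?thesis
  proof (rule nn_integral_le_of_AE_limit[rotated])
    show "\<forall>\<^sub>F j in sequentially. (\<integral>\<^sup>+\<omega>. ennreal (exp (\<mu> * (norm (u (s j) \<omega>))\<^sup>2)) \<partial>M) \<le> ennreal (exp (2 * \<mu> * (norm u0)\<^sup>2 + 2 * \<mu> + 1))"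
      by (intro always_eventually allI exact_exp_moment_pos[OF \<alpha> \<mu> s(1) s(2) \<kappa> N u])
    fix j
    show "(\<lambda>\<omega>. ennreal (exp (\<mu> * (norm (u (s j) \<omega>))\<^sup>2))) \<in> borel_measurable M"
    proof -
      have [measurable]: "u (s j) \<in> borel_measurable M" by (rule measurable_mild_solution[OF u less_imp_le[OF s(1)]])
      show ?thesis by measurable
    qed
  qed
qed

end

theorem theorem11:
  shows "\<exists>\<kappa>>0. \<forall>(\<alpha>::real) (\<gamma> :: nat \<Rightarrow> complex) (e :: nat \<Rightarrow> 'd::finite L2) (u0 :: 'd L2)
      (\<mu>::real) (T::real).
    0 < \<alpha> \<and> complete_orthonormal e \<and> summable (\<lambda>k. (cmod (\<gamma> k))\<^sup>2) \<and> H1_noise \<gamma> e \<and>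
    0 < \<mu> \<and> 0 < T \<and> \<mu> * \<alpha>\<^sup>2 * T * trace_Q \<gamma> < \<kappa> \<longrightarrow>
    (\<exists>C::real. \<forall>(M :: 'w measure) \<F> \<beta> V F.
      stochastic_basis M \<F> \<and> indep_wiener_processes M \<F> \<beta> \<and> nonlinearity V F \<longrightarrow>
      (\<forall>u. mild_solution M \<F> \<gamma> e \<beta> \<alpha> F u0 u \<longrightarrow>
         (\<Squnion>t\<in>{0..T}. \<integral>\<^sup>+\<omega>. ennreal (exp (\<mu> * (norm (u t \<omega>))\<^sup>2)) \<partial>M) \<le> ennreal C) \<and>
      (\<exists>\<tau>s>0. \<tau>s \<le> 1 \<and>
         (\<Squnion>\<tau>\<in>{0<..<\<tau>s}. \<Squnion>n\<in>{n. real n * \<tau> \<le> T}.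
            \<integral>\<^sup>+\<omega>. ennreal (exp (\<mu> * (norm (splitting (Q_wiener \<gamma> e \<beta>) \<alpha> V u0 \<tau> n \<omega>))\<^sup>2)) \<partial>M)
         \<le> ennreal C))"
proof (rule exI[of _ "1/16"], intro conjI allI impI)
  show "(0::real) < 1/16" by simp
  fix \<alpha> :: real and \<gamma> :: "nat \<Rightarrow> complex" and e :: "nat \<Rightarrow> 'd::finite L2" and u0 :: "'d L2" and \<mu> T :: real
  assume H: "0 < \<alpha> \<and> complete_orthonormal e \<and> summable (\<lambda>k. (cmod (\<gamma> k))\<^sup>2) \<and> H1_noise \<gamma> e \<and>
    0 < \<mu> \<and> 0 < T \<and> \<mu> * \<alpha>\<^sup>2 * T * trace_Q \<gamma> < 1/16"
  show "\<exists>C::real. \<forall>(M :: 'w measure) \<F> \<beta> V F.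
      stochastic_basis M \<F> \<and> indep_wiener_processes M \<F> \<beta> \<and> nonlinearity V F \<longrightarrow>
      (\<forall>u. mild_solution M \<F> \<gamma> e \<beta> \<alpha> F u0 u \<longrightarrow>
         (\<Squnion>t\<in>{0..T}. \<integral>\<^sup>+\<omega>. ennreal (exp (\<mu> * (norm (u t \<omega>))\<^sup>2)) \<partial>M) \<le> ennreal C) \<and>
      (\<exists>\<tau>s>0. \<tau>s \<le> 1 \<and>
         (\<Squnion>\<tau>\<in>{0<..<\<tau>s}. \<Squnion>n\<in>{n. real n * \<tau> \<le> T}.
            \<integral>\<^sup>+\<omega>. ennreal (exp (\<mu> * (norm (splitting (Q_wiener \<gamma> e \<beta>) \<alpha> V u0 \<tau> n \<omega>))\<^sup>2)) \<partial>M)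
         \<le> ennreal C)"
  \<comment> \<open>The constant depends on \<open>\<mu>\<close> and \<open>u0\<close> alone and is
    fixed before the probability space and the nonlinearity.\<close>
  proof (rule exI[of _ "exp (2 * \<mu> * (norm u0)\<^sup>2 + 2 * \<mu> + 1)"], intro allI impI)
    fix M :: "'w measure" and \<F> \<beta> V and F :: "'d L2 \<Rightarrow> 'd L2"
    assume A: "stochastic_basis M \<F> \<and> indep_wiener_processes M \<F> \<beta> \<and> nonlinearity V F"
    interpret prob_space M using A by (simp add: stochastic_basis_def)
    interpret Q_wiener_noise M \<F> \<beta> e \<gamma> by standard (use A H in auto)
    let ?C = "ennreal (exp (2 * \<mu> * (norm u0)\<^sup>2 + 2 * \<mu> + 1))"
    show "(\<forall>u. mild_solution M \<F> \<gamma> e \<beta> \<alpha> F u0 u \<longrightarrow>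
         (\<Squnion>t\<in>{0..T}. \<integral>\<^sup>+\<omega>. ennreal (exp (\<mu> * (norm (u t \<omega>))\<^sup>2)) \<partial>M) \<le> ?C) \<and>
      (\<exists>\<tau>s>0. \<tau>s \<le> 1 \<and>
         (\<Squnion>\<tau>\<in>{0<..<\<tau>s}. \<Squnion>n\<in>{n. real n * \<tau> \<le> T}.
            \<integral>\<^sup>+\<omega>. ennreal (exp (\<mu> * (norm (splitting (Q_wiener \<gamma> e \<beta>) \<alpha> V u0 \<tau> n \<omega>))\<^sup>2)) \<partial>M) \<le> ?C)"
    \<comment> \<open>\<open>\<tau>s = 1\<close> works because the moment bound holds for every step
      size: a positive step count with \<open>n \<tau> \<le> T\<close> already forces
      \<open>\<tau> \<le> T\<close>.\<close>
    proof (intro conjI allI impI exI[of _ "1::real"] SUP_least)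
      fix u t assume "mild_solution M \<F> \<gamma> e \<beta> \<alpha> F u0 u" "t \<in> {0..T}"
      then show "(\<integral>\<^sup>+\<omega>. ennreal (exp (\<mu> * (norm (u t \<omega>))\<^sup>2)) \<partial>M) \<le> ?C"
        using H A by (intro exact_exp_moment[of \<alpha> \<mu> t T V F u0 u]) auto
    next
      fix \<tau> n assume "\<tau> \<in> {0<..<1::real}" "n \<in> {n. real n * \<tau> \<le> T}"
      then show "(\<integral>\<^sup>+\<omega>. ennreal (exp (\<mu> * (norm (splitting (Q_wiener \<gamma> e \<beta>) \<alpha> V u0 \<tau> n \<omega>))\<^sup>2)) \<partial>M) \<le> ?C"
        using H A by (intro splitting_exp_moment[of \<tau> \<mu> n T \<alpha> V F u0]) auto
    qed auto
  qed
qed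

end
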